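(* Consider a RAP-modulated fluid process $\{(R_t,\mathbf{A}_t)\}_{t\ge 0}$ with $n^0=0$, let $\tau_-=\inf\{t>0:R_t\le 0\}$, and let $\{\Psi_n\}_{n\ge0}$ be the matrices defined in the context. Then $\{\Psi_n\}_{n\ge 0}$ (with $\Psi_0=0$) satisfy the recursive equation $$C^+\Psi_{n+1}+\Psi_{n+1}C^-=-D^{+-}-\Psi_nD^{-+}\Psi_n,\qquad n\ge0.$$ Furthermore, the limit $\Psi:=\lim_{n\to\infty}\Psi_n$ exists and, for every $\boldsymbol{\alpha}\in\mathfrak{Z}^+$, $$\mathbb{E}_{\boldsymbol{\alpha}}\left[\mathbf{A}_{\tau_-}\mathbb{1}\{\tau_-<\infty\}\right]=\boldsymbol{\alpha}\Psi,\qquad \mathbb{P}_{\boldsymbol{\alpha}}(\tau_-<\infty)=\boldsymbol{\alpha}\Psi\mathbf{1}.$$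
   Context: Setting (RAP-modulated fluid process with $n^0=0$). Elements of state spaces are row vectors; $\mathbf{1}$ is a column vector of ones of appropriate dimension. For $k\in\{+,-\}$ let $n^k\ge 1$, $m^k_1,\dots,m^k_{n^k}\ge1$ be integers, $\eta^k=\sum_i m^k_i$, and split $\mathbb{R}^{\eta^k}$ into $n^k$ consecutive blocks of sizes $m_1^k,\dots,m^k_{n^k}$. For $1\le i\le n^k$ let $\mathfrak{Z}^k_i$ be a subset of $\{\boldsymbol{x}\in\mathbb{R}^{\eta^k}:\boldsymbol{x}$ vanishes outside block $i$ and $\boldsymbol{x}\mathbf{1}=1\}$ which is bounded and minimal, i.e. not contained in any affine subspace of dimension $m^k_i-2$ (the only affine subspace of dimension $-1$ is $\varnothing$). Put $\mathfrak{Z}^k=\bigcup_i\mathfrak{Z}^k_i$; $\mathfrak{Z}^+$ and $\mathfrak{Z}^-$ are regarded as lying in different spaces, hence disjoint. Given are real matrices $C^k_{ij}\in\mathbb{R}^{m^k_i\times m^k_j}$ and $D^{k\ell}_{ij}\in\mathbb{R}^{m^k_i\times m^\ell_j}$ ($\ell\ne k$); let $C^k=(C^k_{ij})_{i,j}\in\mathbb{R}^{\eta^k\times\eta^k}$ and $D^{k\ell}=(D^{k\ell}_{ij})_{i,j}\in\mathbb{R}^{\eta^k\times\eta^\ell}$ be the full block matrices, $\Gamma^k=\mathrm{diag}(C^k_{11},\dots,C^k_{n^kn^k})$, and let $\widehat C^k_{ij}$ ($i\neq j$), $\widehat D^{k\ell}_{ij}$ be the matrices of the sizes of $C^k$, $D^{k\ell}$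 whose $(i,j)$ block is $C^k_{ij}$, $D^{k\ell}_{ij}$ and which are zero elsewhere. Assume $C^k\mathbf{1}+D^{k\ell}\mathbf{1}=\mathbf{0}$ for $k\neq\ell$. The orbit process $\{\mathbf{A}_t\}_{t\ge0}$ is a càdlàg piecewise-deterministic Markov process on $\mathfrak{Z}^+\cup\mathfrak{Z}^-$: with no jumps after $t$ and $\mathbf{A}_t\in\mathfrak{Z}^k$, $\mathbf{A}_{t+r}=\mathbf{A}_te^{\Gamma^kr}/(\mathbf{A}_te^{\Gamma^kr}\mathbf{1})\in\mathfrak{Z}^k$; from a state $\boldsymbol{a}\in\mathfrak{Z}^k_i$ it jumps to $\boldsymbol{a}\widehat C^k_{ij}/(\boldsymbol{a}\widehat C^k_{ij}\mathbf{1})\in\mathfrak{Z}^k_j$ ($j\ne i$) with intensity $\boldsymbol{a}\widehat C^k_{ij}\mathbf{1}\ge0$, and to $\boldsymbol{a}\widehat D^{k\ell}_{ij}/(\boldsymbol{a}\widehat D^{k\ell}_{ij}\mathbf{1})\in\mathfrak{Z}^\ell_j$ ($\ell\neq k$) with intensity $\boldsymbol{a}\widehat D^{k\ell}_{ij}\mathbf{1}\ge0$. It is assumed that the data are such that all these intensities are nonnegative and all these points lie in the indicated sets. The level process is $R_t=\int_0^t(\mathbb{1}\{\mathbf{A}_s\in\mathfrak{Z}^+\}-\mathbb{1}\{\mathbf{A}_s\in\mathfrak{Z}^-\})\,\mathrm{d}s$. Nontriviality assumption: for $k\in\{+,-\}$ and all $\boldsymbol{\alpha}\in\mathfrak{Z}^k$,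 $\mathbb{P}(\mathbf{A}_s\in\mathfrak{Z}^k\ \forall s\in[0,t]\mid\mathbf{A}_0=\boldsymbol{\alpha})\to0$ as $t\to\infty$. $\mathbb{P}_{\boldsymbol{\alpha}},\mathbb{E}_{\boldsymbol{\alpha}}$ denote law and expectation given $\mathbf{A}_0=\boldsymbol{\alpha}$. The matrices $\Psi_n\in\mathbb{R}^{\eta^+\times\eta^-}$ are defined by $\Psi_0=0$ and $\Psi_n=\int_0^\infty e^{C^+y}(D^{+-}+\Psi_{n-1}D^{-+}\Psi_{n-1})e^{C^-y}\,\mathrm{d}y$ for $n\ge1$.
   Formalization: Where a jump intensity (the row sum of a·Ĉ_ij or a·D̂_ij) is zero, the post-jump point is undefined (division by zero); the row vector a·Ĉ_ij or a·D̂_ij itself is then assumed to be zero, since ignoring such cases makes the claim false. *)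

theory Defs
  imports "HOL-Probability.Probability"
begin

section \<open>Matrices\<close>

text \<open>
  Vectors are row vectors, so matrices act from the right with \<open>v*\<close>. In \<open>real ^ 'n\<close> the constant
  \<open>1\<close> is the all-ones vector, and \<open>x \<bullet> 1\<close> is the entry sum of \<open>x\<close>. The product \<open>*\<close> on
  \<open>real ^ 'n ^ 'n\<close> is componentwise, so the library function \<open>exp\<close> is not the matrix exponential.
\<close>

definition mexp :: "real ^ 'n ^ 'n \<Rightarrow> real ^ 'n ^ 'n" where
  "mexp M = (\<Sum>k. (1 / fact k) *\<^sub>R (((**) M ^^ k) (mat 1)))"

text \<open>
  A map \<open>b :: 'n \<Rightarrow> 'i\<close> from coordinates to block labels encodes a splitting into blocks: block \<open>i\<close>
  consists of the coordinates \<open>p\<close> with \<open>b p = i\<close>. Index types carry no order, so that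
  the blocks are consecutive is only a matter of how the coordinates are listed.
\<close>

definition block_at :: "('r \<Rightarrow> 'a) \<Rightarrow> ('c \<Rightarrow> 'b) \<Rightarrow> real ^ 'c ^ 'r \<Rightarrow> 'a \<Rightarrow> 'b \<Rightarrow> real ^ 'c ^ 'r" where
  "block_at b c M i j = (\<chi> p q. if b p = i \<and> c q = j then M $ p $ q else 0)"

definition block_diag :: "('n \<Rightarrow> 'i) \<Rightarrow> real ^ 'n ^ 'n \<Rightarrow> real ^ 'n ^ 'n" where
  "block_diag b M = (\<chi> p q. if b p = b q then M $ p $ q else 0)"

definition normalise :: "real ^ 'n \<Rightarrow> real ^ 'n" where
  "normalise x = (1 / (x \<bullet> 1)) *\<^sub>R x"


section \<open>Piecewise-deterministic Markov processes\<close>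

text \<open>
  \<open>S n \<omega> \<in> (0, \<infinity>]\<close> is the time between the \<open>n\<close>-th and the \<open>(n+1)\<close>-st jump and \<open>L n \<omega>\<close> the kind of
  the \<open>(n+1)\<close>-st jump. From the jump time \<open>\<infinity>\<close> onwards \<open>post_jump\<close> and \<open>L\<close> are irrelevant.
\<close>

definition jump_time :: "(nat \<Rightarrow> 'w \<Rightarrow> ereal) \<Rightarrow> nat \<Rightarrow> 'w \<Rightarrow> ereal" where
  "jump_time S n \<omega> = (\<Sum>k<n. S k \<omega>)"

primrec post_jump :: "(real \<Rightarrow> 's \<Rightarrow> 's) \<Rightarrow> ('l \<Rightarrow> 's \<Rightarrow> 's) \<Rightarrow> 's
    \<Rightarrow> (nat \<Rightarrow> 'w \<Rightarrow> ereal) \<Rightarrow> (nat \<Rightarrow> 'w \<Rightarrow> 'l) \<Rightarrow> nat \<Rightarrow> 'w \<Rightarrow> 's" where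
  "post_jump flow jump x S L 0 \<omega> = x"
| "post_jump flow jump x S L (Suc n) \<omega> =
     jump (L n \<omega>) (flow (real_of_ereal (S n \<omega>)) (post_jump flow jump x S L n \<omega>))"

definition history :: "'w measure \<Rightarrow> (nat \<Rightarrow> 'w \<Rightarrow> ereal) \<Rightarrow> (nat \<Rightarrow> 'w \<Rightarrow> 'l) \<Rightarrow> nat \<Rightarrow> 'w measure" where
  "history M S L n = vimage_algebra (space M) (\<lambda>\<omega>. \<lambda>k\<in>{..<n}. (S k \<omega>, L k \<omega>))
     (PiM {..<n} (\<lambda>_. borel \<Otimes>\<^sub>M count_space UNIV))"

text \<open>
  Davis' definition of a PDMP started at \<open>x\<close>: between jumps the process follows \<open>flow\<close>; from a state
  \<open>a\<close> it jumps to \<open>jump l a\<close> with intensity \<open>rate l a\<close>, i.e. given the first \<open>n\<close> jumps, the next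
  holding time and kind have the joint density
  \<open>rate l (a\<^sub>s) exp (- \<integral>\<^sub>0\<^sup>s \<Sum>k. rate k (a\<^sub>v) dv)\<close>, where \<open>a\<^sub>s\<close> is the flow from the
  last post-jump state. Only finitely many jumps happen in bounded time, so for continuous flows the paths
  are cadlag. The path properties hold for every outcome, not just almost surely.
\<close>

definition pdmp :: "'w measure \<Rightarrow> (real \<Rightarrow> 'w \<Rightarrow> 's) \<Rightarrow> 's set \<Rightarrow> (real \<Rightarrow> 's \<Rightarrow> 's)
    \<Rightarrow> ('l::finite \<Rightarrow> 's \<Rightarrow> real) \<Rightarrow> ('l \<Rightarrow> 's \<Rightarrow> 's) \<Rightarrow> 's \<Rightarrow> bool" where
  "pdmp M X E flow rate jump x \<longleftrightarrow> prob_space M \<and>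
     (\<exists>S L.
        (\<forall>n. S n \<in> borel_measurable M \<and> L n \<in> measurable M (count_space UNIV)) \<and>
        (\<forall>\<omega>\<in>space M.
           (\<forall>n. 0 < S n \<omega>) \<and>
           (\<forall>t. \<exists>n. ereal t < jump_time S n \<omega>) \<and>
           (\<forall>t\<ge>0. X t \<omega> \<in> E) \<and>
           (\<forall>n t. jump_time S n \<omega> \<le> ereal t \<and> ereal t < jump_time S (Suc n) \<omega> \<longrightarrow>
              X t \<omega> = flow (t - real_of_ereal (jump_time S n \<omega>))
                         (post_jump flow jump x S L n \<omega>))) \<and>
        (\<forall>n l u. 0 \<le> u \<longrightarrow>
           (AE \<omega> in M. jump_time S n \<omega> < \<infinity> \<longrightarrow>
              real_cond_exp M (history M S L n)
                (indicator {\<omega>\<in>space M. S n \<omega> \<le> ereal u \<and> L n \<omega> = l}) \<omega> =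
              (LBINT s:{0..u}. rate l (flow s (post_jump flow jump x S L n \<omega>)) *
                 exp (- (LBINT v:{0..s}. \<Sum>k\<in>UNIV. rate k (flow v (post_jump flow jump x S L n \<omega>))))))))"


section \<open>RAP-modulated fluid processes without zero phases\<close>

text \<open>
  \<open>'p\<close> and \<open>'m\<close> index the coordinates of the positive and the negative space (\<open>\<eta>\<^sup>+ = CARD('p)\<close>,
  \<open>\<eta>\<^sup>- = CARD('m)\<close>), and \<open>'i\<close> and \<open>'j\<close> their blocks (\<open>n\<^sup>+ = CARD('i)\<close>, \<open>n\<^sup>- = CARD('j)\<close>).
\<close>

record ('p::finite, 'm::finite, 'i::finite, 'j::finite) rap =
  blk_p :: "'p \<Rightarrow> 'i"
  blk_m :: "'m \<Rightarrow> 'j"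
  Zset_p :: "'i \<Rightarrow> (real ^ 'p) set"
  Zset_m :: "'j \<Rightarrow> (real ^ 'm) set"
  C_p :: "real ^ 'p ^ 'p"
  C_m :: "real ^ 'm ^ 'm"
  D_pm :: "real ^ 'm ^ 'p"
  D_mp :: "real ^ 'p ^ 'm"

text \<open>The sum type makes the positive and the negative orbits disjoint.\<close>

type_synonym ('p, 'm) orbit = "(real ^ 'p) + (real ^ 'm)"

definition orbits_p :: "('p::finite, 'm::finite, 'i::finite, 'j::finite) rap \<Rightarrow> ('p, 'm) orbit set" where
  "orbits_p \<R> = Inl ` (\<Union>i. Zset_p \<R> i)"

definition orbits_m :: "('p::finite, 'm::finite, 'i::finite, 'j::finite) rap \<Rightarrow> ('p, 'm) orbit set" where
  "orbits_m \<R> = Inr ` (\<Union>j. Zset_m \<R> j)"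

fun orbit_flow :: "('p::finite, 'm::finite, 'i::finite, 'j::finite) rap \<Rightarrow> real
    \<Rightarrow> ('p, 'm) orbit \<Rightarrow> ('p, 'm) orbit" where
  "orbit_flow \<R> r (Inl a) = Inl (normalise (a v* mexp (r *\<^sub>R block_diag (blk_p \<R>) (C_p \<R>))))"
| "orbit_flow \<R> r (Inr a) = Inr (normalise (a v* mexp (r *\<^sub>R block_diag (blk_m \<R>) (C_m \<R>))))"

text \<open>The kind of a jump is the pair of its source block and its target block.\<close>

fun orbit_rate :: "('p::finite, 'm::finite, 'i::finite, 'j::finite) rap
    \<Rightarrow> ('i + 'j) \<times> ('i + 'j) \<Rightarrow> ('p, 'm) orbit \<Rightarrow> real" where
  "orbit_rate \<R> (Inl i, Inl j) (Inl a) =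
     (if a \<in> Zset_p \<R> i \<and> i \<noteq> j then (a v* block_at (blk_p \<R>) (blk_p \<R>) (C_p \<R>) i j) \<bullet> 1 else 0)"
| "orbit_rate \<R> (Inl i, Inr j) (Inl a) =
     (if a \<in> Zset_p \<R> i then (a v* block_at (blk_p \<R>) (blk_m \<R>) (D_pm \<R>) i j) \<bullet> 1 else 0)"
| "orbit_rate \<R> (Inr i, Inl j) (Inr a) =
     (if a \<in> Zset_m \<R> i then (a v* block_at (blk_m \<R>) (blk_p \<R>) (D_mp \<R>) i j) \<bullet> 1 else 0)"
| "orbit_rate \<R> (Inr i, Inr j) (Inr a) =
     (if a \<in> Zset_m \<R> i \<and> i \<noteq> j then (a v* block_at (blk_m \<R>) (blk_m \<R>) (C_m \<R>) i j) \<bullet> 1 else 0)"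
| "orbit_rate \<R> _ _ = 0"

text \<open>In the last equation the rate is 0, so the value there does not matter.\<close>

fun orbit_jump :: "('p::finite, 'm::finite, 'i::finite, 'j::finite) rap
    \<Rightarrow> ('i + 'j) \<times> ('i + 'j) \<Rightarrow> ('p, 'm) orbit \<Rightarrow> ('p, 'm) orbit" where
  "orbit_jump \<R> (Inl i, Inl j) (Inl a) =
     Inl (normalise (a v* block_at (blk_p \<R>) (blk_p \<R>) (C_p \<R>) i j))"
| "orbit_jump \<R> (Inl i, Inr j) (Inl a) =
     Inr (normalise (a v* block_at (blk_p \<R>) (blk_m \<R>) (D_pm \<R>) i j))"
| "orbit_jump \<R> (Inr i, Inl j) (Inr a) =
     Inl (normalise (a v* block_at (blk_m \<R>) (blk_p \<R>) (D_mp \<R>) i j))"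
| "orbit_jump \<R> (Inr i, Inr j) (Inr a) =
     Inr (normalise (a v* block_at (blk_m \<R>) (blk_m \<R>) (C_m \<R>) i j))"
| "orbit_jump \<R> _ a = a"

text \<open>Note that \<open>aff_dim {} = -1\<close>, so minimality includes nonemptiness of blocks of size 1.\<close>

definition orbit_family :: "('n::finite \<Rightarrow> 'i) \<Rightarrow> ('i \<Rightarrow> (real ^ 'n) set) \<Rightarrow> bool" where
  "orbit_family b Z \<longleftrightarrow>
     (\<forall>i. (\<forall>x\<in>Z i. (\<forall>p. b p \<noteq> i \<longrightarrow> x $ p = 0) \<and> x \<bullet> 1 = 1) \<and>
          bounded (Z i) \<and>
          (\<forall>V. affine V \<and> aff_dim V = int (card {p. b p = i}) - 2 \<longrightarrow> \<not> Z i \<subseteq> V))"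

text \<open>
  \<open>w\<close> has nonnegative mass and \<open>w / (w \<bullet> 1)\<close> lies in \<open>Z\<close>. The division-free form gives the
  latter the evident meaning \<open>w = 0\<close> in the degenerate case \<open>w \<bullet> 1 = 0\<close>.
\<close>

definition points_into :: "real ^ 'n \<Rightarrow> (real ^ 'n) set \<Rightarrow> bool" where
  "points_into w Z \<longleftrightarrow> 0 \<le> w \<bullet> 1 \<and> (\<exists>z\<in>Z. w = (w \<bullet> 1) *\<^sub>R z)"

definition rap_data :: "('p::finite, 'm::finite, 'i::finite, 'j::finite) rap \<Rightarrow> bool" where
  "rap_data \<R> \<longleftrightarrow>
     surj (blk_p \<R>) \<and> surj (blk_m \<R>) \<and>
     orbit_family (blk_p \<R>) (Zset_p \<R>) \<and> orbit_family (blk_m \<R>) (Zset_m \<R>) \<and>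
     C_p \<R> *v 1 + D_pm \<R> *v 1 = 0 \<and> C_m \<R> *v 1 + D_mp \<R> *v 1 = 0 \<and>
     (\<forall>r\<ge>0. (\<forall>x\<in>orbits_p \<R>. orbit_flow \<R> r x \<in> orbits_p \<R>) \<and>
             (\<forall>x\<in>orbits_m \<R>. orbit_flow \<R> r x \<in> orbits_m \<R>)) \<and>
     (\<forall>i j. \<forall>a\<in>Zset_p \<R> i. i \<noteq> j \<longrightarrow>
        points_into (a v* block_at (blk_p \<R>) (blk_p \<R>) (C_p \<R>) i j) (Zset_p \<R> j)) \<and>
     (\<forall>i j. \<forall>a\<in>Zset_p \<R> i.
        points_into (a v* block_at (blk_p \<R>) (blk_m \<R>) (D_pm \<R>) i j) (Zset_m \<R> j)) \<and>
     (\<forall>i j. \<forall>a\<in>Zset_m \<R> i.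
        points_into (a v* block_at (blk_m \<R>) (blk_p \<R>) (D_mp \<R>) i j) (Zset_p \<R> j)) \<and>
     (\<forall>i j. \<forall>a\<in>Zset_m \<R> i. i \<noteq> j \<longrightarrow>
        points_into (a v* block_at (blk_m \<R>) (blk_m \<R>) (C_m \<R>) i j) (Zset_m \<R> j))"

text \<open>\<open>P x\<close> is the law under which the orbit process \<open>A\<close> starts at \<open>x\<close>.\<close>

definition orbit_process :: "('p::finite, 'm::finite, 'i::finite, 'j::finite) rap
    \<Rightarrow> (('p, 'm) orbit \<Rightarrow> 'w measure) \<Rightarrow> (real \<Rightarrow> 'w \<Rightarrow> ('p, 'm) orbit) \<Rightarrow> bool" where
  "orbit_process \<R> P A \<longleftrightarrow>
     (\<forall>x\<in>orbits_p \<R> \<union> orbits_m \<R>.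
        pdmp (P x) A (orbits_p \<R> \<union> orbits_m \<R>) (orbit_flow \<R>) (orbit_rate \<R>) (orbit_jump \<R>) x)"

definition nontrivial :: "('p::finite, 'm::finite, 'i::finite, 'j::finite) rap
    \<Rightarrow> (('p, 'm) orbit \<Rightarrow> 'w measure) \<Rightarrow> (real \<Rightarrow> 'w \<Rightarrow> ('p, 'm) orbit) \<Rightarrow> bool" where
  "nontrivial \<R> P A \<longleftrightarrow>
     (\<forall>Z\<in>{orbits_p \<R>, orbits_m \<R>}. \<forall>x\<in>Z.
        ((\<lambda>t. measure (P x) {\<omega>\<in>space (P x). \<forall>s\<in>{0..t}. A s \<omega> \<in> Z}) \<longlongrightarrow> 0) at_top)"

definition level :: "('p::finite, 'm::finite, 'i::finite, 'j::finite) rap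
    \<Rightarrow> (real \<Rightarrow> 'w \<Rightarrow> ('p, 'm) orbit) \<Rightarrow> real \<Rightarrow> 'w \<Rightarrow> real" where
  "level \<R> A t \<omega> =
     (LBINT s:{0..t}. indicator (orbits_p \<R>) (A s \<omega>) - indicator (orbits_m \<R>) (A s \<omega>))"

definition tau_minus :: "('p::finite, 'm::finite, 'i::finite, 'j::finite) rap
    \<Rightarrow> (real \<Rightarrow> 'w \<Rightarrow> ('p, 'm) orbit) \<Rightarrow> 'w \<Rightarrow> ereal" where
  "tau_minus \<R> A \<omega> = (INF t\<in>{t. 0 < t \<and> level \<R> A t \<omega> \<le> 0}. ereal t)"

text \<open>
  An orbit read as a row vector of the negative space; a positive orbit has no component there.
  At time \<open>tau_minus\<close> the orbit is almost surely negative.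
\<close>

definition minus_part :: "('p::finite, 'm::finite) orbit \<Rightarrow> real ^ 'm" where
  "minus_part x = (case x of Inl a \<Rightarrow> 0 | Inr a \<Rightarrow> a)"

primrec Psi :: "('p::finite, 'm::finite, 'i::finite, 'j::finite) rap \<Rightarrow> nat \<Rightarrow> real ^ 'm ^ 'p" where
  "Psi \<R> 0 = 0"
| "Psi \<R> (Suc n) =
     (LBINT y:{0..}. mexp (y *\<^sub>R C_p \<R>) ** (D_pm \<R> + Psi \<R> n ** D_mp \<R> ** Psi \<R> n)
        ** mexp (y *\<^sub>R C_m \<R>))"

end

theory Submission
  imports Defs
begin

text \<open>
  The point that makes the process tractable is that it becomes linear if the rows are not normalised. Let
  \<open>G\<close> be the block-diagonal generator of the flow on the joint space of positive and negative orbits. The rows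
  of the full generator sum to 0, so the total jump rate along the flow from \<open>x\<close> is minus the logarithmic
  derivative of the mass \<open>x exp (s G) 1\<close>; hence this mass is the probability of no jump before \<open>s\<close>, and density
  times post-jump orbit for a jump of kind \<open>l\<close> at \<open>s\<close> is \<open>x exp (s G) B\<^sub>l\<close>, where \<open>B\<^sub>l\<close> is the block of that kind
  (\<open>survival_mass\<close>, \<open>jump_density_scaled\<close>). Conditioning on the first jump therefore gives equations between
  matrices.

  Entries of these matrices may be negative. The place of nonnegativity is taken by the dual cone, the set of
  columns on which all orbits are nonnegative, and by the matrices that preserve it (\<open>mpos\<close>). Orbits are bounded,
  have mass 1 and, by minimality of the orbit sets, span the space. So the dual cone has interior points, the
  order that it induces on matrices is antisymmetric, and bounded monotone sequences of matrices converge.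

  Let a level move with slope \<open>1\<close> or \<open>-1\<close> according to the side of the orbit, and let \<open>F r\<close> be the matrix
  whose product with an initial row is the expected orbit at the time when the level, started at \<open>r\<close>, runs out.
  Restricted to fewer than \<open>n\<close> jumps, it obeys a backward recursion in \<open>n\<close>. The limit \<open>F\<close> is the least positive
  fixed point; with \<open>Q\<close> the full generator, its rows satisfy \<open>F' = Q F\<close> on the falling and \<open>F' = - Q F\<close>
  on the rising side, and \<open>F\<close> lies below every positive solution of this system that has the initial value
  1 on the falling side (\<open>passage_ode\<close>, \<open>passage_minimal\<close>, \<open>passage_law\<close>).

  With no rising side the level is a clock, and the diagonal block of \<open>F r\<close> on the falling side is \<open>exp (r C\<^sup>\<plusminus>)\<close>.
  Nontriviality then says that these matrices tend to 0, hence exponentially fast. So the integrals that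
  define \<open>\<Psi>\<^sub>n\<close> converge, and they solve the Sylvester equations of the recursion.

  With the positive side rising and the level started at 0, the block of \<open>F 0\<close> from positive to negative rows is the
  matrix \<open>\<Phi>\<close> with \<open>E[A\<^sub>\<tau>; \<tau> < \<infinity>] = \<alpha> \<Phi>\<close> (\<open>return_expectation\<close>, \<open>return_probability\<close>). It remains to prove
  \<open>\<Psi>\<^sub>n \<longlonglongrightarrow> \<Phi>\<close>. To exhaust the level \<open>s\<close> from a positive orbit it suffices to return to the initial level and
  to exhaust \<open>s\<close> from there; the derivative of this inequality at \<open>s = 0\<close> makes \<open>\<Phi>\<close> a supersolution of the Riccati
  equation, and since the Sylvester integrals preserve positivity, \<open>\<Psi>\<^sub>n\<close> increases and stays below \<open>\<Phi>\<close>. Its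
  limit \<open>\<Psi>\<close> solves the Riccati equation.
  With \<open>K = C\<^sup>- + D\<^sup>-\<^sup>+ \<Psi>\<close> the pair \<open>\<Psi> exp (r K)\<close>, \<open>exp (r K)\<close> is then a positive solution of the system for \<open>F\<close>, so \<open>\<Phi> \<le> \<Psi>\<close> by minimality (\<open>psi_limit\<close>).
\<close>

section \<open>Matrix products and the matrix exponential\<close>

lemma bounded_bilinear_matrix_matrix:
  "bounded_bilinear ((**) :: real^'b::finite^'a::finite \<Rightarrow> real^'c::finite^'b \<Rightarrow> real^'c^'a)"
proof -
  have "bilinear ((**) :: real^'b::finite^'a::finite \<Rightarrow> real^'c::finite^'b \<Rightarrow> real^'c^'a)"
    by (auto simp: bilinear_def intro!: linearI)
       (simp_all add: matrix_matrix_mult_def vec_eq_iff sum_distrib_left algebra_simps sum.distrib)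
  then show ?thesis by (simp add: bilinear_conv_bounded_bilinear)
qed

lemma bounded_bilinear_vector_matrix:
  "bounded_bilinear ((v*) :: real^'a::finite \<Rightarrow> real^'b::finite^'a \<Rightarrow> real^'b)"
proof -
  have "bilinear ((v*) :: real^'a::finite \<Rightarrow> real^'b::finite^'a \<Rightarrow> real^'b)"
    by (auto simp: bilinear_def intro!: linearI)
       (simp_all add: vector_matrix_mult_def vec_eq_iff sum_distrib_left algebra_simps sum.distrib)
  then show ?thesis by (simp add: bilinear_conv_bounded_bilinear)
qed

lemma bounded_bilinear_matrix_vector:
  "bounded_bilinear ((*v) :: real^'b::finite^'a::finite \<Rightarrow> real^'b \<Rightarrow> real^'a)"
proof -
  have "bilinear ((*v) :: real^'b::finite^'a::finite \<Rightarrow> real^'b \<Rightarrow> real^'a)"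
    by (auto simp: bilinear_def intro!: linearI)
       (simp_all add: matrix_vector_mult_def vec_eq_iff sum_distrib_left algebra_simps sum.distrib)
  then show ?thesis by (simp add: bilinear_conv_bounded_bilinear)
qed

lemmas mm_bilin = bounded_bilinear_matrix_matrix
lemmas vm_bilin = bounded_bilinear_vector_matrix
lemmas mv_bilin = bounded_bilinear_matrix_vector

lemmas mm_simps = bounded_bilinear.add_left[OF mm_bilin] bounded_bilinear.add_right[OF mm_bilin]
  bounded_bilinear.diff_left[OF mm_bilin] bounded_bilinear.diff_right[OF mm_bilin]
  bounded_bilinear.minus_left[OF mm_bilin] bounded_bilinear.minus_right[OF mm_bilin]
  bounded_bilinear.zero_left[OF mm_bilin] bounded_bilinear.zero_right[OF mm_bilin]
  bounded_bilinear.scaleR_left[OF mm_bilin] bounded_bilinear.scaleR_right[OF mm_bilin]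

lemmas mv_simps = bounded_bilinear.add_left[OF mv_bilin] bounded_bilinear.add_right[OF mv_bilin]
  bounded_bilinear.diff_left[OF mv_bilin] bounded_bilinear.diff_right[OF mv_bilin]
  bounded_bilinear.minus_left[OF mv_bilin] bounded_bilinear.minus_right[OF mv_bilin]
  bounded_bilinear.zero_left[OF mv_bilin] bounded_bilinear.zero_right[OF mv_bilin]
  bounded_bilinear.scaleR_left[OF mv_bilin] bounded_bilinear.scaleR_right[OF mv_bilin]

lemmas vm_simps = bounded_bilinear.add_left[OF vm_bilin] bounded_bilinear.add_right[OF vm_bilin]
  bounded_bilinear.diff_left[OF vm_bilin] bounded_bilinear.diff_right[OF vm_bilin]
  bounded_bilinear.minus_left[OF vm_bilin] bounded_bilinear.minus_right[OF vm_bilin]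
  bounded_bilinear.zero_left[OF vm_bilin] bounded_bilinear.zero_right[OF vm_bilin]
  bounded_bilinear.scaleR_left[OF vm_bilin] bounded_bilinear.scaleR_right[OF vm_bilin]

lemmas has_vector_derivative_mm = bounded_bilinear.has_vector_derivative[OF mm_bilin]
lemmas continuous_on_mm = bounded_bilinear.continuous_on[OF mm_bilin]

text \<open>Powers with respect to the matrix product; on this type \<open>^\<close> is componentwise.\<close>

definition mpow :: "real^'n::finite^'n \<Rightarrow> nat \<Rightarrow> real^'n^'n" where
  "mpow M k = ((**) M ^^ k) (mat 1)"

lemma mpow_0 [simp]: "mpow M 0 = mat 1" and mpow_Suc: "mpow M (Suc k) = M ** mpow M k"
  by (simp_all add: mpow_def)

lemma mpow_scaleR: "mpow (t *\<^sub>R M) k = t ^ k *\<^sub>R mpow M k"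
  by (induction k) (simp_all add: mpow_Suc mm_simps)

lemma mpow_commute: "M ** mpow M k = mpow M k ** M"
  by (induction k) (simp_all add: mpow_Suc, simp add: matrix_mul_assoc)

lemma mexp_summable: "summable (\<lambda>k. (t ^ k / fact k) *\<^sub>R mpow (M::real^'n::finite^'n) k)"
proof -
  obtain B where B: "B > 0" "\<And>X (Y::real^'n^'n). norm ((X::real^'n^'n) ** Y) \<le> norm X * norm Y * B"
    using bounded_bilinear.pos_bounded[OF mm_bilin] by metis
  have nb: "norm (mpow M k) \<le> (B * norm M) ^ k * norm (mat 1 :: real^'n^'n)" for k
  proof (induction k)
    case (Suc k)
    have "norm (mpow M (Suc k)) \<le> norm M * norm (mpow M k) * B" by (simp add: mpow_Suc B)
    also have "\<dots> \<le> norm M * ((B * norm M) ^ k * norm (mat 1 :: real^'n^'n)) * B"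
      by (intro mult_right_mono mult_left_mono Suc) (use B in auto)
    finally show ?case by (simp add: algebra_simps)
  qed simp
  show ?thesis
  proof (rule summable_comparison_test')
    show "summable (\<lambda>k. (inverse (fact k) * (\<bar>t\<bar> * (B * norm M)) ^ k) * norm (mat 1 :: real^'n^'n))"
      by (intro summable_mult2 summable_exp)
    show "norm ((t ^ k / fact k) *\<^sub>R mpow M k)
        \<le> (inverse (fact k) * (\<bar>t\<bar> * (B * norm M)) ^ k) * norm (mat 1 :: real^'n^'n)" for k
      using mult_left_mono[OF nb[of k], of "\<bar>t\<bar>^k / fact k"]
      by (simp add: power_abs divide_inverse power_mult_distrib mult_ac abs_mult)
  qed
qed

lemma mexp_series: "mexp (t *\<^sub>R M) = (\<Sum>k. (t ^ k / fact k) *\<^sub>R mpow M k)"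
  by (simp add: mexp_def mpow_def[symmetric] mpow_scaleR)

lemma mexp_0 [simp]: "mexp (0::real^'n::finite^'n) = mat 1"
proof -
  have "mexp (0 *\<^sub>R (0::real^'n^'n)) = (\<Sum>k\<in>{0}. (0 ^ k / fact k) *\<^sub>R mpow 0 k)" unfolding mexp_series
    by (rule suminf_finite) auto
  then show ?thesis by simp
qed

lemma mexp_commute: "M ** mexp (t *\<^sub>R M) = mexp (t *\<^sub>R M) ** (M::real^'n::finite^'n)"
proof -
  have "M ** mexp (t *\<^sub>R M) = (\<Sum>k. M ** ((t ^ k / fact k) *\<^sub>R mpow M k))"
    unfolding mexp_series
    by (rule bounded_linear.suminf[OF bounded_bilinear.bounded_linear_right[OF mm_bilin] mexp_summable])
  also have "\<dots> = (\<Sum>k. ((t ^ k / fact k) *\<^sub>R mpow M k) ** M)"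
    by (simp add: mm_simps mpow_commute)
  also have "\<dots> = mexp (t *\<^sub>R M) ** M"
    unfolding mexp_series
    by (rule bounded_linear.suminf[OF bounded_bilinear.bounded_linear_left[OF mm_bilin] mexp_summable, symmetric])
  finally show ?thesis .
qed

lemma bounded_linear_entry: "bounded_linear (\<lambda>X::real^'n::finite^'m::finite. X $ p $ q)"
  by (intro bounded_linear_compose[OF bounded_linear_vec_nth bounded_linear_vec_nth])

lemma has_vector_derivative_matrix:
  fixes f :: "real \<Rightarrow> real^'n::finite^'m::finite"
  assumes "\<And>p q. ((\<lambda>t. f t $ p $ q) has_vector_derivative D $ p $ q) (at t within S)"
  shows "(f has_vector_derivative D) (at t within S)"
  unfolding has_vector_derivative_def
proof (subst has_derivative_componentwise_within, rule ballI)
  fix b :: "real^'n^'m" assume "b \<in> Basis"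
  then obtain i j where b: "b = axis i (axis j 1)" by (auto simp: Basis_vec_def)
  have *: "x \<bullet> b = x $ i $ j" for x :: "real^'n^'m"
    by (simp add: b inner_axis)
  show "((\<lambda>x. f x \<bullet> b) has_derivative (\<lambda>x. (x *\<^sub>R D) \<bullet> b)) (at t within S)"
    using assms[of i j] by (simp add: * has_vector_derivative_def)
qed

lemma has_vector_derivative_mexp:
  "((\<lambda>t. mexp (t *\<^sub>R M)) has_vector_derivative M ** mexp (t *\<^sub>R M)) (at t within S)"
proof (rule has_vector_derivative_matrix)
  fix p q
  let ?c = "\<lambda>k. mpow M k $ p $ q / fact k"
  have 1: "mexp (t *\<^sub>R M) $ p $ q = (\<Sum>k. ?c k * t ^ k)" for t
    unfolding mexp_series
    by (subst bounded_linear.suminf[OF bounded_linear_entry mexp_summable]) (simp add: mult.commute)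
  have s: "summable (\<lambda>k. ?c k * t ^ k)" for t
    using bounded_linear.summable[OF bounded_linear_entry mexp_summable, of t M p q]
    by (simp add: mult.commute)
  have "((\<lambda>t. \<Sum>k. ?c k * t ^ k) has_real_derivative (\<Sum>k. diffs ?c k * t ^ k)) (at t)"
    by (rule termdiffs_strong_converges_everywhere[OF s])
  moreover have "(\<Sum>k. diffs ?c k * t ^ k) = (M ** mexp (t *\<^sub>R M)) $ p $ q"
  proof -
    have "M ** mexp (t *\<^sub>R M) = (\<Sum>k. (t ^ k / fact k) *\<^sub>R mpow M (Suc k))"
      unfolding mexp_series
      by (subst bounded_linear.suminf[OF bounded_bilinear.bounded_linear_right[OF mm_bilin] mexp_summable])
         (simp add: mm_simps mpow_Suc)
    moreover have sm: "summable (\<lambda>k. (t ^ k / fact k) *\<^sub>R mpow M (Suc k))"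
      using bounded_linear.summable[OF bounded_bilinear.bounded_linear_right[OF mm_bilin] mexp_summable, of M t M]
      by (simp add: mm_simps mpow_Suc)
    ultimately have "(M ** mexp (t *\<^sub>R M)) $ p $ q = (\<Sum>k. ((t ^ k / fact k) *\<^sub>R mpow M (Suc k)) $ p $ q)"
      using bounded_linear.suminf[OF bounded_linear_entry[of p q] sm] by (simp only:)
    moreover have "diffs ?c k * t ^ k = ((t ^ k / fact k) *\<^sub>R mpow M (Suc k)) $ p $ q" for k
      by (simp add: diffs_def fact_Suc field_simps del: of_nat_Suc)
    ultimately show ?thesis by (simp only:)
  qed
  ultimately have "((\<lambda>t. mexp (t *\<^sub>R M) $ p $ q) has_real_derivative (M ** mexp (t *\<^sub>R M)) $ p $ q) (at t)"
    by (simp add: 1)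
  then show "((\<lambda>t. mexp (t *\<^sub>R M) $ p $ q) has_vector_derivative (M ** mexp (t *\<^sub>R M)) $ p $ q) (at t within S)"
    using has_real_derivative_iff_has_vector_derivative has_vector_derivative_at_within by blast
qed

lemma has_vector_derivative_mexp':
  "((\<lambda>t. mexp (t *\<^sub>R M)) has_vector_derivative mexp (t *\<^sub>R M) ** M) (at t within S)"
  using has_vector_derivative_mexp[of M t S] by (simp add: mexp_commute)

lemma has_vector_derivative_mexp_neg:
  "((\<lambda>t. mexp ((c - t) *\<^sub>R M)) has_vector_derivative - (mexp ((c - t) *\<^sub>R M) ** M)) (at t within S)"
proof -
  have "((\<lambda>t. mexp (t *\<^sub>R M)) \<circ> (\<lambda>t. c - t) has_vector_derivative (-1) *\<^sub>R (mexp ((c - t) *\<^sub>R M) ** M)) (at t within S)"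
  proof (rule vector_diff_chain_within)
    show "((\<lambda>t. c - t) has_vector_derivative - 1) (at t within S)"
      by (auto intro!: derivative_eq_intros)
  qed (rule has_vector_derivative_mexp')
  then show ?thesis by (simp add: o_def)
qed

lemma continuous_on_mexp [continuous_intros]:
  assumes "continuous_on S f"
  shows "continuous_on S (\<lambda>x. mexp (f x *\<^sub>R (M::real^'n::finite^'n)))"
proof -
  have "continuous_on UNIV (\<lambda>t. mexp (t *\<^sub>R M))"
    unfolding continuous_on_eq_continuous_within
    by (intro ballI has_vector_derivative_continuous[OF has_vector_derivative_mexp])
  then show ?thesis using assms by (rule continuous_on_compose2) auto
qed

lemma constant_on_halfline:
  fixes f :: "real \<Rightarrow> 'a::real_normed_vector"
  assumes "\<And>t. 0 \<le> t \<Longrightarrow> (f has_vector_derivative 0) (at t within {0..})" "0 \<le> t"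
  shows "f t = f 0"
proof -
  have "\<exists>c. \<forall>x\<in>{0..}. f x = c"
    by (rule has_vector_derivative_zero_constant[of "{0..}" f, OF convex_real_interval(1)]) (use assms(1) in auto)
  with assms(2) show ?thesis by auto
qed

text \<open>The product \<open>mexp ((t - u) *\<^sub>R M) ** X u\<close> has derivative 0 in \<open>u\<close>.\<close>

lemma mexp_left_unique:
  fixes X :: "real \<Rightarrow> real^'k::finite^'n::finite"
  assumes X: "\<And>t. 0 \<le> t \<Longrightarrow> (X has_vector_derivative M ** X t) (at t within {0..})" and t: "0 \<le> t"
  shows "X t = mexp (t *\<^sub>R M) ** X 0"
proof -
  have "(\<lambda>u. mexp ((t - u) *\<^sub>R M) ** X u) t = (\<lambda>u. mexp ((t - u) *\<^sub>R M) ** X u) 0"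
    by (rule constant_on_halfline[OF _ t])
      (auto intro!: has_vector_derivative_eq_rhs[OF has_vector_derivative_mm[OF has_vector_derivative_mexp_neg X]]
        simp: mm_simps matrix_mul_assoc)
  then show ?thesis by simp
qed

lemma mexp_add_nonneg: "mexp ((s + t) *\<^sub>R M) = mexp (s *\<^sub>R M) ** mexp (t *\<^sub>R M)" if "0 \<le> t"
  for M :: "real^'n::finite^'n"
proof -
  have "(\<lambda>u. mexp ((s + t - u) *\<^sub>R M) ** mexp (u *\<^sub>R M)) t = (\<lambda>u. mexp ((s + t - u) *\<^sub>R M) ** mexp (u *\<^sub>R M)) 0"
    by (rule constant_on_halfline[OF _ that])
      (auto intro!: has_vector_derivative_eq_rhs[OF has_vector_derivative_mm[OF has_vector_derivative_mexp_neg has_vector_derivative_mexp]]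
        simp: mm_simps matrix_mul_assoc)
  then show ?thesis by simp
qed

lemma mexp_neg: "mexp (- t *\<^sub>R M) ** mexp (t *\<^sub>R M) = mat 1" if "0 \<le> t"
  for M :: "real^'n::finite^'n"
  using mexp_add_nonneg[OF that, of "-t" M] by simp

text \<open>
  A negative \<open>t\<close> reduces to a nonnegative one because \<open>mexp (t *\<^sub>R M)\<close> and \<open>mexp (- t *\<^sub>R M)\<close> are inverse to
  each other.
\<close>

lemma mexp_add: "mexp ((s + t) *\<^sub>R M) = mexp (s *\<^sub>R M) ** mexp (t *\<^sub>R M)"
  for M :: "real^'n::finite^'n"
proof (cases "0 \<le> t")
  case False
  have "mexp (t *\<^sub>R M) ** mexp (- t *\<^sub>R M) = mat 1"
    using mexp_neg[of "-t" M] False by simp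
  then have inv: "mexp (- t *\<^sub>R M) ** mexp (t *\<^sub>R M) = mat 1"
    by (simp add: matrix_left_right_inverse)
  have "mexp (s *\<^sub>R M) = mexp ((s + t) *\<^sub>R M) ** mexp (- t *\<^sub>R M)"
    using mexp_add_nonneg[of "-t" "s + t" M] False by simp
  then have "mexp (s *\<^sub>R M) ** mexp (t *\<^sub>R M) = mexp ((s + t) *\<^sub>R M) ** (mexp (- t *\<^sub>R M) ** mexp (t *\<^sub>R M))"
    by (simp add: matrix_mul_assoc)
  then show ?thesis by (simp only: inv) simp
qed (rule mexp_add_nonneg)

lemma mexp_commute_with:
  fixes A :: "real^'n::finite^'n"
  assumes "A ** G = G ** A" and that: "0 \<le> t"
  shows "A ** mexp (t *\<^sub>R G) = mexp (t *\<^sub>R G) ** A"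
proof -
  have "(\<lambda>t. A ** mexp (t *\<^sub>R G)) t = mexp (t *\<^sub>R G) ** (A ** mexp (0 *\<^sub>R G))"
    by (rule mexp_left_unique[OF _ that])
      (auto intro!: has_vector_derivative_eq_rhs[OF has_vector_derivative_mm[OF has_vector_derivative_const has_vector_derivative_mexp]]
        simp: mm_simps matrix_mul_assoc assms)
  then show ?thesis by simp
qed

section \<open>Integrals over intervals and half-lines\<close>

lemma set_integral_FTC:
  fixes f :: "real \<Rightarrow> 'a::euclidean_space"
  assumes "a \<le> b" "\<And>x. a \<le> x \<Longrightarrow> x \<le> b \<Longrightarrow> (F has_vector_derivative f x) (at x within {a..b})"
    "continuous_on {a..b} f"
  shows "(LBINT x:{a..b}. f x) = F b - F a"
  unfolding set_lebesgue_integral_def using assms by (rule integral_FTC_atLeastAtMost)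

lemma set_integrable_continuous:
  fixes f :: "real \<Rightarrow> 'a::euclidean_space"
  shows "continuous_on {a..b} f \<Longrightarrow> set_integrable lborel {a..b} f"
  by (rule borel_integrable_atLeastAtMost')

lemma set_integral_bounded_linear:
  fixes f :: "real \<Rightarrow> 'a::euclidean_space" and T :: "'a \<Rightarrow> 'b::euclidean_space"
  assumes "bounded_linear T" "set_integrable lborel S f"
  shows "(LBINT x:S. T (f x)) = T (LBINT x:S. f x)" "set_integrable lborel S (\<lambda>x. T (f x))"
proof -
  interpret T: bounded_linear T by fact
  show "(LBINT x:S. T (f x)) = T (LBINT x:S. f x)"
    using integral_bounded_linear[OF assms(1), of lborel "\<lambda>x. indicator S x *\<^sub>R f x"] assms(2)
    by (simp add: set_lebesgue_integral_def set_integrable_def T.scaleR)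
  show "set_integrable lborel S (\<lambda>x. T (f x))"
    using integrable_bounded_linear[OF assms(1), of lborel "\<lambda>x. indicator S x *\<^sub>R f x"] assms(2)
    by (simp add: set_integrable_def T.scaleR)
qed

lemma at_within_halfline:
  assumes "(a::real) \<le> x" "x < b" shows "at x within {a..} = at x within {a..b}"
  by (rule at_within_nhd[of x "{..<b}"]) (use assms in auto)

lemma continuous_on_halflineI:
  fixes f :: "real \<Rightarrow> 'a::topological_space"
  assumes "\<And>b. continuous_on {a..b} f"
  shows "continuous_on {a..} f"
  unfolding continuous_on_eq_continuous_within
proof (rule ballI)
  fix x assume "x \<in> {a..}"
  then have "at x within {a..} = at x within {a..x+1}" by (intro at_within_halfline) auto
  moreover have "continuous (at x within {a..x+1}) f"
    using assms[of "x+1"] \<open>x \<in> {a..}\<close> by (auto simp: continuous_on_eq_continuous_within)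
  ultimately show "continuous (at x within {a..}) f" by (simp add: continuous_within)
qed

lemma set_integral_continuous_upper:
  fixes g :: "real \<Rightarrow> 'a::euclidean_space"
  assumes "\<And>b. set_integrable lborel {0..b} g"
  shows "continuous_on {0..} (\<lambda>r. LBINT u:{0..r}. g u)"
proof (rule continuous_on_halflineI)
  fix b
  have "continuous_on {0..b} (\<lambda>r. integral {0..r} g)"
    by (rule indefinite_integral_continuous_1) (rule set_borel_integral_eq_integral[OF assms])
  then show "continuous_on {0..b} (\<lambda>r. LBINT u:{0..r}. g u)"
    by (simp add: set_borel_integral_eq_integral[OF assms])
qed

lemma set_integral_has_vector_derivative_upper:
  fixes g :: "real \<Rightarrow> 'a::euclidean_space"
  assumes g: "continuous_on {0..} g" and x: "0 \<le> x"
  shows "((\<lambda>r. LBINT u:{0..r}. g u) has_vector_derivative g x) (at x within {0..})"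
proof -
  have c: "continuous_on {0..b} g" for b by (rule continuous_on_subset[OF g]) auto
  have "((\<lambda>r. integral {0..r} g) has_vector_derivative g x) (at x within {0..x+1})"
    by (rule integral_has_vector_derivative[OF c]) (use x in auto)
  then show ?thesis using x
    by (simp add: set_borel_integral_eq_integral[OF set_integrable_continuous[OF c]] at_within_halfline[of 0 x "x+1"])
qed

lemma set_integral_reflect_interval:
  fixes g :: "real \<Rightarrow> 'a::euclidean_space"
  shows "(LBINT s:{0..r}. g s) = (LBINT u:{0..r}. g (r - u))"
  unfolding set_lebesgue_integral_def
  by (subst lborel_integral_real_affine[of "-1" _ r]) (auto intro!: Bochner_Integration.integral_cong simp: indicator_def)

lemma set_integral_shift_halfline:
  fixes g :: "real \<Rightarrow> 'a::euclidean_space"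
  shows "(LBINT s:{0..}. g s) = (LBINT u:{r..}. g (u - r))"
  unfolding set_lebesgue_integral_def
  by (subst lborel_integral_real_affine[of 1 _ "-r"]) (auto intro!: Bochner_Integration.integral_cong simp: indicator_def)

lemma set_integral_tail:
  fixes g :: "real \<Rightarrow> 'a::euclidean_space"
  assumes g: "set_integrable lborel {0..} g" and r: "0 \<le> r"
  shows "(LBINT u:{r..}. g u) = (LBINT u:{0..}. g u) - (LBINT u:{0..r}. g u)"
proof -
  have "{0..} = {0..r} \<union> {r<..}" using r by auto
  then have 1: "(LBINT u:{0..}. g u) = (LBINT u:{0..r}. g u) + (LBINT u:{r<..}. g u)"
    using r by (auto intro!: set_integral_Un set_integrable_subset[OF g])
  have "(LBINT u:{r..}. g u) = (LBINT u:{r<..}. g u)"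
    unfolding set_lebesgue_integral_def
  proof (rule integral_cong_AE)
    have "set_integrable lborel {r..} g" "set_integrable lborel {r<..} g"
      using r by (auto intro!: set_integrable_subset[OF g])
    then show "(\<lambda>x. indicator {r..} x *\<^sub>R g x) \<in> borel_measurable lborel"
      "(\<lambda>x. indicator {r<..} x *\<^sub>R g x) \<in> borel_measurable lborel"
      by (auto simp: set_integrable_def)
    show "AE x in lborel. indicator {r..} x *\<^sub>R g x = indicator {r<..} x *\<^sub>R g x"
      using AE_lborel_singleton[of r] by eventually_elim (auto simp: indicator_def)
  qed
  with 1 show ?thesis by simp
qed

section \<open>Positivity with respect to a dual cone\<close>

definition dual :: "(real^'n::finite) set \<Rightarrow> (real^'n) set" where
  "dual Z = {w. \<forall>z\<in>Z. 0 \<le> z \<bullet> w}"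

text \<open>
  By the bipolar theorem this says that for every \<open>z\<close> in \<open>Z\<close> the row \<open>z v* M\<close> lies in the closed convex
  cone generated by \<open>Y\<close>. The dual form is stable under products, limits and integrals at once.
\<close>

definition mpos :: "(real^'m::finite) set \<Rightarrow> (real^'n::finite) set \<Rightarrow> real^'n^'m \<Rightarrow> bool" where
  "mpos Z Y M \<longleftrightarrow> (\<forall>w\<in>dual Y. M *v w \<in> dual Z)"

text \<open>
  Boundedness and mass 1 make the all-ones column an interior point of the dual cone; since \<open>Z\<close> spans,
  a matrix is known once its products with the rows in \<open>Z\<close> are known.
\<close>

definition mass_base :: "(real^'n::finite) set \<Rightarrow> bool" where
  "mass_base Z \<longleftrightarrow> bounded Z \<and> (\<forall>z\<in>Z. z \<bullet> 1 = 1) \<and> span Z = UNIV"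

lemma dual_add: "a \<in> dual Z \<Longrightarrow> b \<in> dual Z \<Longrightarrow> a + b \<in> dual Z"
  by (auto simp: dual_def inner_add_right)

lemma dual_scaleR: "a \<in> dual Z \<Longrightarrow> 0 \<le> c \<Longrightarrow> c *\<^sub>R a \<in> dual Z"
  by (auto simp: dual_def)

lemma dual_zero [simp]: "0 \<in> dual Z"
  by (auto simp: dual_def)

lemma dual_lim:
  assumes "(f \<longlongrightarrow> l) F" "F \<noteq> bot" "eventually (\<lambda>x. f x \<in> dual Z) F"
  shows "l \<in> dual Z"
  unfolding dual_def
proof safe
  fix z assume "z \<in> Z"
  show "0 \<le> z \<bullet> l"
    by (rule tendsto_lowerbound[OF tendsto_inner[OF tendsto_const assms(1)] _ assms(2)])
       (use assms(3) \<open>z \<in> Z\<close> in \<open>auto elim!: eventually_mono simp: dual_def\<close>)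
qed

lemma dual_integral:
  fixes f :: "real \<Rightarrow> real^'n::finite"
  assumes "\<And>s. s \<in> S \<Longrightarrow> f s \<in> dual Z"
  shows "(LBINT s:S. f s) \<in> dual Z"
proof (cases "set_integrable lborel S f")
  case True
  have "0 \<le> z \<bullet> (LBINT s:S. f s)" if "z \<in> Z" for z
  proof -
    have "z \<bullet> (LBINT s:S. f s) = (LBINT s:S. z \<bullet> f s)"
      using set_integral_bounded_linear(1)[OF bounded_linear_inner_right True] by simp
    also have "\<dots> \<ge> 0"
      unfolding set_lebesgue_integral_def
      by (rule Bochner_Integration.integral_nonneg) (use assms that in \<open>auto simp: indicator_def dual_def\<close>)
    finally show ?thesis .
  qed
  then show ?thesis by (auto simp: dual_def)
next
  case False
  then show ?thesis by (simp add: set_lebesgue_integral_def set_integrable_def not_integrable_integral_eq)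
qed

lemma mposD: "mpos Z Y M \<Longrightarrow> w \<in> dual Y \<Longrightarrow> M *v w \<in> dual Z"
  by (auto simp: mpos_def)

lemma mpos_mult: "mpos X Y M \<Longrightarrow> mpos Y Z N \<Longrightarrow> mpos X Z (M ** N)"
  by (auto simp: mpos_def matrix_vector_mul_assoc[symmetric])

lemma mpos_add: "mpos X Y M \<Longrightarrow> mpos X Y N \<Longrightarrow> mpos X Y (M + N)"
  by (auto simp: mpos_def mv_simps dual_add)

lemma mpos_0 [simp]: "mpos X Y 0"
  by (auto simp: mpos_def mv_simps)

lemma mpos_mat1 [simp]: "mpos X X (mat 1)"
  by (auto simp: mpos_def)

lemma mpos_lim:
  assumes "(f \<longlongrightarrow> l) F" "F \<noteq> bot" "eventually (\<lambda>x. mpos X Y (f x)) F"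
  shows "mpos X Y l"
  unfolding mpos_def
proof safe
  fix w assume "w \<in> dual Y"
  show "l *v w \<in> dual X"
    by (rule dual_lim[OF bounded_bilinear.tendsto[OF mv_bilin assms(1) tendsto_const] assms(2)])
       (use assms(3) \<open>w \<in> dual Y\<close> in \<open>auto elim!: eventually_mono simp: mpos_def\<close>)
qed

lemma mpos_integral:
  fixes f :: "real \<Rightarrow> real^'n::finite^'m::finite"
  assumes "\<And>s. s \<in> S \<Longrightarrow> mpos X Y (f s)"
  shows "mpos X Y (LBINT s:S. f s)"
proof (cases "set_integrable lborel S f")
  case True
  show ?thesis unfolding mpos_def
  proof safe
    fix w assume "w \<in> dual Y"
    have "(LBINT s:S. f s) *v w = (LBINT s:S. f s *v w)"
      using set_integral_bounded_linear(1)[OF bounded_bilinear.bounded_linear_left[OF mv_bilin] True, of w] by simp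
    also have "\<dots> \<in> dual X" using assms \<open>w \<in> dual Y\<close> by (intro dual_integral) (auto simp: mpos_def)
    finally show "(LBINT s:S. f s) *v w \<in> dual X" .
  qed
next
  case False
  then show ?thesis by (simp add: set_lebesgue_integral_def set_integrable_def not_integrable_integral_eq)
qed

lemma mass_base_one: "mass_base Z \<Longrightarrow> 1 \<in> dual Z"
  by (auto simp: mass_base_def dual_def)

text \<open>
  A ball of radius \<open>1 / \<kappa>\<close> about 1 lies in the dual cone, since \<open>z \<bullet> w\<close> is at most the bound of \<open>Z\<close> in
  absolute value for unit columns \<open>w\<close>.
\<close>

lemma mass_base_interior:
  assumes "mass_base Z"
  obtains \<kappa> where "\<kappa> > 0" "\<And>z. z \<in> Z \<Longrightarrow> norm z \<le> \<kappa>"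
    "\<And>w. norm w \<le> 1 \<Longrightarrow> \<kappa> *\<^sub>R 1 + w \<in> dual Z" "\<And>w. norm w \<le> 1 \<Longrightarrow> \<kappa> *\<^sub>R 1 - w \<in> dual Z"
proof -
  obtain \<kappa> where k: "\<kappa> > 0" "\<And>z. z \<in> Z \<Longrightarrow> norm z \<le> \<kappa>"
    using assms by (auto simp: mass_base_def bounded_pos)
  have "\<bar>z \<bullet> w\<bar> \<le> \<kappa>" if "z \<in> Z" "norm w \<le> 1" for z w
    using Cauchy_Schwarz_ineq2[of z w] mult_mono[OF k(2)[OF that(1)] that(2)] k(1) by auto
  then have "\<kappa> *\<^sub>R 1 + w \<in> dual Z" "\<kappa> *\<^sub>R 1 - w \<in> dual Z" if "norm w \<le> 1" for w
  proof -
    have "z \<bullet> 1 = 1" if "z \<in> Z" for z using assms that by (simp add: mass_base_def)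
    moreover have "-\<kappa> \<le> z \<bullet> w \<and> z \<bullet> w \<le> \<kappa>" if "z \<in> Z" for z
      using \<open>\<And>z w. \<lbrakk>z \<in> Z; norm w \<le> 1\<rbrakk> \<Longrightarrow> \<bar>z \<bullet> w\<bar> \<le> \<kappa>\<close>[OF that \<open>norm w \<le> 1\<close>] by linarith
    ultimately have "0 \<le> \<kappa> * (z \<bullet> 1) + z \<bullet> w \<and> 0 \<le> \<kappa> * (z \<bullet> 1) - z \<bullet> w" if "z \<in> Z" for z
      using that by force
    then show "\<kappa> *\<^sub>R 1 + w \<in> dual Z" "\<kappa> *\<^sub>R 1 - w \<in> dual Z"
      by (simp_all add: dual_def inner_add_right inner_diff_right)
  qed
  with k that show ?thesis by blast
qed

lemma axis_row: "(axis i 1 v* M) $ j = (M::real^'n::finite^'m::finite) $ i $ j"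
  by (simp add: vector_matrix_mult_def axis_def if_distrib[of "\<lambda>x. x * _"] if_distrib[of "\<lambda>x. _ * x"] cong: if_cong)

lemma mass_base_zero:
  assumes "mass_base Z" "\<And>z. z \<in> Z \<Longrightarrow> z v* M = 0"
  shows "M = 0"
proof -
  have "x v* M = 0" for x
  proof -
    have "x \<in> span Z" using assms(1) by (simp add: mass_base_def)
    then show ?thesis
      by (rule span_induct) (auto simp: assms(2) subspace_def vm_simps)
  qed
  from this[of "axis i 1" for i] have "axis i 1 v* M = 0" for i .
  then show ?thesis by (metis axis_row vec_eq_iff zero_index)
qed

text \<open>The difference vanishes on the dual cone, whose interior points span the space.\<close>

lemma mpos_antisym:
  assumes "mass_base Z" "mass_base Y" "mpos Z Y (M - N)" "mpos Z Y (N - M)"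
  shows "M = N"
proof -
  obtain \<kappa> where k: "\<kappa> > 0"  "\<And>w. norm w \<le> 1 \<Longrightarrow> \<kappa> *\<^sub>R 1 + w \<in> dual Y"
    using mass_base_interior[OF assms(2)] by metis
  have eq: "z \<bullet> ((M - N) *v w) = 0" if "w \<in> dual Y" "z \<in> Z" for w z
  proof -
    have "0 \<le> z \<bullet> ((M - N) *v w)" "0 \<le> z \<bullet> ((N - M) *v w)"
      using mposD[OF assms(3) that(1)] mposD[OF assms(4) that(1)] that(2) by (auto simp: dual_def)
    then show ?thesis
      by (simp add: bounded_bilinear.diff_left[OF mv_bilin] inner_diff_right)
  qed
  have "z v* (M - N) = 0" if "z \<in> Z" for z
  proof (rule vec_eq_iff[THEN iffD2, rule_format])
    fix q
    have "z \<bullet> ((M - N) *v (\<kappa> *\<^sub>R 1 + axis q 1)) = 0" "z \<bullet> ((M - N) *v 1) = 0"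
      using eq[OF k(2) that, of "axis q 1"] eq[OF mass_base_one[OF assms(2)] that] by (auto simp: norm_axis_1)
    then have "z \<bullet> ((M - N) *v axis q 1) = 0"
      by (simp add: bounded_bilinear.add_right[OF mv_bilin] bounded_bilinear.scaleR_right[OF mv_bilin] inner_add_right)
    then show "(z v* (M - N)) $ q = 0 $ q" by (simp add: dot_lmul_matrix[symmetric] inner_axis)
  qed
  then have "M - N = 0" using mass_base_zero[OF assms(1)] by blast
  then show ?thesis by simp
qed

text \<open>
  Properties that are closed under linear combinations of rows pass from \<open>Z\<close> to all rows. The
  following lemmas use this to reduce statements about matrices to statements about mass-one rows.
\<close>

lemma mass_base_rows:
  assumes "mass_base Z" "\<And>z. z \<in> Z \<Longrightarrow> P z" "subspace {z. P z}"
  shows "P z"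
proof -
  have "z \<in> span Z" using assms(1) by (simp add: mass_base_def)
  then show ?thesis by (rule span_induct) (use assms in auto)
qed

lemma matrix_tendsto_0:
  fixes M :: "'a \<Rightarrow> real^'n::finite^'m::finite"
  assumes "mass_base Z" "\<And>z. z \<in> Z \<Longrightarrow> ((\<lambda>n. z v* M n) \<longlongrightarrow> 0) F"
  shows "(M \<longlongrightarrow> 0) F"
proof -
  have "((\<lambda>n. z v* M n) \<longlongrightarrow> 0) F" for z
    by (rule mass_base_rows[OF assms])
       (auto simp: subspace_def vm_simps intro!: tendsto_add_zero tendsto_eq_intros)
  then have "((\<lambda>n. (axis p 1 v* M n) $ q) \<longlongrightarrow> 0 $ q) F" for p q by (rule tendsto_vec_nth)
  then show ?thesis by (intro vec_tendstoI) (simp add: axis_row)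
qed

lemma matrix_convergent:
  fixes M :: "nat \<Rightarrow> real^'n::finite^'m::finite"
  assumes "mass_base Z" "\<And>z. z \<in> Z \<Longrightarrow> convergent (\<lambda>n. z v* M n)"
  shows "convergent M"
proof -
  have "convergent (\<lambda>n. z v* M n)" for z
    by (rule mass_base_rows[OF assms])
       (auto simp: subspace_def vm_simps convergent_const convergent_def intro: tendsto_add tendsto_scaleR[OF tendsto_const])
  then have "\<exists>l. (\<lambda>n. axis p 1 v* M n) \<longlonglongrightarrow> l" for p by (simp add: convergent_def)
  then obtain l where l: "\<And>p. (\<lambda>n. axis p 1 v* M n) \<longlonglongrightarrow> l p" by metis
  have "(\<lambda>n. M n $ p $ q) \<longlonglongrightarrow> l p $ q" for p q
    using tendsto_vec_nth[OF l[of p], of q] by (simp add: axis_row)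
  then have "M \<longlonglongrightarrow> (\<chi> p. l p)" by (intro vec_tendstoI) simp
  then show ?thesis by (auto simp: convergent_def)
qed

lemma matrix_eq_entries:
  "(M :: real^'n::finite^'m::finite) = (\<Sum>k\<in>UNIV. M $ fst k $ snd k *\<^sub>R axis (fst k) (axis (snd k) 1))"
proof -
  have "(M $ fst k $ snd k *\<^sub>R (axis (fst k) (axis (snd k) 1) :: real^'n^'m)) $ i $ j
      = (if k = (i, j) then M $ i $ j else 0)" for k i j
    by (cases k) (auto simp: axis_def)
  then show ?thesis by (simp add: vec_eq_iff)
qed

lemma matrix_set_integrable:
  fixes M :: "real \<Rightarrow> real^'n::finite^'m::finite"
  assumes "mass_base Z" "\<And>z. z \<in> Z \<Longrightarrow> set_integrable lborel S (\<lambda>s. z v* M s)"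
  shows "set_integrable lborel S M"
proof -
  have "set_integrable lborel S (\<lambda>s. z v* M s)" for z
    by (rule mass_base_rows[OF assms])
       (auto simp: subspace_def vm_simps intro!: set_integral_add set_integral_bounded_linear(2)[OF bounded_linear_scaleR_right],
         simp add: set_integrable_def)
  then have "set_integrable lborel S (\<lambda>s. (axis p 1 v* M s) $ q)" for p q
    by (rule set_integral_bounded_linear(2)[OF bounded_linear_vec_nth])
  then have "set_integrable lborel S (\<lambda>s. M s $ p $ q *\<^sub>R axis p (axis q 1) :: real^'n^'m)" for p q
    by (intro set_integral_bounded_linear(2)[OF bounded_linear_scaleR_left]) (simp add: axis_row)
  then have "set_integrable lborel S (\<lambda>s. \<Sum>k\<in>UNIV. M s $ fst k $ snd k *\<^sub>R axis (fst k) (axis (snd k) 1) :: real^'n^'m)"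
    unfolding set_integrable_def scaleR_sum_right by (intro Bochner_Integration.integrable_sum) auto
  then show ?thesis by (subst (asm) matrix_eq_entries[symmetric])
qed

lemma matrix_bounded:
  fixes S :: "(real^'n::finite^'m::finite) set"
  assumes "mass_base Z" "\<And>z. z \<in> Z \<Longrightarrow> \<exists>B. \<forall>M\<in>S. norm (z v* M) \<le> B"
  shows "\<exists>B. \<forall>M\<in>S. norm M \<le> B"
proof -
  have *: "\<exists>B. \<forall>M\<in>S. norm (z v* M) \<le> B" for z
  proof (rule mass_base_rows[OF assms], assumption, unfold subspace_def, safe)
    show "\<exists>B. \<forall>M\<in>S. norm (0 v* M) \<le> B" by auto
  next
    fix x y B C assume "\<forall>M\<in>S. norm (x v* M) \<le> B" "\<forall>M\<in>S. norm (y v* M) \<le> C"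
    then have "\<forall>M\<in>S. norm ((x + y) v* M) \<le> B + C" by (auto simp: vm_simps intro!: norm_triangle_mono)
    then show "\<exists>B. \<forall>M\<in>S. norm ((x + y) v* M) \<le> B" by blast
  next
    fix c x B assume "\<forall>M\<in>S. norm (x v* M) \<le> B"
    then have "\<forall>M\<in>S. norm ((c *\<^sub>R x) v* M) \<le> \<bar>c\<bar> * B" by (auto simp: vm_simps intro!: mult_left_mono)
    then show "\<exists>B. \<forall>M\<in>S. norm ((c *\<^sub>R x) v* M) \<le> B" by blast
  qed
  obtain B where B: "\<And>p M. M \<in> S \<Longrightarrow> norm (axis p 1 v* M) \<le> B p"
    using *[of "axis p 1" for p] by metis
  have "norm M \<le> (\<Sum>p\<in>UNIV. B p)" if "M \<in> S" for M
  proof -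
    have "axis p 1 v* M = M $ p" for p by (simp add: vec_eq_iff axis_row)
    then have "norm (M $ p) \<le> B p" for p using B[OF that, of p] by simp
    moreover have "norm M \<le> (\<Sum>p\<in>UNIV. norm (M $ p))"
      unfolding norm_vec_def by (rule L2_set_le_sum) auto
    ultimately show ?thesis by (meson order_trans sum_mono)
  qed
  then show ?thesis by blast
qed

text \<open>
  Apply the matrix to the column \<open>\<kappa> *\<^sub>R 1 - w\<close> of the dual cone, where \<open>w\<close> is the direction of \<open>z v* M\<close>.
\<close>

lemma mpos_row_bound:
  assumes "mass_base Y"
  obtains \<kappa> where "\<kappa> > 0"
    "\<And>(Z::(real^'m::finite) set) M z. mpos Z (Y::(real^'n::finite) set) M \<Longrightarrow> z \<in> Z \<Longrightarrow> norm (z v* M) \<le> \<kappa> * (z \<bullet> (M *v 1))"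
proof -
  obtain \<kappa> where k: "\<kappa> > 0"  "\<And>w. norm w \<le> 1 \<Longrightarrow> \<kappa> *\<^sub>R 1 - w \<in> dual Y"
    using mass_base_interior[OF assms] by metis
  show ?thesis
  proof
    show "\<kappa> > 0" by fact
    fix Z :: "(real^'m) set" and M z assume M: "mpos Z Y M" and z: "z \<in> Z"
    define w where "w = (1 / norm (z v* M)) *\<^sub>R (z v* M)"
    have "\<kappa> *\<^sub>R 1 - w \<in> dual Y" by (intro k) (simp add: w_def)
    then have "0 \<le> z \<bullet> (M *v (\<kappa> *\<^sub>R 1 - w))" using mposD[OF M] z by (auto simp: dual_def)
    then have "(z v* M) \<bullet> w \<le> \<kappa> * (z \<bullet> (M *v 1))"
      by (simp add: bounded_bilinear.diff_right[OF mv_bilin] bounded_bilinear.scaleR_right[OF mv_bilin]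
          inner_diff_right dot_lmul_matrix)
    moreover have "(z v* M) \<bullet> w = norm (z v* M)"
      unfolding w_def inner_scaleR_right power2_norm_eq_inner[symmetric] by (simp add: power2_eq_square)
    ultimately show "norm (z v* M) \<le> \<kappa> * (z \<bullet> (M *v 1))" by simp
  qed
qed

text \<open>
  The values on the columns 1 and \<open>\<kappa> *\<^sub>R 1 - w\<close> increase and are bounded, hence converge; the
  difference gives convergence on an arbitrary small column \<open>w\<close>.
\<close>

lemma matrix_mono_convergent:
  fixes M :: "nat \<Rightarrow> real^'n::finite^'m::finite"
  assumes Z: "mass_base Z" and Y: "mass_base Y"
    and mono: "\<And>n. mpos Z Y (M (Suc n) - M n)"
    and bdd: "\<And>n z. z \<in> Z \<Longrightarrow> z \<bullet> (M n *v 1) \<le> C"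
  shows "convergent M"
proof (rule matrix_convergent[OF Z])
  fix z assume z: "z \<in> Z"
  obtain \<kappa> where k: "\<kappa> > 0" "\<And>w. norm w \<le> 1 \<Longrightarrow> \<kappa> *\<^sub>R 1 + w \<in> dual Y" "\<And>w. norm w \<le> 1 \<Longrightarrow> \<kappa> *\<^sub>R 1 - w \<in> dual Y"
    using mass_base_interior[OF Y] by metis
  have inc: "incseq (\<lambda>n. z \<bullet> (M n *v w))" if "w \<in> dual Y" for w
    using mposD[OF mono that] z
    by (intro incseq_SucI) (auto simp: dual_def mv_simps inner_diff_right)
  have one: "convergent (\<lambda>n. z \<bullet> (M n *v 1))"
    using inc[OF mass_base_one[OF Y]] bdd[OF z]
    by (metis incseq_convergent convergentI)
  have "convergent (\<lambda>n. z \<bullet> (M n *v w))" if w: "norm w \<le> 1" for w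
  proof -
    have "z \<bullet> (M n *v (\<kappa> *\<^sub>R 1 - w)) \<le> 2 * \<kappa> * C - z \<bullet> (M 0 *v (\<kappa> *\<^sub>R 1 + w))" for n
    proof -
      have "z \<bullet> (M 0 *v (\<kappa> *\<^sub>R 1 + w)) \<le> z \<bullet> (M n *v (\<kappa> *\<^sub>R 1 + w))"
        using inc[OF k(2)[OF w]] by (simp add: incseq_def)
      moreover have "\<kappa> * (z \<bullet> (M n *v 1)) \<le> \<kappa> * C" using bdd[OF z] k(1) by simp
      ultimately show ?thesis
        by (simp add: bounded_bilinear.diff_right[OF mv_bilin] bounded_bilinear.add_right[OF mv_bilin] bounded_bilinear.scaleR_right[OF mv_bilin]
          inner_diff_right inner_add_right)
    qed
    then have "convergent (\<lambda>n. z \<bullet> (M n *v (\<kappa> *\<^sub>R 1 - w)))"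
      using inc[OF k(3)[OF w]] by (metis incseq_convergent convergentI)
    then have "convergent (\<lambda>n. \<kappa> * (z \<bullet> (M n *v 1)) - z \<bullet> (M n *v (\<kappa> *\<^sub>R 1 - w)))"
      by (intro convergent_diff convergent_mult convergent_const one)
    then show ?thesis
      by (simp add: bounded_bilinear.diff_right[OF mv_bilin] bounded_bilinear.scaleR_right[OF mv_bilin] inner_diff_right)
  qed
  from this[of "axis q 1" for q] have "convergent (\<lambda>n. (z v* M n) $ q)" for q
    by (simp add: dot_lmul_matrix[symmetric] inner_axis norm_axis_1)
  then have "\<exists>l. (\<lambda>n. (z v* M n) $ q) \<longlonglongrightarrow> l" for q by (simp add: convergent_def)
  then obtain l where l: "\<And>q. (\<lambda>n. (z v* M n) $ q) \<longlonglongrightarrow> l q" by metis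
  have "(\<lambda>n. z v* M n) \<longlonglongrightarrow> (\<chi> q. l q)" by (intro vec_tendstoI) (simp add: l)
  then show "convergent (\<lambda>n. z v* M n)" by (auto simp: convergent_def)
qed

section \<open>Passage matrices of a linear flow with jumps\<close>

text \<open>The indicator is there since nothing is known of the values at negative arguments.\<close>

definition nice :: "(real \<Rightarrow> real^'n::finite^'m::finite) \<Rightarrow> bool" where
  "nice F \<longleftrightarrow> (\<lambda>r. indicator {0..} r *\<^sub>R F r) \<in> borel_measurable borel \<and> (\<exists>B. \<forall>r\<ge>0. norm (F r) \<le> B)"

lemma set_integrable_nice:
  fixes K :: "real \<Rightarrow> real^'b::finite^'a::finite" and F :: "real \<Rightarrow> real^'c::finite^'b"
  assumes K: "set_integrable lborel S K" and F: "nice F" and S: "S \<in> sets borel"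
    and h: "h \<in> borel_measurable borel" "\<And>s. s \<in> S \<Longrightarrow> 0 \<le> h s"
  shows "set_integrable lborel S (\<lambda>s. K s ** F (h s))"
proof -
  obtain c where c: "c > 0" "\<And>(X::real^'b^'a) (Y::real^'c^'b). norm (X ** Y) \<le> norm X * norm Y * c"
    using bounded_bilinear.pos_bounded[OF mm_bilin] by metis
  obtain B where B: "\<And>r. r \<ge> 0 \<Longrightarrow> norm (F r) \<le> B" using F by (auto simp: nice_def)
  then have B0: "0 \<le> B" by (meson norm_ge_zero order_refl order_trans)
  let ?F = "\<lambda>r. indicator {0..} r *\<^sub>R F r"
  have F': "?F \<in> borel_measurable borel" using F by (auto simp: nice_def)
  have eq: "indicator S s *\<^sub>R (K s ** F (h s)) = (indicator S s *\<^sub>R K s) ** ?F (h s)" for s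
    using h(2) by (auto simp: indicator_def mm_simps)
  have mK: "(\<lambda>s. indicator S s *\<^sub>R K s) \<in> borel_measurable lborel"
    using K by (auto simp: set_integrable_def)
  have mult: "(\<lambda>(X, Y). (X::real^'b^'a) ** (Y::real^'c^'b)) \<in> borel_measurable borel"
    unfolding split_beta by (intro borel_measurable_continuous_onI bounded_bilinear.continuous_on[OF mm_bilin] continuous_intros)
  have meas: "(\<lambda>s. (indicator S s *\<^sub>R K s) ** ?F (h s)) \<in> borel_measurable lborel"
  proof -
    have "(\<lambda>s. ?F (h s)) \<in> borel_measurable lborel"
      using measurable_compose[OF h(1) F'] by simp
    then have "(\<lambda>s. (indicator S s *\<^sub>R K s, ?F (h s))) \<in> borel_measurable lborel"
      using mK by (rule borel_measurable_Pair[rotated])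
    from measurable_compose[OF this mult] show ?thesis by (simp add: split_beta)
  qed
  show ?thesis unfolding set_integrable_def eq
  proof (rule Bochner_Integration.integrable_bound[OF _ meas])
    show "integrable lborel (\<lambda>s. norm (indicator S s *\<^sub>R K s) * (B * c))"
      using K unfolding set_integrable_def by (intro integrable_mult_left integrable_norm)
    have "norm ((indicator S s *\<^sub>R K s) ** ?F (h s)) \<le> norm (indicator S s *\<^sub>R K s) * (B * c)" for s
    proof -
      have "norm (?F (h s)) \<le> B" using B[of "h s"] B0 by (auto simp: indicator_def)
      then have "norm (indicator S s *\<^sub>R K s) * norm (?F (h s)) * c \<le> norm (indicator S s *\<^sub>R K s) * B * c"
        using c(1) by (intro mult_right_mono mult_left_mono) auto
      with c(2)[of "indicator S s *\<^sub>R K s" "?F (h s)"] show ?thesis by (simp add: mult.assoc)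
    qed
    moreover have "0 \<le> norm (indicator S s *\<^sub>R K s) * (B * c)" for s using B0 c by auto
    ultimately show "AE s in lborel. norm ((indicator S s *\<^sub>R K s) ** ?F (h s)) \<le> norm (norm (indicator S s *\<^sub>R K s) * (B * c))"
      by (intro AE_I2) (metis abs_of_nonneg real_norm_def)
  qed
qed

lemma mm_integral_left:
  fixes f :: "real \<Rightarrow> real^'c::finite^'b::finite" and A :: "real^'b^'a::finite"
  assumes "set_integrable lborel S f"
  shows "A ** (LBINT s:S. f s) = (LBINT s:S. A ** f s)" "set_integrable lborel S (\<lambda>s. A ** f s)"
  using set_integral_bounded_linear[OF bounded_bilinear.bounded_linear_right[OF mm_bilin] assms, of A] by auto

lemma mm_integral_right:
  fixes f :: "real \<Rightarrow> real^'b::finite^'a::finite" and A :: "real^'c::finite^'b"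
  assumes "set_integrable lborel S f"
  shows "(LBINT s:S. f s) ** A = (LBINT s:S. f s ** A)" "set_integrable lborel S (\<lambda>s. f s ** A)"
  using set_integral_bounded_linear[OF bounded_bilinear.bounded_linear_left[OF mm_bilin] assms, of A] by auto

lemma mv_integral:
  fixes f :: "real \<Rightarrow> real^'b::finite^'a::finite" and w :: "real^'b"
  assumes "set_integrable lborel S f"
  shows "(LBINT s:S. f s) *v w = (LBINT s:S. f s *v w)" "set_integrable lborel S (\<lambda>s. f s *v w)"
  using set_integral_bounded_linear[OF bounded_bilinear.bounded_linear_left[OF mv_bilin] assms, of w] by auto

text \<open>
  The flow is \<open>mexp (t *\<^sub>R G)\<close> and \<open>R\<close> collects the jumps. The projections \<open>PD\<close> and \<open>PU\<close> select the rows on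
  which a level falls and rises, with slopes \<open>-1\<close> and \<open>1\<close>; a row that is selected by neither is killed.
  By \<open>loss\<close> no mass is created.
\<close>

locale jump_kernel =
  fixes Z :: "(real^'n::finite) set" and G R PD PU :: "real^'n^'n"
  assumes base: "mass_base Z"
    and flow_pos: "\<And>t. 0 \<le> t \<Longrightarrow> mpos Z Z (mexp (t *\<^sub>R G))"
    and jump_pos: "mpos Z Z R"
    and PD_pos: "mpos Z Z PD" and PU_pos: "mpos Z Z PU" and rest_pos: "mpos Z Z (mat 1 - PD - PU)"
    and proj: "PD ** PD = PD" "PU ** PU = PU" "PD ** PU = 0" "PU ** PD = 0"
    and PD_flow: "PD ** G = G ** PD" and PU_flow: "PU ** G = G ** PU"
    and loss: "- ((G + R) *v 1) \<in> dual Z"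
begin

definition kern :: "real \<Rightarrow> real^'n^'n" where "kern s = mexp (s *\<^sub>R G) ** R"

text \<open>
  One step of the backward recursion, by the first jump. If the level falls, it may run out before
  the jump, which is the first term, or it stands at \<open>r - s\<close> after a jump at time \<open>s\<close>; if it rises, it
  stands at \<open>r + s\<close>.
\<close>

definition step :: "(real \<Rightarrow> real^'n^'n) \<Rightarrow> real \<Rightarrow> real^'n^'n" where
  "step F r = PD ** (mexp (r *\<^sub>R G) + (LBINT s:{0..r}. kern s ** F (r - s)))
            + PU ** (LBINT s:{0..}. kern s ** F (r + s))"

text \<open>The contribution of the paths that exhaust the level with fewer than \<open>n\<close> jumps.\<close>

definition approx :: "nat \<Rightarrow> real \<Rightarrow> real^'n^'n" where
  "approx n = (step ^^ n) (\<lambda>_. 0)"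

definition passage :: "real \<Rightarrow> real^'n^'n" where
  "passage r = lim (\<lambda>n. approx n r)"

lemma approx_0: "approx 0 r = 0" and approx_Suc: "approx (Suc n) = step (approx n)"
  by (simp_all add: approx_def)

lemma one_dual: "1 \<in> dual Z" using base by (rule mass_base_one)

lemma kern_pos: "0 \<le> s \<Longrightarrow> mpos Z Z (kern s)"
  unfolding kern_def by (intro mpos_mult[where Y=Z] flow_pos jump_pos)

lemma kern_continuous: "continuous_on S kern"
  unfolding kern_def by (intro continuous_intros continuous_on_mm)

text \<open>
  The mass \<open>z \<bullet> (mexp (s *\<^sub>R G) *v 1)\<close> decreases and is bounded below, and by \<open>loss\<close> the mass of
  \<open>z v* kern s\<close> is at most minus its derivative. So the mass of the kernel is integrable, and it
  bounds the norm.
\<close>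

lemma kern_integrable: "set_integrable lborel {0..} kern"
proof (rule matrix_set_integrable[OF base])
  fix z assume z: "z \<in> Z"
  let ?F = "\<lambda>s. - (z \<bullet> (mexp (s *\<^sub>R G) *v 1))"
  let ?f = "\<lambda>s. - (z \<bullet> (mexp (s *\<^sub>R G) *v (G *v 1)))"
  have loss': "0 \<le> z \<bullet> (kern s *v 1) \<and> z \<bullet> (kern s *v 1) \<le> ?f s" if "0 \<le> s" for s
  proof -
    have "0 \<le> z \<bullet> (mexp (s *\<^sub>R G) *v (- ((G + R) *v 1)))"
      using mposD[OF flow_pos[OF that] loss] z by (auto simp: dual_def)
    moreover have "0 \<le> z \<bullet> (kern s *v 1)" using mposD[OF kern_pos[OF that] one_dual] z by (auto simp: dual_def)
    ultimately show ?thesis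
      by (simp add: kern_def mv_simps inner_diff_right inner_minus_right matrix_vector_mul_assoc)
  qed
  have der: "(?F has_real_derivative ?f s) (at s)" for s
  proof -
    have "bounded_linear (\<lambda>X. - (z \<bullet> (X *v 1)))"
      by (intro bounded_linear_minus bounded_linear_compose[OF bounded_linear_inner_right] bounded_bilinear.bounded_linear_left[OF mv_bilin])
    from bounded_linear.has_vector_derivative[OF this has_vector_derivative_mexp'[of G s UNIV]]
    show ?thesis by (simp add: has_real_derivative_iff_has_vector_derivative matrix_vector_mul_assoc)
  qed
  have cont: "continuous_on S ?f" for S
    by (intro continuous_intros bounded_bilinear.continuous_on[OF mv_bilin])
  have "incseq (\<lambda>n. ?F (real n))" "\<And>s t. 0 \<le> s \<Longrightarrow> s \<le> t \<Longrightarrow> ?F s \<le> ?F t"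
  proof -
    show mono: "\<And>s t. 0 \<le> s \<Longrightarrow> s \<le> t \<Longrightarrow> ?F s \<le> ?F t"
    proof -
      fix s t :: real assume st: "0 \<le> s" "s \<le> t"
      show "?F s \<le> ?F t"
      proof (rule DERIV_nonneg_imp_nondecreasing[OF st(2)])
        fix x assume "s \<le> x"
        then have "0 \<le> ?f x" using loss'[of x] st by linarith
        then show "\<exists>y. (?F has_real_derivative y) (at x) \<and> 0 \<le> y" using der by blast
      qed
    qed
    show "incseq (\<lambda>n. ?F (real n))" unfolding incseq_def by (intro allI impI mono) auto
  qed
  then have mono: "\<And>s t. 0 \<le> s \<Longrightarrow> s \<le> t \<Longrightarrow> ?F s \<le> ?F t" by blast
  have Fle: "?F s \<le> 0" if "0 \<le> s" for s
    using mposD[OF flow_pos[OF that] one_dual] z by (auto simp: dual_def)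
  have lim: "\<exists>l. (?F \<longlongrightarrow> l) at_top"
  proof -
    obtain l where l: "(\<lambda>n. ?F (real n)) \<longlonglongrightarrow> l"
    proof (rule incseq_convergent[OF \<open>incseq (\<lambda>n. ?F (real n))\<close>, of 0])
      show "\<forall>n. ?F (real n) \<le> 0" using Fle by auto
    qed auto
    have "(?F \<longlongrightarrow> l) at_top"
    proof (rule tendsto_sandwich)
      have fl: "filterlim (\<lambda>t::real. nat \<lfloor>t\<rfloor>) sequentially at_top"
        by (rule filterlim_compose[OF filterlim_nat_sequentially filterlim_floor_sequentially])
      show "((\<lambda>t::real. ?F (real (nat \<lfloor>t\<rfloor>))) \<longlongrightarrow> l) at_top"
        using filterlim_compose[OF l fl] by simp
      show "((\<lambda>t::real. ?F (real (Suc (nat \<lfloor>t\<rfloor>)))) \<longlongrightarrow> l) at_top"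
        using filterlim_compose[OF LIMSEQ_Suc[OF l] fl] by simp
      show "\<forall>\<^sub>F t::real in at_top. ?F (real (nat \<lfloor>t\<rfloor>)) \<le> ?F t"
        using eventually_ge_at_top[of 0] by eventually_elim (intro mono, auto)
      show "\<forall>\<^sub>F t::real in at_top. ?F t \<le> ?F (real (Suc (nat \<lfloor>t\<rfloor>)))"
        using eventually_ge_at_top[of 0]
      proof eventually_elim
        case (elim t)
        then show ?case by (intro mono) (auto, linarith)
      qed
    qed
    then show ?thesis by blast
  qed
  then obtain l where l: "(?F \<longlongrightarrow> l) at_top" by blast
  have mf: "?f \<in> borel_measurable borel" by (intro borel_measurable_continuous_onI cont)
  have "(\<integral>\<^sup>+s. ennreal (?f s) * indicator {0..} s \<partial>lborel) = ennreal (l - ?F 0)"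
    by (rule nn_integral_FTC_atLeast[OF mf der _ l]) (use loss' in \<open>meson order_trans\<close>)
  then have "integrable lborel (\<lambda>s. indicator {0..} s *\<^sub>R ?f s)"
  proof (intro integrableI_nonneg)
    show "(\<lambda>s. indicator {0..} s *\<^sub>R ?f s) \<in> borel_measurable lborel" using mf by simp
    show "AE s in lborel. 0 \<le> indicator {0..} s *\<^sub>R ?f s"
    proof (rule AE_I2)
      fix s show "0 \<le> indicator {0..} s *\<^sub>R ?f s"
        using loss'[of s] by (cases "0 \<le> s") auto
    qed
    have "(\<integral>\<^sup>+ s. ennreal (indicator {0..} s *\<^sub>R ?f s) \<partial>lborel) = (\<integral>\<^sup>+s. ennreal (?f s) * indicator {0..} s \<partial>lborel)"
      by (intro nn_integral_cong) (auto simp: indicator_def)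
    then show "(\<integral>\<^sup>+ s. ennreal (indicator {0..} s *\<^sub>R ?f s) \<partial>lborel) < \<infinity>"
      using \<open>_ = ennreal (l - ?F 0)\<close> by simp
  qed
  then have int: "set_integrable lborel {0..} ?f" by (simp add: set_integrable_def)
  obtain \<kappa> where k: "\<kappa> > 0" "\<And>M z. mpos Z Z M \<Longrightarrow> z \<in> Z \<Longrightarrow> norm (z v* M) \<le> \<kappa> * (z \<bullet> (M *v 1))"
    by (rule mpos_row_bound[OF base]) blast
  have bd: "norm (z v* kern s) \<le> norm (\<kappa> * ?f s)" if "0 \<le> s" for s
  proof -
    have "norm (z v* kern s) \<le> \<kappa> * (z \<bullet> (kern s *v 1))" by (rule k(2)[OF kern_pos[OF that] z])
    also have "\<dots> \<le> \<kappa> * ?f s" using loss'[OF that] k(1) by (intro mult_left_mono) auto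
    also have "\<dots> \<le> norm (\<kappa> * ?f s)" by simp
    finally show ?thesis .
  qed
  show "set_integrable lborel {0..} (\<lambda>s. z v* kern s)"
  proof (rule set_integrable_bound)
    show "set_integrable lborel {0..} (\<lambda>s. \<kappa> * ?f s)" by (intro set_integrable_mult_right) (use int in auto)
    show "set_borel_measurable lborel {0..} (\<lambda>s. z v* kern s)"
      unfolding set_borel_measurable_def measurable_lborel2
      by (intro borel_measurable_continuous_on_indicator bounded_bilinear.continuous_on[OF vm_bilin] kern_continuous continuous_intros) auto
    show "AE s in lborel. s \<in> {0..} \<longrightarrow> norm (z v* kern s) \<le> norm (\<kappa> * ?f s)" using bd by auto
  qed
qed

lemma kern_nice_integrable:
  assumes "nice F"
  shows "set_integrable lborel {0..r} (\<lambda>s. kern s ** F (r - s))"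
    "0 \<le> r \<Longrightarrow> set_integrable lborel {0..} (\<lambda>s. kern s ** F (r + s))"
proof -
  show "set_integrable lborel {0..r} (\<lambda>s. kern s ** F (r - s))"
    by (rule set_integrable_nice[OF set_integrable_continuous[OF kern_continuous] assms]) auto
  show "0 \<le> r \<Longrightarrow> set_integrable lborel {0..} (\<lambda>s. kern s ** F (r + s))"
    by (rule set_integrable_nice[OF kern_integrable assms]) auto
qed

lemma step_mono:
  assumes "nice E" "nice F" "\<And>r. 0 \<le> r \<Longrightarrow> mpos Z Z (F r - E r)" "0 \<le> r"
  shows "mpos Z Z (step F r - step E r)"
proof -
  have "step F r - step E r = PD ** (LBINT s:{0..r}. kern s ** (F (r - s) - E (r - s)))
      + PU ** (LBINT s:{0..}. kern s ** (F (r + s) - E (r + s)))"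
    using assms(4) by (simp add: step_def mm_simps kern_nice_integrable assms set_integral_diff)
  also have "mpos Z Z \<dots>"
    using assms(3,4) by (intro mpos_add mpos_mult[where Y=Z] PD_pos PU_pos mpos_integral kern_pos) auto
  finally show ?thesis .
qed

definition good :: "(real \<Rightarrow> real^'n^'n) \<Rightarrow> bool" where
  "good F \<longleftrightarrow> nice F \<and> (\<forall>r\<ge>0. mpos Z Z (F r) \<and> 1 - F r *v 1 \<in> dual Z)"

lemma uniform_bound: "\<exists>B. \<forall>M. mpos Z Z M \<and> 1 - M *v 1 \<in> dual Z \<longrightarrow> norm M \<le> B"
proof -
  obtain \<kappa> where k: "\<kappa> > 0" "\<And>M z. mpos Z Z M \<Longrightarrow> z \<in> Z \<Longrightarrow> norm (z v* M) \<le> \<kappa> * (z \<bullet> (M *v 1))"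
    by (rule mpos_row_bound[OF base]) blast
  have "\<exists>B. \<forall>M\<in>{M. mpos Z Z M \<and> 1 - M *v 1 \<in> dual Z}. norm M \<le> B"
  proof (rule matrix_bounded[OF base])
    fix z assume z: "z \<in> Z"
    have "norm (z v* M) \<le> \<kappa>" if "mpos Z Z M" "1 - M *v 1 \<in> dual Z" for M
    proof -
      have "z \<bullet> (M *v 1) \<le> 1" using that(2) z base by (auto simp: dual_def mass_base_def inner_diff_right)
      then have "\<kappa> * (z \<bullet> (M *v 1)) \<le> \<kappa> * 1" using k(1) by (intro mult_left_mono) auto
      with k(2)[OF that(1) z] show ?thesis by simp
    qed
    then show "\<exists>B. \<forall>M\<in>{M. mpos Z Z M \<and> 1 - M *v 1 \<in> dual Z}. norm (z v* M) \<le> B" by blast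
  qed
  then show ?thesis by blast
qed

lemma goodI:
  assumes "(\<lambda>r. indicator {0..} r *\<^sub>R F r) \<in> borel_measurable borel"
    "\<And>r. 0 \<le> r \<Longrightarrow> mpos Z Z (F r) \<and> 1 - F r *v 1 \<in> dual Z"
  shows "good F"
  using uniform_bound assms unfolding good_def nice_def by blast

text \<open>
  The two parts of a step after a change of variables. Now \<open>r\<close> occurs in the limits of integration and
  in exponential factors only, so \<open>step F\<close> can be differentiated even where \<open>F\<close> cannot.
\<close>

definition down_part :: "(real \<Rightarrow> real^'n^'n) \<Rightarrow> real \<Rightarrow> real^'n^'n" where
  "down_part F r = mexp (r *\<^sub>R G) ** (mat 1 + (LBINT u:{0..r}. mexp ((0 - u) *\<^sub>R G) ** R ** F u))"

definition up_part :: "(real \<Rightarrow> real^'n^'n) \<Rightarrow> real \<Rightarrow> real^'n^'n" where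
  "up_part F r = mexp ((0 - r) *\<^sub>R G) ** ((LBINT u:{0..}. kern u ** F u) - (LBINT u:{0..r}. kern u ** F u))"

lemma back_integrable:
  assumes "nice F"
  shows "set_integrable lborel {0..r} (\<lambda>u. mexp ((0 - u) *\<^sub>R G) ** R ** F u)"
  by (rule set_integrable_nice[OF set_integrable_continuous assms], intro continuous_intros continuous_on_mm) auto

lemma forward_integrable:
  assumes "nice F"
  shows "set_integrable lborel {0..} (\<lambda>u. kern u ** F u)" "set_integrable lborel {0..r} (\<lambda>u. kern u ** F u)"
proof -
  show "set_integrable lborel {0..} (\<lambda>u. kern u ** F u)"
    by (rule set_integrable_nice[OF kern_integrable assms]) auto
  then show "set_integrable lborel {0..r} (\<lambda>u. kern u ** F u)"
    by (rule set_integrable_subset) auto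
qed

lemma step_parts:
  assumes F: "nice F" and r: "0 \<le> r"
  shows "step F r = PD ** down_part F r + PU ** up_part F r"
proof -
  have "(LBINT s:{0..r}. kern s ** F (r - s)) = (LBINT u:{0..r}. kern (r - u) ** F u)"
    by (subst set_integral_reflect_interval) simp
  also have "\<dots> = (LBINT u:{0..r}. mexp (r *\<^sub>R G) ** (mexp ((0 - u) *\<^sub>R G) ** R ** F u))"
    using mexp_add[of r "- u" G for u] by (simp add: kern_def matrix_mul_assoc)
  also have "\<dots> = mexp (r *\<^sub>R G) ** (LBINT u:{0..r}. mexp ((0 - u) *\<^sub>R G) ** R ** F u)"
    by (rule mm_integral_left(1)[symmetric, OF back_integrable[OF F]])
  finally have 1: "mexp (r *\<^sub>R G) + (LBINT s:{0..r}. kern s ** F (r - s)) = down_part F r"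
    by (simp add: down_part_def mm_simps)
  have "(LBINT s:{0..}. kern s ** F (r + s)) = (LBINT u:{r..}. kern (u - r) ** F u)"
    by (subst set_integral_shift_halfline[where r=r]) simp
  also have "\<dots> = (LBINT u:{r..}. mexp ((0 - r) *\<^sub>R G) ** (kern u ** F u))"
    using mexp_add[of "- r" u G for u] by (simp add: kern_def matrix_mul_assoc)
  also have "\<dots> = mexp ((0 - r) *\<^sub>R G) ** (LBINT u:{r..}. kern u ** F u)"
    by (rule mm_integral_left(1)[symmetric, OF set_integrable_subset[OF forward_integrable(1)[OF F]]]) (use r in auto)
  also have "\<dots> = up_part F r"
    by (simp add: up_part_def set_integral_tail[OF forward_integrable(1)[OF F] r])
  finally show ?thesis using 1 by (simp add: step_def)
qed

lemma step_continuous: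
  assumes F: "nice F"
  shows "continuous_on {0..} (step F)"
proof -
  have "continuous_on {0..} (\<lambda>r. PD ** down_part F r + PU ** up_part F r)"
    unfolding down_part_def up_part_def
    by (intro continuous_intros continuous_on_mm set_integral_continuous_upper back_integrable[OF F] forward_integrable[OF F])
  then show ?thesis by (rule continuous_on_eq) (simp add: step_parts[OF F])
qed

lemma step_derivative:
  assumes F: "nice F" "continuous_on {0..} F" and r: "0 \<le> r"
  shows "(step F has_vector_derivative
      (PD ** (G ** down_part F r + R ** F r) - PU ** (G ** up_part F r + R ** F r))) (at r within {0..})"
proof -
  have d1: "(down_part F has_vector_derivative G ** down_part F r + R ** F r) (at r within {0..})"
  proof -
    have "((\<lambda>r. LBINT u:{0..r}. mexp ((0 - u) *\<^sub>R G) ** R ** F u) has_vector_derivative mexp ((0 - r) *\<^sub>R G) ** R ** F r) (at r within {0..})"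
      by (rule set_integral_has_vector_derivative_upper[OF _ r]) (intro continuous_intros continuous_on_mm F)
    from has_vector_derivative_mm[OF has_vector_derivative_mexp[of G r] has_vector_derivative_add[OF has_vector_derivative_const[of "mat 1"] this]]
    have "(down_part F has_vector_derivative
       (mexp (r *\<^sub>R G) ** (0 + mexp ((0 - r) *\<^sub>R G) ** R ** F r) + G ** mexp (r *\<^sub>R G) ** (mat 1 + (LBINT u:{0..r}. mexp ((0 - u) *\<^sub>R G) ** R ** F u))))
       (at r within {0..})"
      by (simp add: down_part_def[abs_def])
    moreover have "mexp (r *\<^sub>R G) ** (mexp ((0 - r) *\<^sub>R G) ** R ** F r) = R ** F r"
    proof -
      have "mexp (r *\<^sub>R G) ** mexp ((0 - r) *\<^sub>R G) = mat 1" using mexp_add[of r "0 - r" G] by simp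
      then show ?thesis by (simp only: matrix_mul_assoc matrix_mul_lid)
    qed
    ultimately show ?thesis by (simp add: down_part_def matrix_mul_assoc add.commute)
  qed
  have d2: "(up_part F has_vector_derivative - (G ** up_part F r + R ** F r)) (at r within {0..})"
  proof -
    let ?I = "LBINT u:{0..}. kern u ** F u"
    have "((\<lambda>r. LBINT u:{0..r}. kern u ** F u) has_vector_derivative kern r ** F r) (at r within {0..})"
      by (rule set_integral_has_vector_derivative_upper[OF _ r]) (intro continuous_intros continuous_on_mm F kern_continuous)
    from has_vector_derivative_mm[OF has_vector_derivative_mexp_neg[of 0 G r] has_vector_derivative_diff[OF has_vector_derivative_const[of ?I] this]]
    have "(up_part F has_vector_derivative
        (mexp ((0 - r) *\<^sub>R G) ** (0 - kern r ** F r) + - (mexp ((0 - r) *\<^sub>R G) ** G) ** (?I - (LBINT u:{0..r}. kern u ** F u))))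
        (at r within {0..})"
      by (simp add: up_part_def[abs_def])
    moreover have "mexp ((0 - r) *\<^sub>R G) ** (kern r ** F r) = R ** F r"
    proof -
      have "mexp ((0 - r) *\<^sub>R G) ** mexp (r *\<^sub>R G) = mat 1" using mexp_add[of "0 - r" r G] by simp
      then show ?thesis by (simp only: kern_def matrix_mul_assoc matrix_mul_lid)
    qed
    moreover have "mexp ((0 - r) *\<^sub>R G) ** G = G ** mexp ((0 - r) *\<^sub>R G)"
      by (rule mexp_commute[symmetric])
    ultimately show ?thesis by (simp add: up_part_def mm_simps matrix_mul_assoc add.commute)
  qed
  have "((\<lambda>r. PD ** down_part F r + PU ** up_part F r) has_vector_derivative
      (PD ** (G ** down_part F r + R ** F r) - PU ** (G ** up_part F r + R ** F r))) (at r within {0..})"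
    by (rule has_vector_derivative_eq_rhs[OF has_vector_derivative_add[OF
          has_vector_derivative_mm[OF has_vector_derivative_const d1]
          has_vector_derivative_mm[OF has_vector_derivative_const d2]]])
       (simp add: mm_simps)
  then show ?thesis
    by (rule has_vector_derivative_transform[rotated 2]) (use r in \<open>auto simp: step_parts[OF F(1)]\<close>)
qed

text \<open>
  By \<open>loss\<close> the mass that has jumped by time \<open>t\<close> is at most \<open>1 - mexp (t *\<^sub>R G) *v 1\<close>: write the latter as
  an integral and compare integrands.
\<close>

lemma step_mass:
  assumes F: "good F" and r: "0 \<le> r"
  shows "1 - step F r *v 1 \<in> dual Z"
proof -
  have nF: "nice F" and pF: "\<And>r. 0 \<le> r \<Longrightarrow> mpos Z Z (F r)" and mF: "\<And>r. 0 \<le> r \<Longrightarrow> 1 - F r *v 1 \<in> dual Z"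
    using F by (auto simp: good_def)
  note kn = kern_nice_integrable[OF nF]
  have ftc: "(LBINT s:{0..t}. mexp (s *\<^sub>R G) ** G) = mexp (t *\<^sub>R G) - mat 1" if "0 \<le> t" for t
    using set_integral_FTC[OF that has_vector_derivative_mexp', of G]
    by (simp add: continuous_on_mexp continuous_on_mm continuous_on_const)
  have gi: "set_integrable lborel {0..t} (\<lambda>s. mexp (s *\<^sub>R G) ** G)" for t
    by (intro set_integrable_continuous continuous_on_mm continuous_on_mexp continuous_intros)
  have key: "1 - mexp (t *\<^sub>R G) *v 1 - (LBINT s:{0..t}. kern s ** F (h s)) *v 1 \<in> dual Z"
    if t: "0 \<le> t" and h: "\<And>s. 0 \<le> s \<Longrightarrow> s \<le> t \<Longrightarrow> 0 \<le> h s"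
      and i: "set_integrable lborel {0..t} (\<lambda>s. kern s ** F (h s))" for t h
  proof -
    have "1 - mexp (t *\<^sub>R G) *v 1 - (LBINT s:{0..t}. kern s ** F (h s)) *v 1
       = - ((LBINT s:{0..t}. mexp (s *\<^sub>R G) ** G) *v 1) - (LBINT s:{0..t}. kern s ** F (h s)) *v 1"
      by (simp add: ftc[OF t] mv_simps)
    also have "\<dots> = - (LBINT s:{0..t}. (mexp (s *\<^sub>R G) ** G) *v 1 + (kern s ** F (h s)) *v 1)"
      by (subst set_integral_add) (auto simp: mv_integral[OF gi] mv_integral[OF i])
    also have "\<dots> = (LBINT s:{0..t}. - ((mexp (s *\<^sub>R G) ** G) *v 1 + (kern s ** F (h s)) *v 1))"
      by (simp only: set_lebesgue_integral_def scaleR_minus_right Bochner_Integration.integral_minus)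
    also have "\<dots> \<in> dual Z"
    proof (rule dual_integral)
      fix s assume s: "s \<in> {0..t}"
      have "- ((G + R) *v 1) + R *v (1 - F (h s) *v 1) \<in> dual Z"
        using s h by (intro dual_add loss mposD[OF jump_pos] mF) auto
      from mposD[OF flow_pos this, of s] s
      show "- ((mexp (s *\<^sub>R G) ** G) *v 1 + (kern s ** F (h s)) *v 1) \<in> dual Z"
        by (simp add: kern_def mv_simps matrix_vector_mul_assoc matrix_mul_assoc)
    qed
    finally show ?thesis .
  qed
  have 1: "1 - mexp (r *\<^sub>R G) *v 1 - (LBINT s:{0..r}. kern s ** F (r - s)) *v 1 \<in> dual Z"
    by (rule key[OF r _ kn(1)]) auto
  have 2: "1 - (LBINT s:{0..}. kern s ** F (r + s)) *v 1 \<in> dual Z"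
  proof (rule dual_lim)
    show "((\<lambda>t. 1 - (LBINT s:{0..t}. kern s ** F (r + s)) *v 1) \<longlongrightarrow> 1 - (LBINT s:{0..}. kern s ** F (r + s)) *v 1) at_top"
      by (intro tendsto_intros bounded_bilinear.tendsto[OF mv_bilin] tendsto_set_lebesgue_integral_at_top kn(2)[OF r]) auto
    have "1 - (LBINT s:{0..t}. kern s ** F (r + s)) *v 1 \<in> dual Z" if "0 \<le> t" for t
    proof -
      have "set_integrable lborel {0..t} (\<lambda>s. kern s ** F (r + s))"
        by (rule set_integrable_subset[OF kn(2)[OF r]]) auto
      then have "1 - mexp (t *\<^sub>R G) *v 1 - (LBINT s:{0..t}. kern s ** F (r + s)) *v 1 \<in> dual Z"
        by (intro key that) (use r in auto)
      from dual_add[OF this mposD[OF flow_pos[OF that] one_dual]] show ?thesis by (simp add: algebra_simps)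
    qed
    then show "\<forall>\<^sub>F t in at_top. 1 - (LBINT s:{0..t}. kern s ** F (r + s)) *v 1 \<in> dual Z"
      by (intro eventually_mono[OF eventually_ge_at_top[of "0::real"]]) simp
  qed auto
  have "1 - step F r *v 1 = (mat 1 - PD - PU) *v 1
      + PD *v (1 - mexp (r *\<^sub>R G) *v 1 - (LBINT s:{0..r}. kern s ** F (r - s)) *v 1)
      + PU *v (1 - (LBINT s:{0..}. kern s ** F (r + s)) *v 1)"
    by (simp add: step_def mv_simps mm_simps matrix_vector_mul_assoc)
  also have "\<dots> \<in> dual Z"
    by (intro dual_add mposD[OF rest_pos] mposD[OF PD_pos] mposD[OF PU_pos] one_dual 1 2)
  finally show ?thesis .
qed

lemma step_good: assumes "good F" shows "good (step F)"
proof (rule goodI)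
  show "(\<lambda>r. indicator {0..} r *\<^sub>R step F r) \<in> borel_measurable borel"
    using assms by (intro borel_measurable_continuous_on_indicator step_continuous) (auto simp: good_def)
  fix r :: real assume "0 \<le> r"
  then show "mpos Z Z (step F r) \<and> 1 - step F r *v 1 \<in> dual Z"
    using assms unfolding step_def[of F r, THEN arg_cong[where f="mpos Z Z"]]
    by (intro conjI step_mass mpos_add mpos_mult[where Y=Z] PD_pos PU_pos mpos_integral kern_pos flow_pos)
       (auto simp: good_def)
qed

lemma good_0: "good (\<lambda>_. 0)"
  by (rule goodI) (auto simp: mv_simps one_dual)

lemma approx_good: "good (approx n)"
  by (induction n) (simp_all add: approx_def good_0[simplified] step_good)

lemma approx_mono: "0 \<le> r \<Longrightarrow> mpos Z Z (approx (Suc n) r - approx n r)"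
proof (induction n arbitrary: r)
  case 0
  then show ?case using approx_good[of "Suc 0"] by (simp add: good_def approx_0)
next
  case (Suc n)
  then show ?case using approx_good by (simp add: approx_Suc[of "Suc n"]  approx_Suc[of "n"] good_def)
    (intro step_mono, auto simp: approx_Suc[symmetric] good_def)
qed

lemma approx_tendsto: assumes "0 \<le> r" shows "(\<lambda>n. approx n r) \<longlonglongrightarrow> passage r"
proof -
  have "convergent (\<lambda>n. approx n r)"
  proof (rule matrix_mono_convergent[OF base base, of "\<lambda>n. approx n r" 1, OF approx_mono[OF assms]])
    fix n z assume "z \<in> Z"
    then show "z \<bullet> (approx n r *v 1) \<le> 1"
      using approx_good[of n] assms base by (auto simp: good_def dual_def mass_base_def inner_diff_right)
  qed
  then show ?thesis by (simp add: passage_def convergent_LIMSEQ_iff)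
qed

lemma passage_good: "good passage"
proof (rule goodI)
  show "(\<lambda>r. indicator {0..} r *\<^sub>R passage r) \<in> borel_measurable borel"
  proof (rule borel_measurable_LIMSEQ_metric)
    show "(\<lambda>r. indicator {0..} r *\<^sub>R approx n r) \<in> borel_measurable borel" for n
      using approx_good[of n] by (auto simp: good_def nice_def)
    show "(\<lambda>n. indicator {0..} r *\<^sub>R approx n r) \<longlonglongrightarrow> indicator {0..} r *\<^sub>R passage r" for r
      by (cases "0 \<le> r") (auto intro!: tendsto_intros approx_tendsto)
  qed
  fix r :: real assume r: "0 \<le> r"
  show "mpos Z Z (passage r) \<and> 1 - passage r *v 1 \<in> dual Z"
    using approx_good r unfolding good_def
    by (auto intro!: mpos_lim[OF approx_tendsto[OF r]] always_eventually
         dual_lim[OF tendsto_diff[OF tendsto_const bounded_bilinear.tendsto[OF mv_bilin approx_tendsto[OF r] tendsto_const]]])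
qed

end

lemma nice_dominated:
  fixes K :: "real \<Rightarrow> real^'b::finite^'a::finite" and F :: "real \<Rightarrow> real^'c::finite^'b"
  assumes K: "set_integrable lborel S K" and S: "S \<in> sets borel"
    and E: "\<And>n. nice (E n)" "\<And>n r. 0 \<le> r \<Longrightarrow> norm (E n r) \<le> B" and F: "nice F"
    and lim: "\<And>r. 0 \<le> r \<Longrightarrow> (\<lambda>n. E n r) \<longlonglongrightarrow> F r"
    and h: "h \<in> borel_measurable borel" "\<And>s. s \<in> S \<Longrightarrow> 0 \<le> h s"
  shows "(\<lambda>n. LBINT s:S. K s ** E n (h s)) \<longlonglongrightarrow> (LBINT s:S. K s ** F (h s))"
proof -
  obtain c where c: "c > 0" "\<And>(X::real^'b^'a) (Y::real^'c^'b). norm (X ** Y) \<le> norm X * norm Y * c"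
    using bounded_bilinear.pos_bounded[OF mm_bilin] by metis
  show ?thesis unfolding set_lebesgue_integral_def
  proof (rule integral_dominated_convergence[where w="\<lambda>s. norm (indicator S s *\<^sub>R K s) * (B * c)"])
    show "(\<lambda>s. indicator S s *\<^sub>R (K s ** F (h s))) \<in> borel_measurable lborel"
      using set_integrable_nice[OF K F S h] by (auto simp: set_integrable_def)
    show "(\<lambda>s. indicator S s *\<^sub>R (K s ** E n (h s))) \<in> borel_measurable lborel" for n
      using set_integrable_nice[OF K E(1) S h] by (auto simp: set_integrable_def)
    show "integrable lborel (\<lambda>s. norm (indicator S s *\<^sub>R K s) * (B * c))"
      using K unfolding set_integrable_def by (intro integrable_mult_left integrable_norm)
    show "AE s in lborel. (\<lambda>n. indicator S s *\<^sub>R (K s ** E n (h s))) \<longlonglongrightarrow> indicator S s *\<^sub>R (K s ** F (h s))"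
      using h(2) by (intro AE_I2) (auto simp: indicator_def intro!: bounded_bilinear.tendsto[OF mm_bilin] lim)
    have "norm (indicator S s *\<^sub>R (K s ** E n (h s))) \<le> norm (indicator S s *\<^sub>R K s) * (B * c)" for n s
    proof (cases "s \<in> S")
      case True
      have "norm (K s ** E n (h s)) \<le> norm (K s) * norm (E n (h s)) * c" by (rule c)
      also have "\<dots> \<le> norm (K s) * B * c"
        using E(2)[OF h(2)[OF True], of n] c(1) by (intro mult_right_mono mult_left_mono) auto
      finally show ?thesis using True by (simp add: mult.assoc)
    qed simp
    then show "AE s in lborel. norm (indicator S s *\<^sub>R (K s ** E n (h s))) \<le> norm (indicator S s *\<^sub>R K s) * (B * c)" for n
      by simp
  qed
qed

context jump_kernel
begin

lemma passage_fixed: assumes r: "0 \<le> r" shows "passage r = step passage r"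
proof -
  obtain B where B: "\<And>M. mpos Z Z M \<and> 1 - M *v 1 \<in> dual Z \<Longrightarrow> norm M \<le> B"
    using uniform_bound by blast
  have E: "nice (approx n)" "0 \<le> r \<Longrightarrow> norm (approx n r) \<le> B" for n r
    using approx_good[of n] B by (auto simp: good_def)
  have F: "nice passage" using passage_good by (simp add: good_def)
  have "(\<lambda>n. step (approx n) r) \<longlonglongrightarrow> step passage r"
    unfolding step_def
    by (intro tendsto_add bounded_bilinear.tendsto[OF mm_bilin] tendsto_const
          nice_dominated[OF set_integrable_continuous[OF kern_continuous] _ E F approx_tendsto]
          nice_dominated[OF kern_integrable _ E F approx_tendsto]) (use r in auto)
  then have "(\<lambda>n. approx (Suc n) r) \<longlonglongrightarrow> step passage r" by (simp add: approx_Suc)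
  then show ?thesis using LIMSEQ_Suc[OF approx_tendsto[OF r]] LIMSEQ_unique by blast
qed

lemma passage_continuous: "continuous_on {0..} passage"
  by (rule continuous_on_eq[OF step_continuous])
     (use passage_good passage_fixed in \<open>auto simp: good_def\<close>)

lemma passage_0: "PD ** passage 0 = PD"
proof -
  have "(LBINT s:{0..0}. kern s ** passage (0 - s)) = 0"
    unfolding set_lebesgue_integral_def
    by (rule integral_eq_zero_AE) (use AE_lborel_singleton[of "0::real"] in \<open>auto elim!: eventually_mono\<close>)
  then show ?thesis
    by (simp add: passage_fixed[of 0] step_def mm_simps matrix_mul_assoc proj)
qed

text \<open>
  In the formula of \<open>step_derivative\<close> the down part may be replaced by \<open>passage\<close> behind \<open>PD ** G\<close>, and the
  up part behind \<open>PU ** G\<close>, because the projections commute with \<open>G\<close> and annihilate each other.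
\<close>

lemma passage_ode:
  assumes r: "0 \<le> r"
  shows "(passage has_vector_derivative (PD - PU) ** (G + R) ** passage r) (at r within {0..})"
proof -
  have F: "nice passage" using passage_good by (simp add: good_def)
  have p: "passage r = PD ** down_part passage r + PU ** up_part passage r"
    using passage_fixed[OF r] step_parts[OF F r] by simp
  have "(step passage has_vector_derivative (PD ** (G ** down_part passage r + R ** passage r) - PU ** (G ** up_part passage r + R ** passage r))) (at r within {0..})"
    by (rule step_derivative[OF F passage_continuous r])
  then have "(passage has_vector_derivative (PD ** (G ** down_part passage r + R ** passage r) - PU ** (G ** up_part passage r + R ** passage r))) (at r within {0..})"
    by (rule has_vector_derivative_transform[rotated 2]) (use r in \<open>auto simp: passage_fixed\<close>)
  moreover have "PD ** (G ** down_part passage r) = PD ** (G ** passage r)"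
  proof -
    have "PD ** (G ** passage r) = G ** (PD ** passage r)" by (simp add: matrix_mul_assoc PD_flow)
    also have "PD ** passage r = PD ** down_part passage r" by (simp add: p mm_simps matrix_mul_assoc proj)
    finally show ?thesis by (simp add: matrix_mul_assoc PD_flow)
  qed
  moreover have "PU ** (G ** up_part passage r) = PU ** (G ** passage r)"
  proof -
    have "PU ** (G ** passage r) = G ** (PU ** passage r)" by (simp add: matrix_mul_assoc PU_flow)
    also have "PU ** passage r = PU ** up_part passage r" by (simp add: p mm_simps matrix_mul_assoc proj)
    finally show ?thesis by (simp add: matrix_mul_assoc PU_flow)
  qed
  ultimately show ?thesis by (simp add: mm_simps matrix_mul_assoc algebra_simps)
qed

text \<open>
  Since \<open>h\<close> may be unbounded, it need not be a fixed point of \<open>step\<close>. Variation of constants gives the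
  equation of \<open>step\<close> on the falling rows, and on the rising rows the equation with the integral up to
  a finite \<open>t\<close> plus a positive remainder; dropping the remainder leaves an inequality, which suffices
  to compare with \<open>approx n\<close> by induction on \<open>n\<close>.
\<close>

lemma passage_minimal:
  fixes h :: "real \<Rightarrow> real^'n^'n"
  assumes pos: "\<And>r. 0 \<le> r \<Longrightarrow> mpos Z Z (h r)"
    and ode: "\<And>r. 0 \<le> r \<Longrightarrow> (h has_vector_derivative (PD - PU) ** (G + R) ** h r) (at r within {0..})"
    and init: "mpos Z Z (PD ** (h 0 - X))" and r: "0 \<le> r"
  shows "mpos Z Z (h r - passage r ** X)"
proof -
  have hc: "continuous_on {0..} h"
    unfolding continuous_on_eq_continuous_within using has_vector_derivative_continuous[OF ode] by auto
  have hcomp: "continuous_on S (\<lambda>s. h (f s))" if "continuous_on S f" "\<And>s. s \<in> S \<Longrightarrow> 0 \<le> f s" for S and f :: "real \<Rightarrow> real"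
    by (rule continuous_on_compose2[OF hc that(1)]) (use that in auto)
  have down: "PD ** h r = PD ** (mexp (r *\<^sub>R G) ** h 0 + (LBINT s:{0..r}. kern s ** h (r - s)))" if r: "0 \<le> r" for r
  proof -
    have ki: "set_integrable lborel {0..r} (\<lambda>s. kern s ** h (r - s))"
      by (intro set_integrable_continuous continuous_on_mm kern_continuous hcomp continuous_intros) auto
    let ?f = "\<lambda>s. - (PD ** (kern s ** h (r - s)))"
    have "(LBINT s:{0..r}. ?f s) = mexp (r *\<^sub>R G) ** (PD ** h (r - r)) - mexp (0 *\<^sub>R G) ** (PD ** h (r - 0))"
    proof (rule set_integral_FTC[OF r])
      show "continuous_on {0..r} ?f"
        by (intro continuous_intros continuous_on_mm kern_continuous hcomp) auto
      fix s assume s: "0 \<le> s" "s \<le> r"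
      have "(h \<circ> (\<lambda>s. r - s) has_vector_derivative (-1) *\<^sub>R ((PD - PU) ** (G + R) ** h (r - s))) (at s within {0..r})"
      proof (rule vector_diff_chain_within)
        show "((\<lambda>s. r - s) has_vector_derivative - 1) (at s within {0..r})"
          by (auto intro!: derivative_eq_intros)
        show "(h has_vector_derivative (PD - PU) ** (G + R) ** h (r - s)) (at (r - s) within (\<lambda>s. r - s) ` {0..r})"
          by (rule has_vector_derivative_within_subset[OF ode]) (use s in auto)
      qed
      then have dh: "((\<lambda>s. h (r - s)) has_vector_derivative - ((PD - PU) ** (G + R) ** h (r - s))) (at s within {0..r})"
        by (simp add: o_def)
      have eq: "mexp (s *\<^sub>R G) ** (PD ** (- ((PD - PU) ** (G + R) ** h (r - s)))) + mexp (s *\<^sub>R G) ** G ** (PD ** h (r - s)) = ?f s"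
      proof -
        have e1: "PD ** ((PD - PU) ** (G + R) ** h (r - s)) = PD ** (G + R) ** h (r - s)"
          by (simp add: mm_simps matrix_mul_assoc proj)
        have e2: "mexp (s *\<^sub>R G) ** G ** (PD ** h (r - s)) = mexp (s *\<^sub>R G) ** (PD ** G) ** h (r - s)"
          by (simp add: PD_flow matrix_mul_assoc)
        have e3: "PD ** (kern s ** h (r - s)) = mexp (s *\<^sub>R G) ** PD ** R ** h (r - s)"
          using mexp_commute_with[OF PD_flow s(1)] by (simp add: kern_def matrix_mul_assoc)
        show ?thesis
          by (simp only: bounded_bilinear.minus_right[OF mm_bilin] e1 e2 e3) (simp add: mm_simps matrix_mul_assoc)
      qed
      show "((\<lambda>s. mexp (s *\<^sub>R G) ** (PD ** h (r - s))) has_vector_derivative ?f s) (at s within {0..r})"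
        by (rule has_vector_derivative_eq_rhs[OF has_vector_derivative_mm[OF has_vector_derivative_mexp'
              has_vector_derivative_mm[OF has_vector_derivative_const dh]]]) (use eq in \<open>simp add: mm_simps\<close>)
    qed
    moreover have "(LBINT s:{0..r}. ?f s) = - (PD ** (LBINT s:{0..r}. kern s ** h (r - s)))"
      unfolding mm_integral_left(1)[OF ki]
      by (simp only: set_lebesgue_integral_def scaleR_minus_right Bochner_Integration.integral_minus)
    ultimately show ?thesis
      using mexp_commute_with[OF PD_flow r] by (simp add: mm_simps matrix_mul_assoc algebra_simps)
  qed
  have up: "PU ** h r = mexp (t *\<^sub>R G) ** (PU ** h (r + t)) + PU ** (LBINT s:{0..t}. kern s ** h (r + s))"
    if r: "0 \<le> r" and t: "0 \<le> t" for r t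
  proof -
    have ki: "set_integrable lborel {0..t} (\<lambda>s. kern s ** h (r + s))"
      by (intro set_integrable_continuous continuous_on_mm kern_continuous hcomp continuous_intros) (use r in auto)
    let ?f = "\<lambda>s. - (PU ** (kern s ** h (r + s)))"
    have "(LBINT s:{0..t}. ?f s) = mexp (t *\<^sub>R G) ** (PU ** h (r + t)) - mexp (0 *\<^sub>R G) ** (PU ** h (r + 0))"
    proof (rule set_integral_FTC[OF t])
      show "continuous_on {0..t} ?f"
        by (intro continuous_intros continuous_on_mm kern_continuous hcomp) (use r in auto)
      fix s assume s: "0 \<le> s" "s \<le> t"
      have "(h \<circ> (\<lambda>s. r + s) has_vector_derivative 1 *\<^sub>R ((PD - PU) ** (G + R) ** h (r + s))) (at s within {0..t})"
      proof (rule vector_diff_chain_within)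
        show "((\<lambda>s. r + s) has_vector_derivative 1) (at s within {0..t})"
          by (auto intro!: derivative_eq_intros)
        show "(h has_vector_derivative (PD - PU) ** (G + R) ** h (r + s)) (at (r + s) within (\<lambda>s. r + s) ` {0..t})"
          by (rule has_vector_derivative_within_subset[OF ode]) (use s r in auto)
      qed
      then have dh: "((\<lambda>s. h (r + s)) has_vector_derivative ((PD - PU) ** (G + R) ** h (r + s))) (at s within {0..t})"
        by (simp add: o_def)
      have eq: "mexp (s *\<^sub>R G) ** (PU ** ((PD - PU) ** (G + R) ** h (r + s))) + mexp (s *\<^sub>R G) ** G ** (PU ** h (r + s)) = ?f s"
      proof -
        have e1: "PU ** ((PD - PU) ** (G + R) ** h (r + s)) = - (PU ** (G + R) ** h (r + s))"
          by (simp add: mm_simps matrix_mul_assoc proj)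
        have e2: "mexp (s *\<^sub>R G) ** G ** (PU ** h (r + s)) = mexp (s *\<^sub>R G) ** (PU ** G) ** h (r + s)"
          by (simp add: PU_flow matrix_mul_assoc)
        have e3: "PU ** (kern s ** h (r + s)) = mexp (s *\<^sub>R G) ** PU ** R ** h (r + s)"
          using mexp_commute_with[OF PU_flow s(1)] by (simp add: kern_def matrix_mul_assoc)
        show ?thesis
          by (simp only: bounded_bilinear.minus_right[OF mm_bilin] e1 e2 e3) (simp add: mm_simps matrix_mul_assoc)
      qed
      show "((\<lambda>s. mexp (s *\<^sub>R G) ** (PU ** h (r + s))) has_vector_derivative ?f s) (at s within {0..t})"
        by (rule has_vector_derivative_eq_rhs[OF has_vector_derivative_mm[OF has_vector_derivative_mexp'
              has_vector_derivative_mm[OF has_vector_derivative_const dh]]]) (use eq in \<open>simp add: mm_simps\<close>)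
    qed
    moreover have "(LBINT s:{0..t}. ?f s) = - (PU ** (LBINT s:{0..t}. kern s ** h (r + s)))"
      unfolding mm_integral_left(1)[OF ki]
      by (simp only: set_lebesgue_integral_def scaleR_minus_right Bochner_Integration.integral_minus)
    ultimately show ?thesis by (simp add: algebra_simps)
  qed
  have approx: "mpos Z Z (h r - approx n r ** X)" if "0 \<le> r" for n r
    using that
  proof (induction n arbitrary: r)
    case 0
    then show ?case by (simp add: approx_0 mm_simps pos)
  next
    case (Suc n)
    let ?A = "approx n"
    have nA: "nice ?A" using approx_good[of n] by (simp add: good_def)
    note ki = kern_nice_integrable[OF nA]
    let ?L = "LBINT s:{0..r}. kern s ** ?A (r - s)" and ?U = "\<lambda>t. LBINT s:{0..t}. kern s ** ?A (r + s)"
      and ?UI = "LBINT s:{0..}. kern s ** ?A (r + s)"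
    have "(LBINT s:{0..r}. kern s ** h (r - s)) - ?L ** X = (LBINT s:{0..r}. kern s ** (h (r - s) - ?A (r - s) ** X))"
    proof -
      have "set_integrable lborel {0..r} (\<lambda>s. kern s ** h (r - s))"
        by (intro set_integrable_continuous continuous_on_mm kern_continuous hcomp continuous_intros) auto
      then show ?thesis
        by (simp add: mm_simps set_integral_diff mm_integral_right[OF ki(1)] matrix_mul_assoc)
    qed
    then have 1: "mpos Z Z ((LBINT s:{0..r}. kern s ** h (r - s)) - ?L ** X)"
      using Suc by (auto intro!: mpos_integral mpos_mult[where Y=Z] kern_pos)
    have 2: "mpos Z Z (PU ** h r - PU ** (?UI ** X))"
    proof (rule mpos_lim)
      show "((\<lambda>t. PU ** h r - PU ** (?U t ** X)) \<longlongrightarrow> PU ** h r - PU ** (?UI ** X)) at_top"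
        by (intro tendsto_diff tendsto_const bounded_bilinear.tendsto[OF mm_bilin] tendsto_set_lebesgue_integral_at_top ki(2)[OF Suc.prems]) auto
      have "mpos Z Z (PU ** h r - PU ** (?U t ** X))" if t: "0 \<le> t" for t
      proof -
        have "set_integrable lborel {0..t} (\<lambda>s. kern s ** h (r + s))"
          by (intro set_integrable_continuous continuous_on_mm kern_continuous hcomp continuous_intros) (use Suc.prems in auto)
        moreover have "set_integrable lborel {0..t} (\<lambda>s. kern s ** ?A (r + s))"
          by (rule set_integrable_subset[OF ki(2)[OF Suc.prems]]) auto
        ultimately have e: "(LBINT s:{0..t}. kern s ** h (r + s)) - ?U t ** X = (LBINT s:{0..t}. kern s ** (h (r + s) - ?A (r + s) ** X))"
          by (simp add: mm_simps set_integral_diff mm_integral_right matrix_mul_assoc)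
        have "PU ** h r - PU ** (?U t ** X) = mexp (t *\<^sub>R G) ** (PU ** h (r + t)) + PU ** (LBINT s:{0..t}. kern s ** (h (r + s) - ?A (r + s) ** X))"
          unfolding up[OF Suc.prems t] unfolding e[symmetric]
          by (simp only: bounded_bilinear.diff_right[OF mm_bilin] add_diff_eq)
        also have "mpos Z Z \<dots>"
          using Suc t by (intro mpos_add mpos_mult[where Y=Z] flow_pos PU_pos pos mpos_integral kern_pos) auto
        finally show ?thesis .
      qed
      then show "\<forall>\<^sub>F t in at_top. mpos Z Z (PU ** h r - PU ** (?U t ** X))"
        by (intro eventually_mono[OF eventually_ge_at_top[of "0::real"]]) simp
    qed auto
    have "h r = (mat 1 - PD - PU) ** h r + PD ** h r + PU ** h r" by (simp add: mm_simps)
    then have "h r - approx (Suc n) r ** X = (mat 1 - PD - PU) ** h r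
        + (mexp (r *\<^sub>R G) ** (PD ** (h 0 - X)) + PD ** ((LBINT s:{0..r}. kern s ** h (r - s)) - ?L ** X))
        + (PU ** h r - PU ** (?UI ** X))"
      using mexp_commute_with[OF PD_flow Suc.prems]
      by (simp add: down[OF Suc.prems] approx_Suc step_def mm_simps matrix_mul_assoc algebra_simps)
    also have "mpos Z Z \<dots>"
      using Suc.prems by (intro mpos_add mpos_mult[where Y=Z] rest_pos pos flow_pos init PD_pos 1 2)
    finally show ?case .
  qed
  show ?thesis
    by (rule mpos_lim[OF tendsto_diff[OF tendsto_const bounded_bilinear.tendsto[OF mm_bilin approx_tendsto[OF r] tendsto_const]]])
       (auto intro!: always_eventually approx r)
qed

lemma passage_rest: "0 \<le> r \<Longrightarrow> (mat 1 - PD - PU) ** passage r = 0"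
  by (simp add: passage_fixed[of r] step_def mm_simps matrix_mul_assoc proj)

text \<open>
  To exhaust the level \<open>r + s\<close> it suffices to exhaust \<open>r\<close>, and from there \<open>s\<close>. In terms of the equations
  this is minimality, applied to the shifted solution.
\<close>

lemma passage_super:
  assumes r: "0 \<le> r" and s: "0 \<le> s"
  shows "mpos Z Z (passage (r + s) - passage r ** (PD ** passage s))"
proof (rule passage_minimal[where h="\<lambda>r. passage (r + s)", OF _ _ _ r])
  show "mpos Z Z (passage (r + s))" if "0 \<le> r" for r
    using passage_good that s by (simp add: good_def)
  show "((\<lambda>r. passage (r + s)) has_vector_derivative (PD - PU) ** (G + R) ** passage (r + s)) (at r within {0..})" if r: "0 \<le> r" for r
  proof -
    have "(passage \<circ> (\<lambda>r. r + s) has_vector_derivative 1 *\<^sub>R ((PD - PU) ** (G + R) ** passage (r + s))) (at r within {0..})"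
    proof (rule vector_diff_chain_within)
      show "((\<lambda>r. r + s) has_vector_derivative 1) (at r within {0..})"
        by (auto intro!: derivative_eq_intros)
      show "(passage has_vector_derivative (PD - PU) ** (G + R) ** passage (r + s)) (at (r + s) within (\<lambda>r. r + s) ` {0..})"
        by (rule has_vector_derivative_within_subset[OF passage_ode]) (use r s in auto)
    qed
    then show ?thesis by (simp add: o_def)
  qed
  show "mpos Z Z (PD ** (passage (0 + s) - PD ** passage s))"
    by (simp add: mm_simps matrix_mul_assoc proj)
qed

end

section \<open>Orbit sets span their space\<close>

text \<open>
  Minimality of an orbit set speaks of subspaces of one exact dimension; a set of smaller dimension
  has to be enlarged.
\<close>

lemma affine_superset_of_dim:
  fixes S :: "'a::euclidean_space set"
  assumes "aff_dim S \<le> d" "d \<le> int DIM('a)"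
  shows "\<exists>V. affine V \<and> S \<subseteq> V \<and> aff_dim V = d"
  using assms(1)
proof (induction "nat (d - aff_dim S)" arbitrary: S)
  case 0
  then have "aff_dim S = d" by simp
  then show ?case by (intro exI[of _ "affine hull S"]) (auto simp: hull_subset)
next
  case (Suc n)
  then have lt: "aff_dim S < d" by simp
  have "affine hull S \<noteq> UNIV"
  proof
    assume "affine hull S = UNIV"
    then have "aff_dim S = int DIM('a)" using aff_dim_affine_hull[of S] by (metis aff_dim_UNIV)
    then show False using lt assms(2) by simp
  qed
  then obtain a where "a \<notin> affine hull S" by blast
  then have "aff_dim (insert a S) = aff_dim S + 1" by (simp add: aff_dim_insert)
  then have "\<exists>V. affine V \<and> insert a S \<subseteq> V \<and> aff_dim V = d" using Suc.hyps(2) lt by (intro Suc.hyps(1)) auto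
  then show ?case by blast
qed

text \<open>
  The points of block \<open>i\<close> lie in the affine hull of the unit vectors of this block. By minimality the
  two affine hulls have the same dimension, hence agree, and all unit vectors are in the span.
\<close>

lemma orbit_family_mass_base:
  fixes b :: "'n::finite \<Rightarrow> 'i::finite"
  assumes fam: "orbit_family b Z" and b: "surj b"
  shows "mass_base (\<Union>i. Z i)"
  unfolding mass_base_def
proof (intro conjI)
  show "bounded (\<Union>i. Z i)" using fam by (auto simp: orbit_family_def)
  show "\<forall>z\<in>\<Union>i. Z i. z \<bullet> 1 = 1" using fam by (auto simp: orbit_family_def)
  have "axis p 1 \<in> span (\<Union>i. Z i)" for p
  proof -
    define i where "i = b p"
    define H :: "(real^'n) set" where "H = (\<lambda>p. axis p 1) ` {p. b p = i}"
    have cardH: "card H = card {p. b p = i}"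
      unfolding H_def by (rule card_image) (auto simp: inj_on_def axis_eq_axis)
    have m: "0 < card {p. b p = i}" by (auto simp: card_gt_0_iff i_def)
    have sub: "Z i \<subseteq> affine hull H"
    proof
      fix x assume x: "x \<in> Z i"
      then have sup: "\<And>p. b p \<noteq> i \<Longrightarrow> x $ p = 0" and one: "x \<bullet> 1 = 1"
        using fam by (auto simp: orbit_family_def)
      have inj: "inj_on (\<lambda>p. axis p (1::real) :: real^'n) {p. b p = i}"
        by (auto simp: inj_on_def axis_eq_axis)
      have "(\<Sum>v\<in>H. (x \<bullet> v)) = (\<Sum>p | b p = i. x $ p)"
        unfolding H_def by (subst sum.reindex[OF inj]) (simp add: inner_axis)
      also have "\<dots> = (\<Sum>p\<in>UNIV. x $ p)" by (rule sum.mono_neutral_left) (auto simp: sup)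
      also have "\<dots> = 1" using one by (simp add: inner_vec_def)
      finally have s1: "(\<Sum>v\<in>H. (x \<bullet> v)) = 1" .
      have "(\<Sum>v\<in>H. (x \<bullet> v) *\<^sub>R v) = (\<Sum>p | b p = i. x $ p *\<^sub>R axis p 1)"
        unfolding H_def by (subst sum.reindex[OF inj]) (simp add: inner_axis)
      also have "\<dots> = (\<Sum>p\<in>UNIV. x $ p *\<^sub>R axis p 1)" by (rule sum.mono_neutral_left) (auto simp: sup)
      also have "\<dots> = x" using basis_expansion[of x] by (simp add: scalar_mult_eq_scaleR)
      finally have s2: "(\<Sum>v\<in>H. (x \<bullet> v) *\<^sub>R v) = x" .
      have "finite H" by (simp add: H_def)
      then show "x \<in> affine hull H" using s1 s2 by (auto simp: affine_hull_finite intro!: exI[of _ "\<lambda>v. x \<bullet> v"])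
    qed
    have dimH: "aff_dim (affine hull H) \<le> int (card {p. b p = i}) - 1"
      using aff_dim_le_card[of H] cardH by (simp add: H_def)
    have dimZ: "int (card {p. b p = i}) - 1 \<le> aff_dim (Z i)"
    proof (rule ccontr)
      assume "\<not> ?thesis"
      then have "aff_dim (Z i) \<le> int (card {p. b p = i}) - 2" by simp
      moreover have "int (card {p. b p = i}) - 2 \<le> int DIM(real^'n)"
        using card_mono[of UNIV "{p. b p = i}"] by simp
      ultimately obtain V where "affine V" "Z i \<subseteq> V" "aff_dim V = int (card {p. b p = i}) - 2"
        using affine_superset_of_dim[of "Z i"] by blast
      then show False using fam by (auto simp: orbit_family_def)
    qed
    have "affine hull (Z i) = affine hull H"
    proof (rule affine_dim_equal)
      show "affine hull Z i \<noteq> {}" using dimZ m by (auto simp: aff_dim_empty)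
      show "affine hull Z i \<subseteq> affine hull H" using sub by (simp add: hull_minimal)
      then have "aff_dim (affine hull Z i) \<le> aff_dim (affine hull H)" by (rule aff_dim_subset)
      then show "aff_dim (affine hull Z i) = aff_dim (affine hull H)" using dimH dimZ by simp
    qed auto
    then have "axis p 1 \<in> affine hull (Z i)" by (auto simp: H_def i_def intro: hull_inc)
    then have "axis p 1 \<in> span (Z i)" using affine_hull_subset_span by blast
    then show ?thesis using span_mono[of "Z i" "\<Union>i. Z i"] by blast
  qed
  then have "span (Basis :: (real^'n) set) \<subseteq> span (\<Union>i. Z i)"
    by (intro span_minimal subspace_span) (auto simp: Basis_vec_def)
  then show "span (\<Union>i. Z i) = UNIV" by (auto simp: span_Basis)
qed

section \<open>The positive and the negative space side by side\<close>

definition cat :: "real^'p::finite \<Rightarrow> real^'m::finite \<Rightarrow> real^('p + 'm)" where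
  "cat a b = (\<chi> k. case k of Inl p \<Rightarrow> a $ p | Inr q \<Rightarrow> b $ q)"

definition bmat :: "real^'p::finite^'p \<Rightarrow> real^'m::finite^'p \<Rightarrow> real^'p^'m \<Rightarrow> real^'m^'m \<Rightarrow> real^('p + 'm)^('p + 'm)" where
  "bmat A B C D = (\<chi> k l. case k of
      Inl p \<Rightarrow> (case l of Inl p' \<Rightarrow> A $ p $ p' | Inr q \<Rightarrow> B $ p $ q)
    | Inr q \<Rightarrow> (case l of Inl p' \<Rightarrow> C $ q $ p' | Inr q' \<Rightarrow> D $ q $ q'))"

lemma sum_UNIV_sum: "(\<Sum>k\<in>(UNIV::('p::finite + 'm::finite) set). f k) = (\<Sum>p\<in>UNIV. f (Inl p)) + (\<Sum>q\<in>UNIV. f (Inr q))"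
  by (simp add: sum.Plus UNIV_Plus_UNIV[symmetric] del: UNIV_Plus_UNIV)

lemma all_sum: "(\<forall>k::'a + 'b. P k) \<longleftrightarrow> (\<forall>p. P (Inl p)) \<and> (\<forall>q. P (Inr q))"
  by (metis sum.exhaust)

lemma cat_nth [simp]: "cat a b $ Inl p = a $ p" "cat a b $ Inr q = b $ q"
  by (simp_all add: cat_def)

lemma bmat_nth [simp]: "bmat A B C D $ Inl p $ Inl p' = A $ p $ p'" "bmat A B C D $ Inl p $ Inr q = B $ p $ q"
  "bmat A B C D $ Inr q $ Inl p = C $ q $ p" "bmat A B C D $ Inr q $ Inr q' = D $ q $ q'"
  by (simp_all add: bmat_def)

lemma cat_eq_iff: "cat a b = cat c d \<longleftrightarrow> a = c \<and> b = d"
  by (auto simp: vec_eq_iff all_sum)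

lemma cat_surj: "\<exists>a b. w = cat a b"
  by (intro exI[of _ "\<chi> p. w $ Inl p"] exI[of _ "\<chi> q. w $ Inr q"]) (simp add: vec_eq_iff all_sum)

lemma bmat_eq_iff: "bmat A B C D = bmat A' B' C' D' \<longleftrightarrow> A = A' \<and> B = B' \<and> C = C' \<and> D = D'"
  by (auto simp: vec_eq_iff all_sum)

lemma cat_simps: "cat a b + cat c d = cat (a + c) (b + d)" "cat a b - cat c d = cat (a - c) (b - d)"
  "r *\<^sub>R cat a b = cat (r *\<^sub>R a) (r *\<^sub>R b)" "- cat a b = cat (- a) (- b)"
  by (simp_all add: vec_eq_iff all_sum)

lemma cat_consts: "cat 0 0 = 0" "cat 1 1 = 1"
  by (simp_all add: vec_eq_iff all_sum)

lemma inner_cat: "cat a b \<bullet> cat c d = a \<bullet> c + b \<bullet> d"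
  by (simp add: inner_vec_def sum_UNIV_sum)

lemma inner_cat_one: "cat a b \<bullet> 1 = a \<bullet> 1 + b \<bullet> 1"
  unfolding cat_consts(2)[symmetric] inner_cat ..

lemma bmat_simps: "bmat A B C D + bmat A' B' C' D' = bmat (A + A') (B + B') (C + C') (D + D')"
  "bmat A B C D - bmat A' B' C' D' = bmat (A - A') (B - B') (C - C') (D - D')"
  "r *\<^sub>R bmat A B C D = bmat (r *\<^sub>R A) (r *\<^sub>R B) (r *\<^sub>R C) (r *\<^sub>R D)"
  "- bmat A B C D = bmat (- A) (- B) (- C) (- D)"
  by (simp_all add: vec_eq_iff all_sum)

lemma bmat_0: "bmat 0 0 0 0 = 0"
  by (simp_all add: vec_eq_iff all_sum)

lemma bmat_mat1: "bmat (mat 1) 0 0 (mat 1) = mat 1"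
  by (auto simp: vec_eq_iff all_sum mat_def)

lemma cat_bmat: "cat a b v* bmat A B C D = cat (a v* A + b v* C) (a v* B + b v* D)"
  by (simp add: vec_eq_iff all_sum vector_matrix_mult_def sum_UNIV_sum)

lemma bmat_cat: "bmat A B C D *v cat a b = cat (A *v a + B *v b) (C *v a + D *v b)"
  by (simp add: vec_eq_iff all_sum matrix_vector_mult_def sum_UNIV_sum)

lemma bmat_mult: "bmat A B C D ** bmat A' B' C' D' =
    bmat (A ** A' + B ** C') (A ** B' + B ** D') (C ** A' + D ** C') (C ** B' + D ** D')"
  by (simp add: vec_eq_iff all_sum matrix_matrix_mult_def sum_UNIV_sum)

lemma has_vector_derivative_bmat:
  assumes "(A has_vector_derivative A') (at t within S)" "(B has_vector_derivative B') (at t within S)"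
    "(C has_vector_derivative C') (at t within S)" "(D has_vector_derivative D') (at t within S)"
  shows "((\<lambda>t. bmat (A t) (B t) (C t) (D t)) has_vector_derivative bmat A' B' C' D') (at t within S)"
proof (rule has_vector_derivative_matrix)
  note d = assms[THEN bounded_linear.has_vector_derivative[OF bounded_linear_entry]]
  fix p q
  show "((\<lambda>t. bmat (A t) (B t) (C t) (D t) $ p $ q) has_vector_derivative bmat A' B' C' D' $ p $ q) (at t within S)"
    by (cases p; cases q) (simp_all add: d)
qed

lemma mexp_bmat:
  assumes "0 \<le> t"
  shows "mexp (t *\<^sub>R bmat A 0 0 D) = bmat (mexp (t *\<^sub>R A)) 0 0 (mexp (t *\<^sub>R D))"
proof -
  have "bmat (mexp (t *\<^sub>R A)) 0 0 (mexp (t *\<^sub>R D)) = mexp (t *\<^sub>R bmat A 0 0 D) ** bmat (mexp (0 *\<^sub>R A)) 0 0 (mexp (0 *\<^sub>R D))"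
    by (rule mexp_left_unique[of "\<lambda>t. bmat (mexp (t *\<^sub>R A)) 0 0 (mexp (t *\<^sub>R D))", OF _ assms])
       (auto intro!: has_vector_derivative_eq_rhs[OF has_vector_derivative_bmat[OF has_vector_derivative_mexp
           has_vector_derivative_const has_vector_derivative_const has_vector_derivative_mexp]]
         simp: bmat_mult mm_simps)
  then show ?thesis by (simp add: bmat_mat1)
qed

definition emb :: "('p::finite, 'm::finite) orbit \<Rightarrow> real^('p + 'm)" where
  "emb x = (case x of Inl a \<Rightarrow> cat a 0 | Inr b \<Rightarrow> cat 0 b)"

lemma emb_simps [simp]: "emb (Inl a) = cat a 0" "emb (Inr b) = cat 0 b"
  by (simp_all add: emb_def)

text \<open>A side is named by the value of \<open>isl\<close>: \<open>True\<close> is the positive one.\<close>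

definition side_proj :: "bool set \<Rightarrow> real^('p::finite + 'm::finite)^('p + 'm)" where
  "side_proj S = bmat (if True \<in> S then mat 1 else 0) 0 0 (if False \<in> S then mat 1 else 0)"

lemma emb_side_proj: "emb x v* side_proj S = (if isl x \<in> S then emb x else 0)"
  by (cases x) (auto simp: side_proj_def cat_bmat cat_consts vm_simps)

lemma mposI_scaled:
  assumes "\<And>z. z \<in> Z \<Longrightarrow> \<exists>c y. 0 \<le> c \<and> (y \<in> Y \<or> y = 0) \<and> z v* M = c *\<^sub>R y"
  shows "mpos Z Y M"
  unfolding mpos_def dual_def
proof safe
  fix w z assume w: "\<forall>z\<in>Y. 0 \<le> z \<bullet> w" and "z \<in> Z"
  then obtain c y where "0 \<le> c" "y \<in> Y \<or> y = 0" "z v* M = c *\<^sub>R y" using assms by blast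
  moreover have "z \<bullet> (M *v w) = (z v* M) \<bullet> w" by (simp add: dot_lmul_matrix)
  ultimately show "0 \<le> z \<bullet> (M *v w)" using w by auto
qed

section \<open>The orbit process as an abstract flow with jumps\<close>

definition orbs :: "('p::finite, 'm::finite, 'i::finite, 'j::finite) rap \<Rightarrow> ('p, 'm) orbit set" where
  "orbs \<R> = orbits_p \<R> \<union> orbits_m \<R>"

definition flow_gen :: "('p::finite, 'm::finite, 'i::finite, 'j::finite) rap \<Rightarrow> real^('p + 'm)^('p + 'm)" where
  "flow_gen \<R> = bmat (block_diag (blk_p \<R>) (C_p \<R>)) 0 0 (block_diag (blk_m \<R>) (C_m \<R>))"

definition full_gen :: "('p::finite, 'm::finite, 'i::finite, 'j::finite) rap \<Rightarrow> real^('p + 'm)^('p + 'm)" where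
  "full_gen \<R> = bmat (C_p \<R>) (D_pm \<R>) (D_mp \<R>) (C_m \<R>)"

text \<open>
  The kind \<open>l\<close> of a jump is its pair of blocks. Pairs of equal blocks get 0, because the diagonal
  blocks of \<open>full_gen\<close> belong to the flow.
\<close>

fun jump_mat :: "('p::finite, 'm::finite, 'i::finite, 'j::finite) rap \<Rightarrow> ('i + 'j) \<times> ('i + 'j) \<Rightarrow> real^('p + 'm)^('p + 'm)" where
  "jump_mat \<R> (Inl i, Inl j) = (if i = j then 0 else bmat (block_at (blk_p \<R>) (blk_p \<R>) (C_p \<R>) i j) 0 0 0)"
| "jump_mat \<R> (Inl i, Inr j) = bmat 0 (block_at (blk_p \<R>) (blk_m \<R>) (D_pm \<R>) i j) 0 0"
| "jump_mat \<R> (Inr i, Inl j) = bmat 0 0 (block_at (blk_m \<R>) (blk_p \<R>) (D_mp \<R>) i j) 0"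
| "jump_mat \<R> (Inr i, Inr j) = (if i = j then 0 else bmat 0 0 0 (block_at (blk_m \<R>) (blk_m \<R>) (C_m \<R>) i j))"

lemma kind_cases [case_names pp pm mp mm]:
  obtains i j where "l = (Inl i, Inl j)" | i j where "l = (Inl i, Inr j)"
    | i j where "l = (Inr i, Inl j)" | i j where "l = (Inr i, Inr j)"
  by (metis surj_pair sum.exhaust)

text \<open>Each entry lies in exactly one pair of blocks.\<close>

lemma sum_jump_mat: "(\<Sum>l\<in>UNIV. jump_mat \<R> l) = full_gen \<R> - flow_gen \<R>"
proof -
  have "(\<Sum>l\<in>UNIV. jump_mat \<R> l) $ k $ k' = (full_gen \<R> - flow_gen \<R>) $ k $ k'" for k k'
  proof -
    define bb where "bb = (\<lambda>k. case k of Inl p \<Rightarrow> Inl (blk_p \<R> p) | Inr q \<Rightarrow> Inr (blk_m \<R> q))"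
    have "jump_mat \<R> l $ k $ k' = (if l = (bb k, bb k') then (full_gen \<R> - flow_gen \<R>) $ k $ k' else 0)" for l
      by (cases l rule: kind_cases; cases k; cases k')
         (auto simp: bb_def full_gen_def flow_gen_def bmat_simps block_at_def block_diag_def)
    then show ?thesis by simp
  qed
  then show ?thesis by (simp add: vec_eq_iff)
qed

lemma normalise_one: "x \<bullet> 1 = 1 \<Longrightarrow> normalise x = x"
  by (simp add: normalise_def)

lemma normalise_idem: "normalise (normalise x) = normalise x"
  by (cases "x \<bullet> 1 = 0") (auto simp: normalise_def)

lemma normalise_cat: "normalise (cat a 0) = cat (normalise a) 0" "normalise (cat 0 b) = cat 0 (normalise b)"
  by (simp_all add: normalise_def inner_cat_one cat_simps)

context
  fixes \<R> :: "('p::finite, 'm::finite, 'i::finite, 'j::finite) rap"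
  assumes rap: "rap_data \<R>"
begin

lemma mass_base_p: "mass_base (\<Union>i. Zset_p \<R> i)" and mass_base_m: "mass_base (\<Union>i. Zset_m \<R> i)"
  using rap by (auto simp: rap_data_def intro!: orbit_family_mass_base)

lemma emb_orbs: "emb ` orbs \<R> = (\<lambda>a. cat a 0) ` (\<Union>i. Zset_p \<R> i) \<union> (\<lambda>b. cat 0 b) ` (\<Union>i. Zset_m \<R> i)"
  by (auto simp: orbs_def orbits_p_def orbits_m_def image_Un image_image)

lemma linear_cat1: "linear (\<lambda>a::real^'p. cat a (0::real^'m))" and linear_cat2: "linear (\<lambda>b::real^'m. cat (0::real^'p) b)"
  by (auto intro!: linearI simp: cat_simps)

lemma emb_mass: "x \<in> orbs \<R> \<Longrightarrow> emb x \<bullet> 1 = 1"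
  using mass_base_p mass_base_m by (auto simp: orbs_def orbits_p_def orbits_m_def inner_cat_one mass_base_def)

lemma mass_base_orbs: "mass_base (emb ` orbs \<R>)"
  unfolding mass_base_def
proof (intro conjI)
  show "bounded (emb ` orbs \<R>)"
    unfolding emb_orbs using mass_base_p mass_base_m
    by (auto simp: mass_base_def intro!: bounded_linear_image linear_conv_bounded_linear[THEN iffD1, OF linear_cat1] linear_conv_bounded_linear[THEN iffD1, OF linear_cat2])
  show "\<forall>z\<in>emb ` orbs \<R>. z \<bullet> 1 = 1" by (auto simp: emb_mass)
  have "cat a b \<in> span (emb ` orbs \<R>)" for a b
  proof -
    have "a \<in> span (\<Union>i. Zset_p \<R> i)" "b \<in> span (\<Union>i. Zset_m \<R> i)"
      using mass_base_p mass_base_m by (auto simp: mass_base_def)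
    then have "cat a (0::real^'m) \<in> span ((\<lambda>a. cat a 0) ` (\<Union>i. Zset_p \<R> i))" "cat (0::real^'p) b \<in> span ((\<lambda>b. cat 0 b) ` (\<Union>i. Zset_m \<R> i))"
      by (simp_all add: linear_span_image[OF linear_cat1] linear_span_image[OF linear_cat2])
    then have "cat a (0::real^'m) \<in> span (emb ` orbs \<R>)" "cat (0::real^'p) b \<in> span (emb ` orbs \<R>)"
      unfolding emb_orbs by (meson span_mono Un_upper1 Un_upper2 subsetD)+
    then have "cat a (0::real^'m) + cat (0::real^'p) b \<in> span (emb ` orbs \<R>)" by (rule span_add)
    then show ?thesis by (simp add: cat_simps)
  qed
  then show "span (emb ` orbs \<R>) = UNIV" using cat_surj by (metis UNIV_eq_I)
qed

lemma flow_orbs: "x \<in> orbs \<R> \<Longrightarrow> 0 \<le> r \<Longrightarrow> orbit_flow \<R> r x \<in> orbs \<R>"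
  using rap by (auto simp: rap_data_def orbs_def)

lemma emb_flow: "0 \<le> r \<Longrightarrow> emb (orbit_flow \<R> r x) = normalise (emb x v* mexp (r *\<^sub>R flow_gen \<R>))"
  by (cases x) (simp_all add: flow_gen_def mexp_bmat cat_bmat normalise_cat vm_simps)

lemma isl_flow [simp]: "isl (orbit_flow \<R> r x) = isl x"
  by (cases x) auto

lemma inj_emb_orbs: "x \<in> orbs \<R> \<Longrightarrow> y \<in> orbs \<R> \<Longrightarrow> emb x = emb y \<Longrightarrow> x = y"
  using emb_mass[of x] emb_mass[of y] by (cases x; cases y) (auto simp: cat_eq_iff cat_consts)

lemma orbs_sides: "x \<in> orbs \<R> \<Longrightarrow> isl x \<longleftrightarrow> x \<in> orbits_p \<R>" "x \<in> orbs \<R> \<Longrightarrow> \<not> isl x \<longleftrightarrow> x \<in> orbits_m \<R>"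
  by (auto simp: orbs_def orbits_p_def orbits_m_def)

lemma flow_0: "x \<in> orbs \<R> \<Longrightarrow> orbit_flow \<R> 0 x = x"
  by (rule inj_emb_orbs) (auto simp: flow_orbs emb_flow emb_mass normalise_one)

text \<open>
  The mass is 1 at time 0 and depends continuously on time. Where it vanished, the normalised flow
  would be 0 and so would have left the orbits.
\<close>

lemma flow_mass_pos:
  assumes x: "x \<in> orbs \<R>" and r: "0 \<le> r"
  shows "0 < (emb x v* mexp (r *\<^sub>R flow_gen \<R>)) \<bullet> 1"
proof (rule ccontr)
  let ?f = "\<lambda>r. (emb x v* mexp (r *\<^sub>R flow_gen \<R>)) \<bullet> 1"
  assume "\<not> 0 < ?f r"
  moreover have "?f 0 = 1" using x by (simp add: emb_mass)
  moreover have "continuous_on {0..r} ?f"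
    by (intro continuous_intros bounded_bilinear.continuous_on[OF vm_bilin])
  ultimately obtain s where s: "0 \<le> s" "s \<le> r" "?f s = 0"
    using IVT2'[of ?f r 0 0] r by auto
  have "emb (orbit_flow \<R> s x) \<bullet> 1 = 1" using flow_orbs[OF x s(1)] by (rule emb_mass)
  then show False using s by (simp add: emb_flow normalise_def)
qed

lemma flow_unnormalise:
  assumes "x \<in> orbs \<R>" "0 \<le> r"
  shows "emb x v* mexp (r *\<^sub>R flow_gen \<R>) = ((emb x v* mexp (r *\<^sub>R flow_gen \<R>)) \<bullet> 1) *\<^sub>R emb (orbit_flow \<R> r x)"
  using flow_mass_pos[OF assms] by (simp add: emb_flow[OF assms(2)] normalise_def)

lemma block_at_p_zero: "a \<in> Zset_p \<R> i0 \<Longrightarrow> i \<noteq> i0 \<Longrightarrow> a v* block_at (blk_p \<R>) c M i j = 0"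
proof -
  assume "a \<in> Zset_p \<R> i0" "i \<noteq> i0"
  then have "blk_p \<R> p = i \<Longrightarrow> a $ p = 0" for p using rap by (auto simp: rap_data_def orbit_family_def)
  then show ?thesis by (auto simp: vec_eq_iff vector_matrix_mult_def block_at_def intro!: sum.neutral)
qed

lemma block_at_m_zero: "a \<in> Zset_m \<R> i0 \<Longrightarrow> i \<noteq> i0 \<Longrightarrow> a v* block_at (blk_m \<R>) c M i j = 0"
proof -
  assume "a \<in> Zset_m \<R> i0" "i \<noteq> i0"
  then have "blk_m \<R> p = i \<Longrightarrow> a $ p = 0" for p using rap by (auto simp: rap_data_def orbit_family_def)
  then show ?thesis by (auto simp: vec_eq_iff vector_matrix_mult_def block_at_def intro!: sum.neutral)
qed

text \<open>
  If \<open>l\<close> does not start in the block of \<open>x\<close>, the product is 0 and hence a multiple of any orbit.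
\<close>

lemma jump_point:
  assumes x: "x \<in> orbs \<R>"
  shows "0 \<le> (emb x v* jump_mat \<R> l) \<bullet> 1"
    and "\<exists>y. y \<in> orbs \<R> \<and> emb x v* jump_mat \<R> l = ((emb x v* jump_mat \<R> l) \<bullet> 1) *\<^sub>R emb y"
proof -
  let ?v = "emb x v* jump_mat \<R> l"
  have zero: "0 \<le> ?v \<bullet> 1 \<and> (\<exists>y. y \<in> orbs \<R> \<and> ?v = (?v \<bullet> 1) *\<^sub>R emb y)" if "?v = 0"
    using that x by auto
  have p: "0 \<le> v \<bullet> 1 \<and> (\<exists>y. y \<in> orbs \<R> \<and> v = (v \<bullet> 1) *\<^sub>R emb y)"
    if pt: "points_into w (Zset_p \<R> j)" and v: "v = cat w (0::real^'m)" for v w j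
  proof -
    obtain z where z: "0 \<le> w \<bullet> 1" "z \<in> Zset_p \<R> j" "w = (w \<bullet> 1) *\<^sub>R z" using pt unfolding points_into_def by blast
    have "Inl z \<in> orbs \<R>" using z(2) by (auto simp: orbs_def orbits_p_def)
    moreover have "v = (v \<bullet> 1) *\<^sub>R emb (Inl z :: ('p, 'm) orbit)" using z(3) by (simp add: v inner_cat_one cat_simps cat_eq_iff)
    moreover have "v \<bullet> 1 = w \<bullet> 1" by (simp add: v inner_cat_one)
    ultimately show ?thesis using z(1) by metis
  qed
  have m: "0 \<le> v \<bullet> 1 \<and> (\<exists>y. y \<in> orbs \<R> \<and> v = (v \<bullet> 1) *\<^sub>R emb y)"
    if pt: "points_into w (Zset_m \<R> j)" and v: "v = cat (0::real^'p) w" for v w j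
  proof -
    obtain z where z: "0 \<le> w \<bullet> 1" "z \<in> Zset_m \<R> j" "w = (w \<bullet> 1) *\<^sub>R z" using pt unfolding points_into_def by blast
    have "Inr z \<in> orbs \<R>" using z(2) by (auto simp: orbs_def orbits_m_def)
    moreover have "v = (v \<bullet> 1) *\<^sub>R emb (Inr z :: ('p, 'm) orbit)" using z(3) by (simp add: v inner_cat_one cat_simps cat_eq_iff)
    moreover have "v \<bullet> 1 = w \<bullet> 1" by (simp add: v inner_cat_one)
    ultimately show ?thesis using z(1) by metis
  qed
  have "0 \<le> ?v \<bullet> 1 \<and> (\<exists>y. y \<in> orbs \<R> \<and> ?v = (?v \<bullet> 1) *\<^sub>R emb y)"
  proof (cases x)
    case (Inl a)
    then obtain i0 where a: "a \<in> Zset_p \<R> i0" using x by (auto simp: orbs_def orbits_p_def orbits_m_def)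
    show ?thesis
    proof (cases l rule: kind_cases)
      case (pp i j)
      then show ?thesis
      proof (cases "i = i0 \<and> i \<noteq> j")
        case True
        then have "points_into (a v* block_at (blk_p \<R>) (blk_p \<R>) (C_p \<R>) i j) (Zset_p \<R> j)"
          using rap a by (auto simp: rap_data_def)
        then show ?thesis by (rule p) (use pp Inl True in \<open>auto simp: cat_bmat vm_simps\<close>)
      next
        case False
        then show ?thesis using pp Inl by (intro zero) (auto simp: block_at_p_zero[OF a] cat_bmat vm_simps cat_consts)
      qed
    next
      case (pm i j)
      then show ?thesis
      proof (cases "i = i0")
        case True
        then have "points_into (a v* block_at (blk_p \<R>) (blk_m \<R>) (D_pm \<R>) i j) (Zset_m \<R> j)"
          using rap a by (auto simp: rap_data_def)
        then show ?thesis by (rule m) (use pm Inl True in \<open>simp add: cat_bmat vm_simps\<close>)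
      next
        case False
        then show ?thesis using pm Inl by (intro zero) (auto simp: block_at_p_zero[OF a] cat_bmat vm_simps cat_consts)
      qed
    qed (rule zero, simp add: Inl cat_bmat vm_simps cat_consts)+
  next
    case (Inr a)
    then obtain i0 where a: "a \<in> Zset_m \<R> i0" using x by (auto simp: orbs_def orbits_p_def orbits_m_def)
    show ?thesis
    proof (cases l rule: kind_cases)
      case (mp i j)
      then show ?thesis
      proof (cases "i = i0")
        case True
        then have "points_into (a v* block_at (blk_m \<R>) (blk_p \<R>) (D_mp \<R>) i j) (Zset_p \<R> j)"
          using rap a by (auto simp: rap_data_def)
        then show ?thesis by (rule p) (use mp Inr True in \<open>simp add: cat_bmat vm_simps\<close>)
      next
        case False
        then show ?thesis using mp Inr by (intro zero) (auto simp: block_at_m_zero[OF a] cat_bmat vm_simps cat_consts)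
      qed
    next
      case (mm i j)
      then show ?thesis
      proof (cases "i = i0 \<and> i \<noteq> j")
        case True
        then have "points_into (a v* block_at (blk_m \<R>) (blk_m \<R>) (C_m \<R>) i j) (Zset_m \<R> j)"
          using rap a by (auto simp: rap_data_def)
        then show ?thesis by (rule m) (use mm Inr True in \<open>auto simp: cat_bmat vm_simps\<close>)
      next
        case False
        then show ?thesis using mm Inr by (intro zero) (auto simp: block_at_m_zero[OF a] cat_bmat vm_simps cat_consts)
      qed
    qed (rule zero, simp add: Inr cat_bmat vm_simps cat_consts)+
  qed
  then show "0 \<le> ?v \<bullet> 1" "\<exists>y. y \<in> orbs \<R> \<and> ?v = (?v \<bullet> 1) *\<^sub>R emb y" by blast+
qed

lemma orbit_rate_eq:
  assumes x: "x \<in> orbs \<R>"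
  shows "orbit_rate \<R> l x = (emb x v* jump_mat \<R> l) \<bullet> 1"
proof (cases x)
  case (Inl a)
  then obtain i0 where a: "a \<in> Zset_p \<R> i0" using x by (auto simp: orbs_def orbits_p_def orbits_m_def)
  show ?thesis
  proof (cases l rule: kind_cases)
    case (pp i j)
    then show ?thesis using Inl a
      by (cases "i = i0") (auto simp: block_at_p_zero[OF a] cat_bmat vm_simps inner_cat_one)
  next
    case (pm i j)
    then show ?thesis using Inl a
      by (cases "i = i0") (auto simp: block_at_p_zero[OF a] cat_bmat vm_simps inner_cat_one)
  next
    case (mp i j)
    then show ?thesis using Inl by (auto simp: cat_bmat vm_simps inner_cat_one)
  next
    case (mm i j)
    then show ?thesis using Inl by (auto simp: cat_bmat vm_simps inner_cat_one)
  qed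
next
  case (Inr a)
  then obtain i0 where a: "a \<in> Zset_m \<R> i0" using x by (auto simp: orbs_def orbits_p_def orbits_m_def)
  show ?thesis
  proof (cases l rule: kind_cases)
    case (pp i j)
    then show ?thesis using Inr by (auto simp: cat_bmat vm_simps inner_cat_one)
  next
    case (pm i j)
    then show ?thesis using Inr by (auto simp: cat_bmat vm_simps inner_cat_one)
  next
    case (mp i j)
    then show ?thesis using Inr a
      by (cases "i = i0") (auto simp: block_at_m_zero[OF a] cat_bmat vm_simps inner_cat_one)
  next
    case (mm i j)
    then show ?thesis using Inr a
      by (cases "i = i0") (auto simp: block_at_m_zero[OF a] cat_bmat vm_simps inner_cat_one)
  qed
qed

lemma emb_jump:
  assumes "(emb x v* jump_mat \<R> l) \<noteq> 0"
  shows "emb (orbit_jump \<R> l x) = normalise (emb x v* jump_mat \<R> l)"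
  using assms
  by (cases l rule: kind_cases; cases x)
     (auto simp: cat_bmat vm_simps normalise_cat cat_consts split: if_splits)

text \<open>The right-hand side is independent of the value of \<open>orbit_jump\<close> when the rate is 0.\<close>

lemma jump_scaled:
  assumes x: "x \<in> orbs \<R>"
  shows "emb x v* jump_mat \<R> l = orbit_rate \<R> l x *\<^sub>R emb (orbit_jump \<R> l x)"
proof (cases "emb x v* jump_mat \<R> l = 0")
  case True
  then show ?thesis by (simp add: orbit_rate_eq[OF x])
next
  case False
  obtain y where y: "y \<in> orbs \<R>" "emb x v* jump_mat \<R> l = ((emb x v* jump_mat \<R> l) \<bullet> 1) *\<^sub>R emb y"
    using jump_point(2)[OF x] by blast
  then have "(emb x v* jump_mat \<R> l) \<bullet> 1 \<noteq> 0" using False by auto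
  then show ?thesis by (simp add: emb_jump[OF False] orbit_rate_eq[OF x] normalise_def)
qed

lemma flow_pos: assumes "0 \<le> t" shows "mpos (emb ` orbs \<R>) (emb ` orbs \<R>) (mexp (t *\<^sub>R flow_gen \<R>))"
proof (rule mposI_scaled, safe)
  fix x assume x: "x \<in> orbs \<R>"
  let ?v = "emb x v* mexp (t *\<^sub>R flow_gen \<R>)"
  show "\<exists>c y. 0 \<le> c \<and> (y \<in> emb ` orbs \<R> \<or> y = 0) \<and> ?v = c *\<^sub>R y"
    using flow_mass_pos[OF x assms] flow_unnormalise[OF x assms] flow_orbs[OF x assms]
    by (intro exI[of _ "?v \<bullet> 1"] exI[of _ "emb (orbit_flow \<R> t x)"]) auto
qed

lemma jump_mat_pos: "mpos (emb ` orbs \<R>) (emb ` orbs \<R>) (jump_mat \<R> l)"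
proof (rule mposI_scaled, safe)
  fix x assume x: "x \<in> orbs \<R>"
  show "\<exists>c y. 0 \<le> c \<and> (y \<in> emb ` orbs \<R> \<or> y = 0) \<and> emb x v* jump_mat \<R> l = c *\<^sub>R y"
    using jump_point[OF x, of l] by blast
qed

lemma mpos_sum: "(\<And>i. i \<in> I \<Longrightarrow> mpos X Y (f i)) \<Longrightarrow> mpos X Y (sum f I)"
  by (induction I rule: infinite_finite_induct) (auto intro: mpos_add)

lemma side_proj_pos: "mpos (emb ` orbs \<R>) (emb ` orbs \<R>) (side_proj S)"
proof (rule mposI_scaled, safe)
  fix x assume "x \<in> orbs \<R>"
  then show "\<exists>c y. 0 \<le> c \<and> (y \<in> emb ` orbs \<R> \<or> y = 0) \<and> emb x v* side_proj S = c *\<^sub>R y"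
    by (intro exI[of _ 1] exI[of _ "if isl x \<in> S then emb x else 0"]) (auto simp: emb_side_proj)
qed

lemma side_proj_diff: "A \<inter> B = {} \<Longrightarrow> mat 1 - side_proj A - side_proj B = side_proj (- (A \<union> B))"
  by (auto simp: side_proj_def bmat_simps bmat_mat1[symmetric] bmat_eq_iff)

lemma full_gen_one: "full_gen \<R> *v 1 = 0"
  using rap by (simp add: full_gen_def cat_consts(2)[symmetric] bmat_cat rap_data_def add.commute)
    (simp add: cat_consts)

lemma jump_kernel_orbs:
  assumes "A \<inter> B = {}"
  shows "jump_kernel (emb ` orbs \<R>) (flow_gen \<R>) (full_gen \<R> - flow_gen \<R>) (side_proj A) (side_proj B)"
proof
  show "mpos (emb ` orbs \<R>) (emb ` orbs \<R>) (full_gen \<R> - flow_gen \<R>)"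
    unfolding sum_jump_mat[symmetric] by (intro mpos_sum jump_mat_pos)
  show "mpos (emb ` orbs \<R>) (emb ` orbs \<R>) (mat 1 - side_proj A - side_proj B)"
    by (simp add: side_proj_diff[OF assms] side_proj_pos)
  show "- ((flow_gen \<R> + (full_gen \<R> - flow_gen \<R>)) *v 1) \<in> dual (emb ` orbs \<R>)"
    by (simp add: full_gen_one)
  show "mass_base (emb ` orbs \<R>)" by (rule mass_base_orbs)
  show "mpos (emb ` orbs \<R>) (emb ` orbs \<R>) (mexp (t *\<^sub>R flow_gen \<R>))" if "0 \<le> t" for t
    using that by (rule flow_pos)
  show "mpos (emb ` orbs \<R>) (emb ` orbs \<R>) (side_proj A)" "mpos (emb ` orbs \<R>) (emb ` orbs \<R>) (side_proj B)"
    by (rule side_proj_pos)+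
qed (use assms in \<open>auto simp: side_proj_def flow_gen_def bmat_mult mm_simps bmat_0\<close>)

end

section \<open>The law of the next jump\<close>

lemma nonneg_set_nn_integral:
  fixes f :: "real \<Rightarrow> real"
  assumes "set_integrable lborel S f" "\<And>s. s \<in> S \<Longrightarrow> 0 \<le> f s"
  shows "(\<integral>\<^sup>+s. indicator S s * ennreal (f s) \<partial>lborel) = ennreal (LBINT s:S. f s)"
proof -
  have "(\<integral>\<^sup>+s. indicator S s * ennreal (f s) \<partial>lborel) = (\<integral>\<^sup>+s. ennreal (indicator S s *\<^sub>R f s) \<partial>lborel)"
    by (intro nn_integral_cong) (auto simp: indicator_def)
  also have "\<dots> = ennreal (LBINT s:S. f s)"
    unfolding set_lebesgue_integral_def
    by (rule nn_integral_eq_integral) (use assms in \<open>auto simp: set_integrable_def indicator_def\<close>)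
  finally show ?thesis .
qed

context
  fixes \<R> :: "('p::finite, 'm::finite, 'i::finite, 'j::finite) rap"
  assumes rap: "rap_data \<R>"
begin

abbreviation "E s \<equiv> mexp (s *\<^sub>R flow_gen \<R>)"

text \<open>The joint density of holding time \<open>s\<close> and kind \<open>l\<close> of the next jump from the row \<open>v\<close>.\<close>

definition jump_density :: "('i + 'j) \<times> ('i + 'j) \<Rightarrow> real \<Rightarrow> real^('p + 'm) \<Rightarrow> real" where
  "jump_density l s v = (v v* E s v* jump_mat \<R> l) \<bullet> 1"

lemma jump_density_rate:
  assumes x: "x \<in> orbs \<R>" and s: "0 \<le> s"
  shows "jump_density l s (emb x) = ((emb x v* E s) \<bullet> 1) * orbit_rate \<R> l (orbit_flow \<R> s x)"
proof -
  let ?c = "(emb x v* E s) \<bullet> 1"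
  have "emb x v* E s v* jump_mat \<R> l = (?c *\<^sub>R emb (orbit_flow \<R> s x)) v* jump_mat \<R> l"
    using flow_unnormalise[OF rap x s] by (rule arg_cong)
  also have "\<dots> = ?c *\<^sub>R (emb (orbit_flow \<R> s x) v* jump_mat \<R> l)"
    by (simp only: vm_simps)
  finally show ?thesis
    by (simp add: jump_density_def orbit_rate_eq[OF rap flow_orbs[OF rap x s]])
qed

lemma jump_density_nonneg: "x \<in> orbs \<R> \<Longrightarrow> 0 \<le> s \<Longrightarrow> 0 \<le> jump_density l s (emb x)"
  using jump_point(1)[OF rap flow_orbs[OF rap]] flow_mass_pos[OF rap, of x s]
  by (simp add: jump_density_rate orbit_rate_eq[OF rap flow_orbs[OF rap]])

text \<open>Weighted with the density, the post-jump orbit depends linearly on the orbit before.\<close>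

lemma jump_density_scaled:
  assumes x: "x \<in> orbs \<R>" and s: "0 \<le> s"
  shows "jump_density l s (emb x) *\<^sub>R emb (orbit_jump \<R> l (orbit_flow \<R> s x)) = emb x v* E s v* jump_mat \<R> l"
proof -
  let ?c = "(emb x v* E s) \<bullet> 1"
  have "emb x v* E s v* jump_mat \<R> l = (?c *\<^sub>R emb (orbit_flow \<R> s x)) v* jump_mat \<R> l"
    using flow_unnormalise[OF rap x s] by (rule arg_cong)
  also have "\<dots> = ?c *\<^sub>R (emb (orbit_flow \<R> s x) v* jump_mat \<R> l)"
    by (simp only: vm_simps)
  also have "\<dots> = ?c *\<^sub>R orbit_rate \<R> l (orbit_flow \<R> s x) *\<^sub>R emb (orbit_jump \<R> l (orbit_flow \<R> s x))"
    by (simp only: jump_scaled[OF rap flow_orbs[OF rap x s]])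
  finally show ?thesis by (simp add: jump_density_rate[OF x s])
qed

lemma sum_jump_density:
  "(\<Sum>l\<in>UNIV. jump_density l s v) = - ((v v* E s v* flow_gen \<R>) \<bullet> 1)"
proof -
  have "(\<Sum>l\<in>UNIV. jump_density l s v) = (v v* E s v* (\<Sum>l\<in>UNIV. jump_mat \<R> l)) \<bullet> 1"
    by (simp add: jump_density_def bounded_bilinear.sum_right[OF vm_bilin] inner_sum_left)
  also have "\<dots> = (v v* E s v* full_gen \<R>) \<bullet> 1 - (v v* E s v* flow_gen \<R>) \<bullet> 1"
    by (simp add: sum_jump_mat vm_simps inner_diff_left)
  also have "(v v* E s v* full_gen \<R>) \<bullet> 1 = 0"
    by (simp add: dot_lmul_matrix full_gen_one[OF rap])
  finally show ?thesis by simp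
qed

lemma mass_derivative:
  "((\<lambda>s. (v v* E s) \<bullet> 1) has_real_derivative - (\<Sum>l\<in>UNIV. jump_density l s v)) (at s within T)"
proof -
  have "bounded_linear (\<lambda>X. (v v* X) \<bullet> 1)"
    by (intro bounded_linear_compose[OF bounded_linear_inner_left] bounded_bilinear.bounded_linear_right[OF vm_bilin])
  from bounded_linear.has_vector_derivative[OF this has_vector_derivative_mexp'[of "flow_gen \<R>" s T]]
  show ?thesis
    by (simp add: has_real_derivative_iff_has_vector_derivative sum_jump_density vector_matrix_mul_assoc)
qed

lemma jump_density_continuous [continuous_intros]:
  "continuous_on T f \<Longrightarrow> continuous_on T g \<Longrightarrow> continuous_on T (\<lambda>x. jump_density l (f x) (g x))"
  unfolding jump_density_def
  by (intro continuous_intros bounded_bilinear.continuous_on[OF vm_bilin])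

lemma integral_sum_jump_density:
  assumes r: "0 \<le> r"
  shows "(LBINT s:{0..r}. (\<Sum>l\<in>UNIV. jump_density l s v)) = v \<bullet> 1 - (v v* E r) \<bullet> 1"
proof -
  have "(LBINT s:{0..r}. (\<Sum>l\<in>UNIV. jump_density l s v)) = - ((v v* E r) \<bullet> 1) - - ((v v* E 0) \<bullet> 1)"
  proof (rule set_integral_FTC[OF r])
    fix s
    show "((\<lambda>s. - ((v v* E s) \<bullet> 1)) has_vector_derivative (\<Sum>l\<in>UNIV. jump_density l s v)) (at s within {0..r})"
      using DERIV_minus[OF mass_derivative[of v s "{0..r}"]]
      by (simp add: has_real_derivative_iff_has_vector_derivative)
  qed (intro continuous_intros)
  then show ?thesis by simp
qed

text \<open>
  The survival factor of the holding time is the total mass of the unnormalised flow, because the total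
  rate is minus its logarithmic derivative.
\<close>

lemma survival_mass:
  assumes x: "x \<in> orbs \<R>" and s: "0 \<le> s"
  shows "exp (- (LBINT v:{0..s}. \<Sum>k\<in>UNIV. orbit_rate \<R> k (orbit_flow \<R> v x))) = (emb x v* E s) \<bullet> 1"
proof -
  let ?m = "\<lambda>v. (emb x v* E v) \<bullet> 1" and ?d = "\<lambda>v. \<Sum>l\<in>UNIV. jump_density l v (emb x)"
  have pos: "0 < ?m v" if "0 \<le> v" for v using flow_mass_pos[OF rap x that] .
  have "(LBINT v:{0..s}. \<Sum>k\<in>UNIV. orbit_rate \<R> k (orbit_flow \<R> v x)) = (LBINT v:{0..s}. ?d v / ?m v)"
  proof (rule set_lebesgue_integral_cong)
    have "(\<Sum>k\<in>UNIV. orbit_rate \<R> k (orbit_flow \<R> v x)) = ?d v / ?m v" if "0 \<le> v" for v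
      using pos[OF that] by (simp add: jump_density_rate[OF x that] sum_distrib_left[symmetric])
    then show "\<forall>v. v \<in> {0..s} \<longrightarrow> (\<Sum>k\<in>UNIV. orbit_rate \<R> k (orbit_flow \<R> v x)) = ?d v / ?m v" by simp
  qed simp
  also have "\<dots> = - ln (?m s) - - ln (?m 0)"
  proof (rule set_integral_FTC[OF s])
    fix v assume v: "0 \<le> v" "v \<le> s"
    show "((\<lambda>v. - ln (?m v)) has_vector_derivative ?d v / ?m v) (at v within {0..s})"
      using DERIV_minus[OF DERIV_chain2[where f=ln and g="?m", OF DERIV_ln_divide[OF pos[OF v(1)]] mass_derivative[of "emb x" v "{0..s}"]]]
      by (simp add: has_real_derivative_iff_has_vector_derivative)
  next
    show "continuous_on {0..s} (\<lambda>v. ?d v / ?m v)"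
      by (intro continuous_intros bounded_bilinear.continuous_on[OF vm_bilin]) (use pos in fastforce)
  qed
  finally show ?thesis using pos[OF s] emb_mass[OF rap x] by simp
qed

lemma jump_law:
  assumes x: "x \<in> orbs \<R>"
  shows "(LBINT s:{0..u}. orbit_rate \<R> l (orbit_flow \<R> s x) *
      exp (- (LBINT v:{0..s}. \<Sum>k\<in>UNIV. orbit_rate \<R> k (orbit_flow \<R> v x))))
    = (LBINT s:{0..u}. jump_density l s (emb x))"
proof (rule set_lebesgue_integral_cong)
  show "\<forall>s. s \<in> {0..u} \<longrightarrow> orbit_rate \<R> l (orbit_flow \<R> s x) *
      exp (- (LBINT v:{0..s}. \<Sum>k\<in>UNIV. orbit_rate \<R> k (orbit_flow \<R> v x))) = jump_density l s (emb x)"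
    using survival_mass[OF x] by (simp add: jump_density_rate[OF x])
qed simp

end

lemma jump_flow_normalised:
  "orbit_flow \<R> 0 (orbit_jump \<R> l (orbit_flow \<R> s z)) = orbit_jump \<R> l (orbit_flow \<R> s z)"
  by (cases l rule: kind_cases; cases z) (simp_all add: normalise_idem)

definition source_side :: "('i + 'j) \<times> ('i + 'j) \<Rightarrow> bool" where "source_side l = isl (fst l)"

text \<open>
  In contrast to \<open>jump_mat\<close>, kinds with two equal blocks have their block here, as in the equations of
  \<open>orbit_jump\<close>. Such jumps have rate 0, but measurability of the post-jump orbits is a statement about
  all outcomes.
\<close>

definition jump_all :: "('p::finite, 'm::finite, 'i::finite, 'j::finite) rap \<Rightarrow> ('i + 'j) \<times> ('i + 'j) \<Rightarrow> real^('p + 'm)^('p + 'm)" where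
  "jump_all \<R> l = (case l of
     (Inl i, Inl j) \<Rightarrow> bmat (block_at (blk_p \<R>) (blk_p \<R>) (C_p \<R>) i j) 0 0 0
   | (Inl i, Inr j) \<Rightarrow> bmat 0 (block_at (blk_p \<R>) (blk_m \<R>) (D_pm \<R>) i j) 0 0
   | (Inr i, Inl j) \<Rightarrow> bmat 0 0 (block_at (blk_m \<R>) (blk_p \<R>) (D_mp \<R>) i j) 0
   | (Inr i, Inr j) \<Rightarrow> bmat 0 0 0 (block_at (blk_m \<R>) (blk_m \<R>) (C_m \<R>) i j))"

lemma emb_orbit_jump:
  "emb (orbit_jump \<R> l z) = (if isl z = source_side l then normalise (emb z v* jump_all \<R> l) else emb z)"
  by (cases l rule: kind_cases; cases z)
     (simp_all add: source_side_def jump_all_def cat_bmat vm_simps normalise_cat)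

lemma isl_orbit_jump:
  "isl (orbit_jump \<R> l z) = (if isl z = source_side l then isl (snd l) else isl z)"
  by (cases l rule: kind_cases; cases z) (simp_all add: source_side_def)

text \<open>
  The definition of a PDMP for one starting point, with the holding times \<open>S\<close> and the kinds \<open>L\<close> of the
  jumps fixed.
\<close>

locale orbit_pdmp = prob_space M
  for M :: "'w measure" +
  fixes \<R> :: "('p::finite, 'm::finite, 'i::finite, 'j::finite) rap"
    and A :: "real \<Rightarrow> 'w \<Rightarrow> ('p, 'm) orbit" and x0 :: "('p, 'm) orbit"
    and S :: "nat \<Rightarrow> 'w \<Rightarrow> ereal" and L :: "nat \<Rightarrow> 'w \<Rightarrow> ('i + 'j) \<times> ('i + 'j)"
  assumes rap: "rap_data \<R>" and start: "x0 \<in> orbs \<R>"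
    and S_meas: "\<And>n. S n \<in> borel_measurable M" and L_meas: "\<And>n. L n \<in> measurable M (count_space UNIV)"
    and S_pos: "\<And>n \<omega>. \<omega> \<in> space M \<Longrightarrow> 0 < S n \<omega>"
    and unbounded: "\<And>t \<omega>. \<omega> \<in> space M \<Longrightarrow> \<exists>n. ereal t < jump_time S n \<omega>"
    and in_orbs: "\<And>t \<omega>. \<omega> \<in> space M \<Longrightarrow> 0 \<le> t \<Longrightarrow> A t \<omega> \<in> orbs \<R>"
    and path: "\<And>n t \<omega>. \<omega> \<in> space M \<Longrightarrow> jump_time S n \<omega> \<le> ereal t \<Longrightarrow> ereal t < jump_time S (Suc n) \<omega> \<Longrightarrow>
        A t \<omega> = orbit_flow \<R> (t - real_of_ereal (jump_time S n \<omega>)) (post_jump (orbit_flow \<R>) (orbit_jump \<R>) x0 S L n \<omega>)"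
    and law: "\<And>n l u. 0 \<le> u \<Longrightarrow> AE \<omega> in M. jump_time S n \<omega> < \<infinity> \<longrightarrow>
        real_cond_exp M (history M S L n) (indicator {\<omega>\<in>space M. S n \<omega> \<le> ereal u \<and> L n \<omega> = l}) \<omega> =
        (LBINT s:{0..u}. orbit_rate \<R> l (orbit_flow \<R> s (post_jump (orbit_flow \<R>) (orbit_jump \<R>) x0 S L n \<omega>)) *
           exp (- (LBINT v:{0..s}. \<Sum>k\<in>UNIV. orbit_rate \<R> k (orbit_flow \<R> v (post_jump (orbit_flow \<R>) (orbit_jump \<R>) x0 S L n \<omega>)))))"
begin

abbreviation "J \<equiv> jump_time S"
abbreviation "Y \<equiv> post_jump (orbit_flow \<R>) (orbit_jump \<R>) x0 S L"
abbreviation "T n \<omega> \<equiv> real_of_ereal (S n \<omega>)"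
abbreviation "Hist n \<equiv> history M S L n"

lemma J_0 [simp]: "J 0 \<omega> = 0" and J_Suc: "J (Suc n) \<omega> = J n \<omega> + S n \<omega>"
  by (simp_all add: jump_time_def add.commute)

lemma J_nonneg: "\<omega> \<in> space M \<Longrightarrow> 0 \<le> J n \<omega>"
  unfolding jump_time_def by (intro sum_nonneg) (use S_pos in \<open>auto intro: less_imp_le\<close>)

lemma J_Suc_finite: "\<omega> \<in> space M \<Longrightarrow> J (Suc n) \<omega> < \<infinity> \<longleftrightarrow> J n \<omega> < \<infinity> \<and> S n \<omega> < \<infinity>"
  using J_nonneg[of \<omega> n] S_pos[of \<omega> n] by (auto simp: J_Suc)

lemma S_real: "\<omega> \<in> space M \<Longrightarrow> S n \<omega> < \<infinity> \<Longrightarrow> S n \<omega> = ereal (T n \<omega>) \<and> 0 < T n \<omega>"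
  using S_pos[of \<omega> n] by (cases "S n \<omega>") auto

lemma J_real: "\<omega> \<in> space M \<Longrightarrow> J n \<omega> < \<infinity> \<Longrightarrow> J n \<omega> = ereal (real_of_ereal (J n \<omega>))"
  using J_nonneg[of \<omega> n] by (cases "J n \<omega>") auto

lemma T_nonneg: "\<omega> \<in> space M \<Longrightarrow> 0 \<le> T n \<omega>"
  using S_pos[of \<omega> n] by (simp add: real_of_ereal_pos)

lemma Y_normalised: "orbit_flow \<R> 0 (Y n \<omega>) = Y n \<omega>"
  by (cases n) (simp_all add: jump_flow_normalised flow_0[OF rap start])

text \<open>
  At its jump time the path sits in the post-jump state, so all post-jump states are orbits, for every
  outcome.
\<close>

lemma Y_orbs:
  assumes \<omega>: "\<omega> \<in> space M" and J: "J n \<omega> < \<infinity>"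
  shows "Y n \<omega> \<in> orbs \<R>"
proof -
  let ?t = "real_of_ereal (J n \<omega>)"
  have t: "J n \<omega> = ereal ?t" "0 \<le> ?t" using J_real[OF \<omega> J] J_nonneg[OF \<omega>] by (auto simp: real_of_ereal_pos)
  have "ereal ?t < J (Suc n) \<omega>"
    unfolding J_Suc using S_pos[OF \<omega>, of n] J J_nonneg[OF \<omega>, of n]
    by (cases "S n \<omega>"; cases "J n \<omega>") auto
  then have "A ?t \<omega> = orbit_flow \<R> (?t - ?t) (Y n \<omega>)" using path[OF \<omega>, of n ?t] t(1) by simp
  then show ?thesis using in_orbs[OF \<omega> t(2)] by (simp add: Y_normalised)
qed

lemma history_measurable:
  assumes "k < n"
  shows "S k \<in> borel_measurable (Hist n)" "L k \<in> measurable (Hist n) (count_space UNIV)"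
proof -
  have "(\<lambda>\<omega>. \<lambda>k\<in>{..<n}. (S k \<omega>, L k \<omega>)) \<in> measurable (Hist n) (PiM {..<n} (\<lambda>_. borel \<Otimes>\<^sub>M count_space UNIV))"
    unfolding history_def by (rule measurable_vimage_algebra1) (auto simp: space_PiM space_pair_measure)
  from measurable_compose[OF this measurable_component_singleton[of k]] assms
  have *: "(\<lambda>\<omega>. (S k \<omega>, L k \<omega>)) \<in> measurable (Hist n) (borel \<Otimes>\<^sub>M count_space UNIV)"
    by simp
  show "S k \<in> borel_measurable (Hist n)" "L k \<in> measurable (Hist n) (count_space UNIV)"
    using measurable_compose[OF * measurable_fst] measurable_compose[OF * measurable_snd] by simp_all
qed

lemma space_history [simp]: "space (Hist n) = space M"
  by (simp add: history_def)

lemma subalgebra_history: "subalgebra M (Hist n)"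
  unfolding subalgebra_def
proof safe
  fix X assume "X \<in> sets (Hist n)"
  then obtain B where B: "B \<in> sets (PiM {..<n} (\<lambda>_. borel \<Otimes>\<^sub>M count_space UNIV))"
    "X = (\<lambda>\<omega>. \<lambda>k\<in>{..<n}. (S k \<omega>, L k \<omega>)) -` B \<inter> space M"
    unfolding history_def by (subst (asm) sets_vimage_algebra2) (auto simp: space_PiM space_pair_measure)
  have "(\<lambda>\<omega>. \<lambda>k\<in>{..<n}. (S k \<omega>, L k \<omega>)) \<in> measurable M (PiM {..<n} (\<lambda>_. borel \<Otimes>\<^sub>M count_space UNIV))"
    by (intro measurable_restrict measurable_Pair S_meas L_meas)
  from measurable_sets[OF this B(1)] show "X \<in> sets M" by (simp add: B(2))
qed simp_all

lemma from_history: "f \<in> measurable (Hist n) N \<Longrightarrow> f \<in> measurable M N"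
  by (rule measurable_from_subalg[OF subalgebra_history])

lemma J_history: "J n \<in> borel_measurable (Hist n)"
  unfolding jump_time_def[abs_def] by (intro borel_measurable_ereal_sum history_measurable) auto

lemma flow_measurable:
  fixes G :: "real^'n::finite^'n"
  assumes "f \<in> borel_measurable N" "g \<in> borel_measurable N"
  shows "(\<lambda>\<omega>. g \<omega> v* mexp (f \<omega> *\<^sub>R G)) \<in> borel_measurable N"
proof -
  have "(\<lambda>q. snd q v* mexp (fst q *\<^sub>R G)) \<in> borel_measurable borel"
    by (intro borel_measurable_continuous_onI bounded_bilinear.continuous_on[OF vm_bilin] continuous_intros)
  from measurable_compose[OF borel_measurable_Pair[OF assms] this] show ?thesis by simp
qed

lemma normalise_measurable: "normalise \<in> borel_measurable borel"
  unfolding normalise_def by measurable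

lemma vm_measurable: "(\<lambda>v. v v* B) \<in> borel_measurable borel" for B :: "real^'b::finite^'a::finite"
  by (intro borel_measurable_continuous_onI bounded_bilinear.continuous_on[OF vm_bilin] continuous_intros)

text \<open>Flow and jump of a fixed kind are products with matrices, followed by normalisation.\<close>

lemma next_measurable:
  assumes y: "(\<lambda>\<omega>. emb (z \<omega>)) \<in> borel_measurable N" "(\<lambda>\<omega>. isl (z \<omega>)) \<in> measurable N (count_space UNIV)"
    and f: "f \<in> borel_measurable N" "\<And>\<omega>. \<omega> \<in> space N \<Longrightarrow> 0 \<le> f \<omega>"
  shows "(\<lambda>\<omega>. emb (orbit_jump \<R> l (orbit_flow \<R> (f \<omega>) (z \<omega>)))) \<in> borel_measurable N"
    "(\<lambda>\<omega>. isl (orbit_jump \<R> l (orbit_flow \<R> (f \<omega>) (z \<omega>)))) \<in> measurable N (count_space UNIV)"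
proof -
  have 1: "(\<lambda>\<omega>. normalise (emb (z \<omega>) v* mexp (f \<omega> *\<^sub>R flow_gen \<R>))) \<in> borel_measurable N"
    by (rule measurable_compose[OF flow_measurable[OF f(1) y(1)] normalise_measurable])
  then have 2: "(\<lambda>\<omega>. emb (orbit_flow \<R> (f \<omega>) (z \<omega>))) \<in> borel_measurable N"
    by (subst measurable_cong[where g="\<lambda>\<omega>. normalise (emb (z \<omega>) v* mexp (f \<omega> *\<^sub>R flow_gen \<R>))"]) (auto simp: emb_flow[OF rap f(2)])
  have 3: "Measurable.pred N (\<lambda>\<omega>. isl (z \<omega>) = source_side l)" using y(2) by measurable
  show "(\<lambda>\<omega>. emb (orbit_jump \<R> l (orbit_flow \<R> (f \<omega>) (z \<omega>)))) \<in> borel_measurable N"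
    unfolding emb_orbit_jump isl_flow[OF rap]
    by (intro measurable_If[OF _ 2 3[unfolded pred_def]] measurable_compose[OF measurable_compose[OF 2 vm_measurable] normalise_measurable])
  show "(\<lambda>\<omega>. isl (orbit_jump \<R> l (orbit_flow \<R> (f \<omega>) (z \<omega>)))) \<in> measurable N (count_space UNIV)"
    unfolding isl_orbit_jump isl_flow[OF rap]
    by (intro measurable_If[OF _ y(2) 3[unfolded pred_def]]) simp
qed

lemma Y_history_both:
  "n \<le> m \<Longrightarrow> (\<lambda>\<omega>. emb (Y n \<omega>)) \<in> borel_measurable (Hist m) \<and> (\<lambda>\<omega>. isl (Y n \<omega>)) \<in> measurable (Hist m) (count_space UNIV)"
proof (induction n)
  case (Suc n)
  then have n: "n < m" and IH: "(\<lambda>\<omega>. emb (Y n \<omega>)) \<in> borel_measurable (Hist m)"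
    "(\<lambda>\<omega>. isl (Y n \<omega>)) \<in> measurable (Hist m) (count_space UNIV)" by simp_all
  have T: "T n \<in> borel_measurable (Hist m)" using history_measurable(1)[OF n] by measurable
  note nxt = next_measurable[OF IH T]
  show ?case
    unfolding post_jump.simps
    by (intro conjI measurable_compose_countable'[OF nxt(1) history_measurable(2)[OF n]]
        measurable_compose_countable'[OF nxt(2) history_measurable(2)[OF n]])
       (use T_nonneg in \<open>auto simp: countable_finite\<close>)
qed simp

lemmas Y_history = Y_history_both[THEN conjunct1] Y_history_both[THEN conjunct2]

end

context orbit_pdmp
begin

abbreviation "jd \<equiv> jump_density \<R>"

lemma jd_nonneg: "\<omega> \<in> space M \<Longrightarrow> J n \<omega> < \<infinity> \<Longrightarrow> 0 \<le> s \<Longrightarrow> 0 \<le> jd l s (emb (Y n \<omega>))"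
  by (rule jump_density_nonneg[OF rap Y_orbs])

lemma jd_integrable: "set_integrable lborel {0..u} (\<lambda>s. jd l s v)"
  by (intro set_integrable_continuous jump_density_continuous[OF rap] continuous_intros)

lemma jd_borel: "(\<lambda>q. jd l (fst q) (snd q)) \<in> borel_measurable borel"
  by (intro borel_measurable_continuous_onI jump_density_continuous[OF rap] continuous_intros)

lemma jd_measurable:
  assumes "f \<in> borel_measurable N" "g \<in> borel_measurable N"
  shows "(\<lambda>p. jd l (f p) (g p)) \<in> borel_measurable N"
  using measurable_compose[OF borel_measurable_Pair[OF assms] jd_borel] by simp

lemma finite_history: "{\<omega> \<in> space M. J n \<omega> < \<infinity>} \<in> sets (Hist n)"
proof -
  have "Measurable.pred (Hist n) (\<lambda>\<omega>. J n \<omega> < \<infinity>)" using J_history by measurable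
  then show ?thesis by (simp add: pred_def)
qed

text \<open>The assumption \<open>law\<close>, integrated over a set of the history and rewritten by \<open>jump_law\<close>.\<close>

lemma holding_law:
  assumes u: "0 \<le> u" and B: "B \<in> sets (Hist n)"
  shows "emeasure M {\<omega>\<in>space M. \<omega> \<in> B \<and> J n \<omega> < \<infinity> \<and> S n \<omega> \<le> ereal u \<and> L n \<omega> = l}
    = (\<integral>\<^sup>+\<omega>. indicator B \<omega> * (indicator {\<omega>. J n \<omega> < \<infinity>} \<omega> *
        (\<integral>\<^sup>+s. indicator {0..u} s * ennreal (jd l s (emb (Y n \<omega>))) \<partial>lborel)) \<partial>M)"
proof -
  interpret F: finite_measure_subalgebra M "Hist n"
    by unfold_locales (rule subalgebra_history)
  let ?B = "B \<inter> {\<omega>\<in>space M. J n \<omega> < \<infinity>}" and ?X = "{\<omega>\<in>space M. S n \<omega> \<le> ereal u \<and> L n \<omega> = l}"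
  let ?f = "indicator ?X :: 'w \<Rightarrow> real"
  have BN: "?B \<in> sets (Hist n)" using B finite_history by (rule sets.Int)
  then have BM: "?B \<in> sets M" using subalgebra_history by (auto simp: subalgebra_def)
  have XM: "?X \<in> sets M"
  proof -
    have "Measurable.pred M (\<lambda>\<omega>. S n \<omega> \<le> ereal u \<and> L n \<omega> = l)"
      using S_meas L_meas by measurable
    then show ?thesis by (simp add: pred_def)
  qed
  have fi: "integrable M ?f" using XM by (simp add: integrable_indicator_iff emeasure_eq_measure)
  have fm: "?f \<in> borel_measurable M" using XM by simp
  have ri: "integrable M (\<lambda>x. indicator ?B x *\<^sub>R real_cond_exp M (Hist n) ?f x)"
    using BM by (intro integrable_mult_indicator F.real_cond_exp_int fi)
  have rp: "AE x in M. 0 \<le> real_cond_exp M (Hist n) ?f x"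
    by (rule F.real_cond_exp_pos[OF _ fm]) auto
  have "{\<omega>\<in>space M. \<omega> \<in> B \<and> J n \<omega> < \<infinity> \<and> S n \<omega> \<le> ereal u \<and> L n \<omega> = l} = ?B \<inter> ?X" by auto
  moreover have "measure M (?B \<inter> ?X) = (\<integral>x\<in>?B. ?f x \<partial>M)"
    using BM XM unfolding set_lebesgue_integral_def
    by (simp add: indicator_inter_arith[symmetric] sets.Int)
  ultimately have "emeasure M {\<omega>\<in>space M. \<omega> \<in> B \<and> J n \<omega> < \<infinity> \<and> S n \<omega> \<le> ereal u \<and> L n \<omega> = l}
      = ennreal (\<integral>x\<in>?B. real_cond_exp M (Hist n) ?f x \<partial>M)"
    using F.real_cond_exp_intA[OF fi BN] by (simp add: emeasure_eq_measure)
  also have "\<dots> = (\<integral>\<^sup>+x. ennreal (indicator ?B x *\<^sub>R real_cond_exp M (Hist n) ?f x) \<partial>M)"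
    unfolding set_lebesgue_integral_def
    by (rule nn_integral_eq_integral[symmetric, OF ri]) (use rp in \<open>auto elim!: eventually_mono simp: indicator_def\<close>)
  also have "\<dots> = (\<integral>\<^sup>+\<omega>. indicator B \<omega> * (indicator {\<omega>. J n \<omega> < \<infinity>} \<omega> *
        (\<integral>\<^sup>+s. indicator {0..u} s * ennreal (jd l s (emb (Y n \<omega>))) \<partial>lborel)) \<partial>M)"
  proof (rule nn_integral_cong_AE)
    show "AE \<omega> in M. ennreal (indicator ?B \<omega> *\<^sub>R real_cond_exp M (Hist n) ?f \<omega>) = indicator B \<omega> * (indicator {\<omega>. J n \<omega> < \<infinity>} \<omega> *
        (\<integral>\<^sup>+s. indicator {0..u} s * ennreal (jd l s (emb (Y n \<omega>))) \<partial>lborel))"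
      using law[OF u, of n l] AE_space
    proof eventually_elim
      case (elim \<omega>)
      show ?case
      proof (cases "\<omega> \<in> B \<and> J n \<omega> < \<infinity>")
        case True
        have "(\<integral>\<^sup>+s. indicator {0..u} s * ennreal (jd l s (emb (Y n \<omega>))) \<partial>lborel) = ennreal (LBINT s:{0..u}. jd l s (emb (Y n \<omega>)))"
          by (rule nonneg_set_nn_integral[OF jd_integrable]) (use jd_nonneg elim True in auto)
        moreover have "real_cond_exp M (Hist n) ?f \<omega> = (LBINT s:{0..u}. jd l s (emb (Y n \<omega>)))"
          using elim True jump_law[OF rap Y_orbs[OF elim(2)], of n u l] by auto
        ultimately show ?thesis using True elim(2) by simp
      qed (auto simp: indicator_def)
    qed
  qed
  finally show ?thesis .
qed

text \<open>
  Both sides are integrals of \<open>g\<close> over measures on pairs of history and time. By \<open>holding_law\<close> these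
  measures agree on rectangles \<open>B \<times> {..u}\<close>, which form a generator that is stable under intersection.
\<close>

lemma holding_nn:
  assumes g: "g \<in> borel_measurable (Hist n \<Otimes>\<^sub>M borel)"
  shows "(\<integral>\<^sup>+\<omega>. indicator {\<omega>. J n \<omega> < \<infinity> \<and> S n \<omega> < \<infinity> \<and> L n \<omega> = l} \<omega> * g (\<omega>, T n \<omega>) \<partial>M)
    = (\<integral>\<^sup>+\<omega>. indicator {\<omega>. J n \<omega> < \<infinity>} \<omega> *
        (\<integral>\<^sup>+s. indicator {0..} s * ennreal (jd l s (emb (Y n \<omega>))) * g (\<omega>, s) \<partial>lborel) \<partial>M)"
proof -
  let ?X = "{\<omega>\<in>space M. J n \<omega> < \<infinity> \<and> S n \<omega> < \<infinity> \<and> L n \<omega> = l}"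
  let ?P = "Hist n \<Otimes>\<^sub>M (borel :: real measure)"
  let ?MN = "restr_to_subalg M (Hist n)"
  have sub: "subalgebra M (Hist n)" by (rule subalgebra_history)
  have J_M: "J n \<in> borel_measurable M" by (rule from_history[OF J_history])
  have X: "?X \<in> sets M"
  proof -
    have "Measurable.pred M (\<lambda>\<omega>. J n \<omega> < \<infinity> \<and> S n \<omega> < \<infinity> \<and> L n \<omega> = l)"
      using S_meas L_meas J_M by measurable
    then show ?thesis by (simp add: pred_def)
  qed
  have T: "T n \<in> borel_measurable M" using S_meas[of n] by measurable
  have topH: "space M \<in> sets (Hist n)" using sets.top[of "Hist n"] by simp
  have id: "(\<lambda>\<omega>. \<omega>) \<in> measurable M (Hist n)" by (rule from_history[of _ n]) simp
  have pair: "(\<lambda>\<omega>. (\<omega>, T n \<omega>)) \<in> measurable M ?P" by (intro measurable_Pair id T)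
  have setsP: "sets (?MN \<Otimes>\<^sub>M lborel) = sets ?P"
    by (intro sets_pair_measure_cong sets_restr_to_subalg sub) simp
  let ?d = "\<lambda>p. indicator {\<omega>. J n \<omega> < \<infinity>} (fst p) * (indicator {0..} (snd p) * ennreal (jd l (snd p) (emb (Y n (fst p)))))"
  have d: "?d \<in> borel_measurable ?P"
  proof -
    have "(\<lambda>p. J n (fst p)) \<in> borel_measurable ?P" by (rule measurable_compose[OF measurable_fst J_history])
    then have "(\<lambda>p. indicator {\<omega>. J n \<omega> < \<infinity>} (fst p) :: ennreal) \<in> borel_measurable ?P"
      unfolding indicator_def of_bool_def by measurable
    moreover have "(\<lambda>p. jd l (snd p) (emb (Y n (fst p)))) \<in> borel_measurable ?P"
      by (intro jd_measurable measurable_snd measurable_compose[OF measurable_fst Y_history(1)]) simp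
    ultimately show ?thesis by measurable
  qed
  define \<mu> where "\<mu> = distr (density M (indicator ?X)) ?P (\<lambda>\<omega>. (\<omega>, T n \<omega>))"
  define \<nu> where "\<nu> = density (?MN \<Otimes>\<^sub>M lborel) ?d"
  have mu_nn: "(\<integral>\<^sup>+p. h p \<partial>\<mu>) = (\<integral>\<^sup>+\<omega>. indicator ?X \<omega> * h (\<omega>, T n \<omega>) \<partial>M)" if h: "h \<in> borel_measurable ?P" for h
  proof -
    have "(\<integral>\<^sup>+p. h p \<partial>\<mu>) = (\<integral>\<^sup>+\<omega>. h (\<omega>, T n \<omega>) \<partial>density M (indicator ?X))"
      unfolding \<mu>_def by (rule nn_integral_distr) (use pair h in auto)
    also have "\<dots> = (\<integral>\<^sup>+\<omega>. indicator ?X \<omega> * h (\<omega>, T n \<omega>) \<partial>M)"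
      by (rule nn_integral_density) (use X measurable_compose[OF pair h] in auto)
    finally show ?thesis .
  qed
  have nu_nn: "(\<integral>\<^sup>+p. h p \<partial>\<nu>) = (\<integral>\<^sup>+\<omega>. \<integral>\<^sup>+s. ?d (\<omega>, s) * h (\<omega>, s) \<partial>lborel \<partial>M)" if h: "h \<in> borel_measurable ?P" for h
  proof -
    have dhP: "(\<lambda>p. ?d p * h p) \<in> borel_measurable ?P"
      by (rule borel_measurable_times_ennreal[OF d h])
    then have dh: "(\<lambda>p. ?d p * h p) \<in> borel_measurable (?MN \<Otimes>\<^sub>M lborel)"
      by (subst measurable_cong_sets[OF setsP refl])
    have "(\<integral>\<^sup>+p. h p \<partial>\<nu>) = (\<integral>\<^sup>+p. ?d p * h p \<partial>(?MN \<Otimes>\<^sub>M lborel))"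
      unfolding \<nu>_def by (rule nn_integral_density; subst measurable_cong_sets[OF setsP refl]; rule d h)
    also have "\<dots> = (\<integral>\<^sup>+\<omega>. \<integral>\<^sup>+s. ?d (\<omega>, s) * h (\<omega>, s) \<partial>lborel \<partial>?MN)"
      by (rule lborel.nn_integral_fst[symmetric, OF dh])
    also have "\<dots> = (\<integral>\<^sup>+\<omega>. \<integral>\<^sup>+s. ?d (\<omega>, s) * h (\<omega>, s) \<partial>lborel \<partial>M)"
    proof (rule nn_integral_subalgebra2[OF sub])
      have "(\<lambda>p. ?d p * h p) \<in> borel_measurable (Hist n \<Otimes>\<^sub>M lborel)"
        by (subst measurable_cong_sets[OF sets_pair_measure_cong[OF refl sets_lborel] refl]) (rule dhP)
      from lborel.borel_measurable_nn_integral_fst[OF this]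
      show "(\<lambda>\<omega>. \<integral>\<^sup>+s. ?d (\<omega>, s) * h (\<omega>, s) \<partial>lborel) \<in> borel_measurable (Hist n)" .
    qed
    finally show ?thesis .
  qed
  have setsM: "sets \<mu> = sets ?P" by (simp add: \<mu>_def)
  have setsN: "sets \<nu> = sets ?P" unfolding \<nu>_def sets_density by (rule setsP)
  have "\<mu> = \<nu>"
  proof (rule measure_eqI_generator_eq)
    let ?E = "{a \<times> b | a b. a \<in> sets (Hist n) \<and> b \<in> range (atMost :: real \<Rightarrow> real set)}"
    have "sets ?P = sets (sigma (space (Hist n) \<times> space (borel::real measure)) ?E)"
    proof (rule sets_pair_eq)
      show "sets (Hist n) \<subseteq> Pow (space (Hist n))" by (rule sets.space_closed)
      show "sets (Hist n) = sigma_sets (space (Hist n)) (sets (Hist n))" by (rule sets.sigma_sets_eq[symmetric])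
      show "countable {space (Hist n)}" "{space (Hist n)} \<subseteq> sets (Hist n)" "\<Union>{space (Hist n)} = space (Hist n)" using topH by auto
      show "range atMost \<subseteq> Pow (space (borel::real measure))" by simp
      show "sets (borel::real measure) = sigma_sets (space borel) (range atMost)"
        by (subst borel_eq_atMost) simp
      show "countable (range (\<lambda>k::nat. {..real k}))" by simp
      show "range (\<lambda>k::nat. {..real k}) \<subseteq> range atMost" by auto
      show "\<Union>(range (\<lambda>k::nat. {..real k})) = space borel" by (auto intro: real_arch_simple)
    qed
    also have "\<dots> = sigma_sets (space M \<times> UNIV) ?E"
      by (subst sets_measure_of) (use sets.space_closed[of "Hist n"] in auto)
    finally have sP: "sets ?P = sigma_sets (space M \<times> UNIV) ?E" .
    show "sets \<mu> = sigma_sets (space M \<times> UNIV) ?E" "sets \<nu> = sigma_sets (space M \<times> UNIV) ?E"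
      by (simp_all only: setsM setsN sP)
    show "?E \<subseteq> Pow (space M \<times> UNIV)" using sets.sets_into_space[of _ "Hist n"] by fastforce
    show "Int_stable ?E"
    proof (rule Int_stableI)
      fix a b assume "a \<in> ?E" "b \<in> ?E"
      then obtain a1 a2 u1 u2 where ab: "a = a1 \<times> {..u1}" "b = a2 \<times> {..u2}" and a12: "a1 \<in> sets (Hist n)" "a2 \<in> sets (Hist n)" by auto
      have "a \<inter> b = (a1 \<inter> a2) \<times> {..min u1 u2}" using ab by auto
      then show "a \<inter> b \<in> ?E" using a12 by blast
    qed
    show "range (\<lambda>k::nat. space M \<times> {..real k}) \<subseteq> ?E"
      using topH by auto
    show "(\<Union>k::nat. space M \<times> {..real k}) = space M \<times> UNIV" by (auto intro: real_arch_simple)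
    have eC: "emeasure \<mu> C = (\<integral>\<^sup>+\<omega>. indicator ?X \<omega> * indicator C (\<omega>, T n \<omega>) \<partial>M)" if "C \<in> sets ?P" for C
      using mu_nn[of "indicator C"] that by (simp add: setsM)
    have le1: "emeasure \<mu> C \<le> 1" if "C \<in> sets ?P" for C
    proof -
      have "emeasure \<mu> C \<le> (\<integral>\<^sup>+\<omega>. 1 \<partial>M)" unfolding eC[OF that] by (intro nn_integral_mono) (auto simp: indicator_def)
      then show ?thesis by (simp add: emeasure_space_1)
    qed
    have "space M \<times> {..real k} \<in> sets ?P" for k
      using topH by (intro pair_measureI) auto
    from le1[OF this] show "emeasure \<mu> (space M \<times> {..real k}) \<noteq> \<infinity>" for k
      by (metis ennreal_one_neq_top infinity_ennreal_def top_unique)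
    fix C assume "C \<in> ?E"
    then obtain a u where C: "C = a \<times> {..u}" and a: "a \<in> sets (Hist n)" by auto
    have CP: "C \<in> sets ?P" using a by (auto simp: C)
    have aM: "a \<in> sets M" using a sub by (auto simp: subalgebra_def)
    have nu: "emeasure \<nu> C = (\<integral>\<^sup>+\<omega>. \<integral>\<^sup>+s. ?d (\<omega>, s) * indicator C (\<omega>, s) \<partial>lborel \<partial>M)"
      using nu_nn[of "indicator C"] CP by (simp add: setsN)
    show "emeasure \<mu> C = emeasure \<nu> C"
    proof (cases "0 \<le> u")
      case True
      have "emeasure \<mu> C = emeasure M {\<omega>\<in>space M. \<omega> \<in> a \<and> J n \<omega> < \<infinity> \<and> S n \<omega> \<le> ereal u \<and> L n \<omega> = l}"
      proof -
        let ?W = "{\<omega>\<in>space M. \<omega> \<in> a \<and> J n \<omega> < \<infinity> \<and> S n \<omega> \<le> ereal u \<and> L n \<omega> = l}"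
        have "Measurable.pred M (\<lambda>\<omega>. \<omega> \<in> a \<and> J n \<omega> < \<infinity> \<and> S n \<omega> \<le> ereal u \<and> L n \<omega> = l)"
          using S_meas L_meas J_M aM by measurable
        then have W: "?W \<in> sets M" by (simp add: pred_def)
        have "indicator ?X \<omega> * indicator C (\<omega>, T n \<omega>) = (indicator ?W \<omega> :: ennreal)" if "\<omega> \<in> space M" for \<omega>
        proof (cases "S n \<omega> < \<infinity>")
          case True
          then have "S n \<omega> = ereal (T n \<omega>)" using S_real[OF that] by blast
          then have "S n \<omega> \<le> ereal u \<longleftrightarrow> T n \<omega> \<le> u" by (metis ereal_less_eq(3))
          then show ?thesis using True that by (auto simp: indicator_def C)
        next
          case False
          then show ?thesis by (auto simp: indicator_def)
        qed
        then have "emeasure \<mu> C = (\<integral>\<^sup>+\<omega>. indicator ?W \<omega> \<partial>M)" unfolding eC[OF CP] by (intro nn_integral_cong)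
        then show ?thesis using W by simp
      qed
      also have "\<dots> = emeasure \<nu> C"
        unfolding holding_law[OF True a] nu
      proof (intro nn_integral_cong)
        fix \<omega>
        have "(\<integral>\<^sup>+s. ?d (\<omega>, s) * indicator C (\<omega>, s) \<partial>lborel)
           = (\<integral>\<^sup>+s. (indicator a \<omega> * indicator {\<omega>. J n \<omega> < \<infinity>} \<omega>) * (indicator {0..u} s * ennreal (jd l s (emb (Y n \<omega>)))) \<partial>lborel)"
          by (intro nn_integral_cong) (auto simp: C indicator_def)
        also have "\<dots> = (indicator a \<omega> * indicator {\<omega>. J n \<omega> < \<infinity>} \<omega>) * (\<integral>\<^sup>+s. indicator {0..u} s * ennreal (jd l s (emb (Y n \<omega>))) \<partial>lborel)"
        proof (rule nn_integral_cmult)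
          have "(\<lambda>s. jd l s (emb (Y n \<omega>))) \<in> borel_measurable lborel" by (intro jd_measurable) auto
          then show "(\<lambda>s. indicator {0..u} s * ennreal (jd l s (emb (Y n \<omega>)))) \<in> borel_measurable lborel" by measurable
        qed
        finally show "indicator a \<omega> * (indicator {\<omega>. J n \<omega> < \<infinity>} \<omega> * (\<integral>\<^sup>+s. indicator {0..u} s * ennreal (jd l s (emb (Y n \<omega>))) \<partial>lborel))
            = (\<integral>\<^sup>+s. ?d (\<omega>, s) * indicator C (\<omega>, s) \<partial>lborel)" by (simp add: mult.assoc)
      qed
      finally show ?thesis .
    next
      case False
      have "emeasure \<mu> C = 0"
      proof -
        have "emeasure \<mu> C = (\<integral>\<^sup>+\<omega>. 0 \<partial>M)"
          unfolding eC[OF CP]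
        proof (rule nn_integral_cong)
          fix \<omega> assume "\<omega> \<in> space M"
          then have "0 \<le> T n \<omega>" by (rule T_nonneg)
          then show "indicator ?X \<omega> * indicator C (\<omega>, T n \<omega>) = (0::ennreal)" using False by (auto simp: C)
        qed
        then show ?thesis by simp
      qed
      moreover have "emeasure \<nu> C = 0"
      proof -
        have "?d (\<omega>, s) * indicator C (\<omega>, s) = 0" for \<omega> s using False by (auto simp: C indicator_def)
        then show ?thesis unfolding nu by (simp only: nn_integral_0_iff_AE) simp
      qed
      ultimately show ?thesis by simp
    qed
  qed
  have "(\<integral>\<^sup>+\<omega>. indicator {\<omega>. J n \<omega> < \<infinity> \<and> S n \<omega> < \<infinity> \<and> L n \<omega> = l} \<omega> * g (\<omega>, T n \<omega>) \<partial>M) = (\<integral>\<^sup>+p. g p \<partial>\<mu>)"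
    unfolding mu_nn[OF g] by (intro nn_integral_cong) (auto simp: indicator_def)
  also have "\<dots> = (\<integral>\<^sup>+\<omega>. \<integral>\<^sup>+s. ?d (\<omega>, s) * g (\<omega>, s) \<partial>lborel \<partial>M)"
    unfolding \<open>\<mu> = \<nu>\<close> by (rule nu_nn[OF g])
  also have "\<dots> = (\<integral>\<^sup>+\<omega>. indicator {\<omega>. J n \<omega> < \<infinity>} \<omega> *
        (\<integral>\<^sup>+s. indicator {0..} s * ennreal (jd l s (emb (Y n \<omega>))) * g (\<omega>, s) \<partial>lborel) \<partial>M)"
  proof (rule nn_integral_cong)
    fix \<omega>
    assume \<omega>: "\<omega> \<in> space M"
    have "(\<lambda>s. g (\<omega>, s)) \<in> borel_measurable lborel"
      using measurable_compose[OF measurable_Pair1'[of \<omega> "Hist n" borel] g] \<omega> by simp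
    moreover have "(\<lambda>s. jd l s (emb (Y n \<omega>))) \<in> borel_measurable lborel" by (intro jd_measurable) auto
    ultimately have "(\<lambda>s. indicator {0..} s * ennreal (jd l s (emb (Y n \<omega>))) * g (\<omega>, s)) \<in> borel_measurable lborel" by measurable
    from nn_integral_cmult[OF this, of "indicator {\<omega>. J n \<omega> < \<infinity>} \<omega>"]
    show "(\<integral>\<^sup>+s. ?d (\<omega>, s) * g (\<omega>, s) \<partial>lborel) = indicator {\<omega>. J n \<omega> < \<infinity>} \<omega> *
        (\<integral>\<^sup>+s. indicator {0..} s * ennreal (jd l s (emb (Y n \<omega>))) * g (\<omega>, s) \<partial>lborel)"
      by (simp add: mult.assoc)
  qed
  finally show ?thesis .
qed

end

section \<open>The orbit at the time when a level runs out\<close>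

text \<open>
  A level starts at \<open>r0\<close>, rises while the side of the orbit is in \<open>U\<close> and falls while it is in \<open>D\<close>.
\<close>

locale orbit_passage = orbit_pdmp M \<R> A x0 S L
  for M :: "'w measure" and \<R> :: "('p::finite, 'm::finite, 'i::finite, 'j::finite) rap"
    and A :: "real \<Rightarrow> 'w \<Rightarrow> ('p, 'm) orbit" and x0 S L +
  fixes U D :: "bool set" and r0 :: real
  assumes UD: "D \<inter> U = {}" and r0: "0 \<le> r0"
begin

sublocale K: jump_kernel "emb ` orbs \<R>" "flow_gen \<R>" "full_gen \<R> - flow_gen \<R>" "side_proj D" "side_proj U"
  by (rule jump_kernel_orbs[OF rap UD])

primrec R :: "nat \<Rightarrow> 'w \<Rightarrow> real" where
  "R 0 \<omega> = r0"
| "R (Suc n) \<omega> = (if isl (Y n \<omega>) \<in> U then R n \<omega> + T n \<omega> else R n \<omega> - T n \<omega>)"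

text \<open>
  If the level runs out exactly at the next jump, the path counts as one that continues; accordingly
  the inequality in \<open>hit\<close> is strict. Such ties have probability 0 by \<open>no_tie\<close>.
\<close>

definition stays :: "nat \<Rightarrow> 'w \<Rightarrow> bool" where
  "stays n \<omega> \<longleftrightarrow> isl (Y n \<omega>) \<in> U \<or> (isl (Y n \<omega>) \<in> D \<and> T n \<omega> \<le> R n \<omega>)"

definition alive :: "nat \<Rightarrow> 'w \<Rightarrow> bool" where
  "alive n \<omega> \<longleftrightarrow> J n \<omega> < \<infinity> \<and> (\<forall>k<n. stays k \<omega>)"

definition hit :: "nat \<Rightarrow> 'w \<Rightarrow> bool" where
  "hit n \<omega> \<longleftrightarrow> alive n \<omega> \<and> isl (Y n \<omega>) \<in> D \<and> ereal (R n \<omega>) < S n \<omega>"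

definition exit :: "nat \<Rightarrow> 'w \<Rightarrow> real^('p + 'm)" where
  "exit n \<omega> = normalise (emb (Y n \<omega>) v* mexp (R n \<omega> *\<^sub>R flow_gen \<R>))"

lemma alive_Suc: "\<omega> \<in> space M \<Longrightarrow> alive (Suc n) \<omega> \<longleftrightarrow> alive n \<omega> \<and> S n \<omega> < \<infinity> \<and> stays n \<omega>"
  unfolding alive_def J_Suc_finite by (auto simp: less_Suc_eq)

lemma alive_orbs: "\<omega> \<in> space M \<Longrightarrow> alive n \<omega> \<Longrightarrow> Y n \<omega> \<in> orbs \<R>"
  by (auto simp: alive_def intro: Y_orbs)

lemma R_nonneg: "\<omega> \<in> space M \<Longrightarrow> alive n \<omega> \<Longrightarrow> 0 \<le> R n \<omega>"
  by (induction n) (auto simp: r0 alive_Suc stays_def T_nonneg UD)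

lemma alive_mono: "\<omega> \<in> space M \<Longrightarrow> alive m \<omega> \<Longrightarrow> n \<le> m \<Longrightarrow> alive n \<omega>"
  by (induction m) (auto simp: alive_Suc le_Suc_eq)

lemma hit_unique:
  assumes "\<omega> \<in> space M" "hit n \<omega>" "hit m \<omega>" shows "n = m"
proof -
  have "\<not> hit m \<omega>" if "hit n \<omega>" "n < m" for n m
  proof
    assume "hit m \<omega>"
    then have "alive (Suc n) \<omega>" using alive_mono[OF assms(1), of m "Suc n"] that by (simp add: hit_def)
    then have "S n \<omega> < \<infinity>" "stays n \<omega>" by (simp_all add: alive_Suc[OF assms(1)])
    then have "T n \<omega> \<le> R n \<omega>" "S n \<omega> = ereal (T n \<omega>)" using that UD S_real[OF assms(1), of n] by (auto simp: stays_def hit_def)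
    moreover have "ereal (R n \<omega>) < S n \<omega>" using that by (simp add: hit_def)
    ultimately show False by (metis ereal_less_eq(3) leD)
  qed
  then show ?thesis using assms(2,3) by (metis linorder_neqE_nat)
qed

lemma R_history: "n \<le> m \<Longrightarrow> R n \<in> borel_measurable (Hist m)"
proof (induction n)
  case (Suc n)
  have [measurable]: "T n \<in> borel_measurable (Hist m)" "(\<lambda>\<omega>. isl (Y n \<omega>)) \<in> measurable (Hist m) (count_space UNIV)" "R n \<in> borel_measurable (Hist m)"
    using Suc history_measurable(1)[of n m] Y_history(2)[of n m] by auto
  have "(\<lambda>\<omega>. if isl (Y n \<omega>) \<in> U then R n \<omega> + T n \<omega> else R n \<omega> - T n \<omega>) \<in> borel_measurable (Hist m)"
    by measurable
  moreover have "R (Suc n) = (\<lambda>\<omega>. if isl (Y n \<omega>) \<in> U then R n \<omega> + T n \<omega> else R n \<omega> - T n \<omega>)" by auto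
  ultimately show ?case by simp
next
  case 0
  have "R 0 = (\<lambda>_. r0)" by auto
  then show ?case by simp
qed

lemma stays_history: "n < m \<Longrightarrow> Measurable.pred (Hist m) (stays n)"
proof -
  assume "n < m"
  then have [measurable]: "T n \<in> borel_measurable (Hist m)" "(\<lambda>\<omega>. isl (Y n \<omega>)) \<in> measurable (Hist m) (count_space UNIV)" "R n \<in> borel_measurable (Hist m)"
    using history_measurable(1)[of n m] Y_history(2)[of n m] R_history[of n m] by auto
  show ?thesis unfolding stays_def[abs_def] by measurable
qed

lemma alive_history: "Measurable.pred (Hist n) (alive n)"
proof -
  have "Measurable.pred (Hist n) (\<lambda>\<omega>. \<forall>k\<in>{..<n}. stays k \<omega>)"
    by (intro pred_intros_finite stays_history) auto
  moreover have "Measurable.pred (Hist n) (\<lambda>\<omega>. J n \<omega> < \<infinity>)" using J_history by measurable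
  ultimately have "Measurable.pred (Hist n) (\<lambda>\<omega>. J n \<omega> < \<infinity> \<and> (\<forall>k\<in>{..<n}. stays k \<omega>))" by measurable
  then show ?thesis by (simp add: alive_def[abs_def] Ball_def)
qed

lemma exit_eq: "0 \<le> R n \<omega> \<Longrightarrow> exit n \<omega> = emb (orbit_flow \<R> (R n \<omega>) (Y n \<omega>))"
  by (simp add: exit_def emb_flow[OF rap])

lemma exit_history: "exit n \<in> borel_measurable (Hist n)"
  unfolding exit_def[abs_def]
  by (rule measurable_compose[OF flow_measurable[OF R_history Y_history(1)] normalise_measurable]) auto

text \<open>The cut at 0 makes the approximations Borel measurable on the whole line.\<close>

definition cutoff :: "(real \<Rightarrow> real^('p + 'm)^('p + 'm)) \<Rightarrow> real \<Rightarrow> real^('p + 'm)^('p + 'm)" where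
  "cutoff F r = indicator {0..} r *\<^sub>R F r"

lemma kern_row:
  assumes x: "x \<in> orbs \<R>" and s: "0 \<le> s"
  shows "(emb x v* K.kern s v* F) \<bullet> w = (\<Sum>l\<in>UNIV. jd l s (emb x) * ((emb (orbit_jump \<R> l (orbit_flow \<R> s x)) v* F) \<bullet> w))"
proof -
  have "K.kern s = mexp (s *\<^sub>R flow_gen \<R>) ** (\<Sum>l\<in>UNIV. jump_mat \<R> l)"
    by (simp only: K.kern_def sum_jump_mat)
  then have "emb x v* K.kern s = (\<Sum>l\<in>UNIV. emb x v* mexp (s *\<^sub>R flow_gen \<R>) v* jump_mat \<R> l)"
    by (simp only: vector_matrix_mul_assoc[symmetric] bounded_bilinear.sum_right[OF vm_bilin])
  also have "\<dots> = (\<Sum>l\<in>UNIV. jd l s (emb x) *\<^sub>R emb (orbit_jump \<R> l (orbit_flow \<R> s x)))"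
    by (simp only: jump_density_scaled[OF rap x s])
  finally show ?thesis
    by (simp add: bounded_bilinear.sum_left[OF vm_bilin] vm_simps inner_sum_left)
qed

text \<open>
  The recursion read on a single orbit and tested on a column of the dual cone. All terms are
  nonnegative, so that it can be integrated over the paths without regard to convergence.
\<close>

lemma step_row:
  assumes x: "x \<in> orbs \<R>" and r: "0 \<le> r" and F: "K.good F" and w: "w \<in> dual (emb ` orbs \<R>)"
  shows "ennreal ((emb x v* K.step F r) \<bullet> w) =
      (if isl x \<in> D then ennreal (((emb x v* mexp (r *\<^sub>R flow_gen \<R>)) \<bullet> 1) * (emb (orbit_flow \<R> r x) \<bullet> w)) else 0)
      + (\<integral>\<^sup>+s. indicator {0..} s * (indicator {s. isl x \<in> U \<or> isl x \<in> D \<and> s \<le> r} s *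
          ennreal ((emb x v* K.kern s v* F (if isl x \<in> U then r + s else r - s)) \<bullet> w)) \<partial>lborel)"
    (is "_ = ?first + ?int")
proof -
  have nF: "nice F" and pF: "\<And>r. 0 \<le> r \<Longrightarrow> mpos (emb ` orbs \<R>) (emb ` orbs \<R>) (F r)" using F by (auto simp: K.good_def)
  have pos: "0 \<le> (emb x v* K.kern s v* F t) \<bullet> w" if "0 \<le> s" "0 \<le> t" for s t
    using mposD[OF mpos_mult[OF K.kern_pos[OF that(1)] pF[OF that(2)]] w] x
    by (auto simp: dual_def vector_matrix_mul_assoc dot_lmul_matrix)
  have bl: "bounded_linear (\<lambda>X. (emb x v* X) \<bullet> w)"
    by (intro bounded_linear_compose[OF bounded_linear_inner_left] bounded_bilinear.bounded_linear_right[OF vm_bilin])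
  consider "isl x \<in> D" "isl x \<notin> U" | "isl x \<in> U" "isl x \<notin> D" | "isl x \<notin> D" "isl x \<notin> U" using UD by auto
  then show ?thesis
  proof cases
    case 1
    let ?I = "LBINT s:{0..r}. K.kern s ** F (r - s)"
    have i: "set_integrable lborel {0..r} (\<lambda>s. K.kern s ** F (r - s))" by (rule K.kern_nice_integrable(1)[OF nF])
    have "emb x v* K.step F r = emb x v* mexp (r *\<^sub>R flow_gen \<R>) + emb x v* ?I"
      using 1 by (simp add: K.step_def vm_simps vector_matrix_mul_assoc[symmetric] emb_side_proj)
    then have "(emb x v* K.step F r) \<bullet> w = (emb x v* mexp (r *\<^sub>R flow_gen \<R>)) \<bullet> w + (LBINT s:{0..r}. (emb x v* K.kern s v* F (r - s)) \<bullet> w)"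
      using set_integral_bounded_linear(1)[OF bl i] by (simp add: inner_add_left vector_matrix_mul_assoc)
    also have "(emb x v* mexp (r *\<^sub>R flow_gen \<R>)) \<bullet> w = ((emb x v* mexp (r *\<^sub>R flow_gen \<R>)) \<bullet> 1) * (emb (orbit_flow \<R> r x) \<bullet> w)"
      using arg_cong[OF flow_unnormalise[OF rap x r], of "\<lambda>v. v \<bullet> w"] by simp
    finally have e: "(emb x v* K.step F r) \<bullet> w = ((emb x v* mexp (r *\<^sub>R flow_gen \<R>)) \<bullet> 1) * (emb (orbit_flow \<R> r x) \<bullet> w) + (LBINT s:{0..r}. (emb x v* K.kern s v* F (r - s)) \<bullet> w)" .
    have "ennreal (LBINT s:{0..r}. (emb x v* K.kern s v* F (r - s)) \<bullet> w) = (\<integral>\<^sup>+s. indicator {0..r} s * ennreal ((emb x v* K.kern s v* F (r - s)) \<bullet> w) \<partial>lborel)"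
      using set_integral_bounded_linear(2)[OF bl i] by (intro nonneg_set_nn_integral[symmetric] pos) (auto simp: vector_matrix_mul_assoc)
    also have "\<dots> = ?int" using 1 by (intro nn_integral_cong) (auto simp: indicator_def)
    finally have "ennreal (LBINT s:{0..r}. (emb x v* K.kern s v* F (r - s)) \<bullet> w) = ?int" .
    moreover have "0 \<le> emb (orbit_flow \<R> r x) \<bullet> w" using w flow_orbs[OF rap x r] by (auto simp: dual_def)
    moreover have "0 \<le> (LBINT s:{0..r}. (emb x v* K.kern s v* F (r - s)) \<bullet> w)"
      unfolding set_lebesgue_integral_def by (rule Bochner_Integration.integral_nonneg) (use pos in \<open>auto simp: indicator_def\<close>)
    ultimately show ?thesis using 1 flow_mass_pos[OF rap x r] by (simp add: e ennreal_plus)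
  next
    case 2
    let ?I = "LBINT s:{0..}. K.kern s ** F (r + s)"
    have i: "set_integrable lborel {0..} (\<lambda>s. K.kern s ** F (r + s))" by (rule K.kern_nice_integrable(2)[OF nF r])
    have "emb x v* K.step F r = emb x v* ?I"
      using 2 by (simp add: K.step_def vm_simps vector_matrix_mul_assoc[symmetric] emb_side_proj)
    then have e: "(emb x v* K.step F r) \<bullet> w = (LBINT s:{0..}. (emb x v* K.kern s v* F (r + s)) \<bullet> w)"
      using set_integral_bounded_linear(1)[OF bl i] by (simp add: vector_matrix_mul_assoc)
    have "ennreal (LBINT s:{0..}. (emb x v* K.kern s v* F (r + s)) \<bullet> w) = (\<integral>\<^sup>+s. indicator {0..} s * ennreal ((emb x v* K.kern s v* F (r + s)) \<bullet> w) \<partial>lborel)"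
      using set_integral_bounded_linear(2)[OF bl i] r by (intro nonneg_set_nn_integral[symmetric] pos) (auto simp: vector_matrix_mul_assoc)
    also have "\<dots> = ?int" using 2 by (intro nn_integral_cong) (auto simp: indicator_def)
    finally show ?thesis using 2 e by simp
  next
    case 3
    have "emb x v* K.step F r = 0"
      using 3 by (simp add: K.step_def vm_simps vector_matrix_mul_assoc[symmetric] emb_side_proj)
    then show ?thesis using 3 by simp
  qed
qed

lemma approx_restr_measurable: "cutoff (K.approx N) \<in> borel_measurable borel"
  using K.approx_good[of N] by (simp add: K.good_def nice_def cutoff_def[abs_def])

definition moved :: "nat \<Rightarrow> 'w \<Rightarrow> real \<Rightarrow> real" where
  "moved n \<omega> s = (if isl (Y n \<omega>) \<in> U then R n \<omega> + s else R n \<omega> - s)"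

lemma moved_nonneg:
  "\<omega> \<in> space M \<Longrightarrow> alive n \<omega> \<Longrightarrow> 0 \<le> s \<Longrightarrow> isl (Y n \<omega>) \<in> U \<or> isl (Y n \<omega>) \<in> D \<and> s \<le> R n \<omega> \<Longrightarrow> 0 \<le> moved n \<omega> s"
  using R_nonneg[of \<omega> n] by (auto simp: moved_def)

text \<open>
  The expected reward \<open>w\<close> of the final orbit, given the first \<open>n\<close> jumps, from paths that exhaust the
  level after these jumps and with fewer than \<open>N\<close> further ones.
\<close>

definition payoff :: "nat \<Rightarrow> nat \<Rightarrow> real^('p + 'm) \<Rightarrow> 'w \<Rightarrow> ennreal" where
  "payoff N n w \<omega> = indicator {\<omega>. alive n \<omega>} \<omega> * ennreal ((emb (Y n \<omega>) v* K.approx N (R n \<omega>)) \<bullet> w)"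

text \<open>
  \<open>payoff N (Suc n) w\<close> as a function of the history up to the \<open>n\<close>-th jump and of the next holding time
  and kind. The maximum with 0 keeps the flow time nonnegative on the whole product space.
\<close>

definition next_payoff :: "nat \<Rightarrow> nat \<Rightarrow> real^('p + 'm) \<Rightarrow> ('i + 'j) \<times> ('i + 'j) \<Rightarrow> 'w \<times> real \<Rightarrow> ennreal" where
  "next_payoff N n w l p = indicator {p. alive n (fst p) \<and> (isl (Y n (fst p)) \<in> U \<or> isl (Y n (fst p)) \<in> D \<and> snd p \<le> R n (fst p))} p *
     ennreal ((emb (orbit_jump \<R> l (orbit_flow \<R> (max 0 (snd p)) (Y n (fst p)))) v* cutoff (K.approx N) (moved n (fst p) (snd p))) \<bullet> w)"

lemma next_payoff_measurable: "next_payoff N n w l \<in> borel_measurable (Hist n \<Otimes>\<^sub>M borel)"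
proof -
  let ?P = "Hist n \<Otimes>\<^sub>M (borel :: real measure)"
  have m [measurable]: "(\<lambda>p. emb (Y n (fst p))) \<in> borel_measurable ?P" "(\<lambda>p. isl (Y n (fst p))) \<in> measurable ?P (count_space UNIV)"
    "(\<lambda>p. R n (fst p)) \<in> borel_measurable ?P" "Measurable.pred ?P (\<lambda>p. alive n (fst p))"
    using measurable_compose[OF measurable_fst Y_history(1)[of n n]] measurable_compose[OF measurable_fst Y_history(2)[of n n]]
      measurable_compose[OF measurable_fst R_history[of n n]] measurable_compose[OF measurable_fst alive_history[of n]] by auto
  have n1 [measurable]: "(\<lambda>p. emb (orbit_jump \<R> l (orbit_flow \<R> (max 0 (snd p)) (Y n (fst p))))) \<in> borel_measurable ?P"
  proof (rule next_measurable(1)[OF m(1,2)])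
    show "(\<lambda>p. max 0 (snd p)) \<in> borel_measurable ?P" by measurable
  qed simp
  have "(\<lambda>p. moved n (fst p) (snd p)) \<in> borel_measurable ?P" unfolding moved_def by measurable
  then have n2 [measurable]: "(\<lambda>p. cutoff (K.approx N) (moved n (fst p) (snd p))) \<in> borel_measurable ?P"
    by (rule measurable_compose[OF _ approx_restr_measurable])
  have "(\<lambda>q. fst q v* (snd q :: real^('p + 'm)^('p + 'm))) \<in> borel_measurable borel"
    by (intro borel_measurable_continuous_onI bounded_bilinear.continuous_on[OF vm_bilin] continuous_intros)
  from measurable_compose[OF borel_measurable_Pair[OF n1 n2] this]
  have [measurable]: "(\<lambda>p. emb (orbit_jump \<R> l (orbit_flow \<R> (max 0 (snd p)) (Y n (fst p)))) v* cutoff (K.approx N) (moved n (fst p) (snd p))) \<in> borel_measurable ?P"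
    by simp
  show ?thesis unfolding next_payoff_def indicator_def of_bool_def mem_Collect_eq by measurable
qed

lemma payoff_Suc:
  assumes \<omega>: "\<omega> \<in> space M"
  shows "payoff N (Suc n) w \<omega> = (\<Sum>l\<in>UNIV. indicator {\<omega>. J n \<omega> < \<infinity> \<and> S n \<omega> < \<infinity> \<and> L n \<omega> = l} \<omega> * next_payoff N n w l (\<omega>, T n \<omega>))"
proof -
  have "(\<Sum>l\<in>UNIV. indicator {\<omega>. J n \<omega> < \<infinity> \<and> S n \<omega> < \<infinity> \<and> L n \<omega> = l} \<omega> * next_payoff N n w l (\<omega>, T n \<omega>))
      = (\<Sum>l\<in>UNIV. if l = L n \<omega> then indicator {\<omega>. J n \<omega> < \<infinity> \<and> S n \<omega> < \<infinity>} \<omega> * next_payoff N n w l (\<omega>, T n \<omega>) else 0)"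
    by (intro sum.cong) (auto simp: indicator_def)
  also have "\<dots> = indicator {\<omega>. J n \<omega> < \<infinity> \<and> S n \<omega> < \<infinity>} \<omega> * next_payoff N n w (L n \<omega>) (\<omega>, T n \<omega>)" by simp
  also have "\<dots> = payoff N (Suc n) w \<omega>"
  proof (cases "alive (Suc n) \<omega>")
    case True
    then have a: "alive n \<omega>" "S n \<omega> < \<infinity>" "stays n \<omega>" using alive_Suc[OF \<omega>] by auto
    have "R (Suc n) \<omega> = moved n \<omega> (T n \<omega>)" by (simp add: moved_def)
    then have "cutoff (K.approx N) (moved n \<omega> (T n \<omega>)) = K.approx N (R (Suc n) \<omega>)"
      using R_nonneg[OF \<omega> True] unfolding cutoff_def by simp
    moreover have "max 0 (T n \<omega>) = T n \<omega>" using T_nonneg[OF \<omega>] by simp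
    moreover have "J n \<omega> < \<infinity>" using a(1) by (simp add: alive_def)
    ultimately show ?thesis using a True
      by (simp add: payoff_def next_payoff_def stays_def del: R.simps)
  next
    case False
    then show ?thesis using alive_Suc[OF \<omega>, of n]
      by (auto simp: payoff_def next_payoff_def stays_def indicator_def del: R.simps)
  qed
  finally show ?thesis ..
qed

text \<open>The part of \<open>payoff (Suc N) n w\<close> that is due to a further jump.\<close>

definition cont_payoff :: "nat \<Rightarrow> nat \<Rightarrow> real^('p + 'm) \<Rightarrow> 'w \<Rightarrow> ennreal" where
  "cont_payoff N n w \<omega> = (\<integral>\<^sup>+s. indicator {0..} s * (indicator {s. isl (Y n \<omega>) \<in> U \<or> isl (Y n \<omega>) \<in> D \<and> s \<le> R n \<omega>} s *
          ennreal ((emb (Y n \<omega>) v* K.kern s v* K.approx N (moved n \<omega> s)) \<bullet> w)) \<partial>lborel)"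

lemma continuing_part:
  assumes w: "w \<in> dual (emb ` orbs \<R>)"
  shows "(\<integral>\<^sup>+\<omega>. payoff N (Suc n) w \<omega> \<partial>M) = (\<integral>\<^sup>+\<omega>. indicator {\<omega>. alive n \<omega>} \<omega> * cont_payoff N n w \<omega> \<partial>M)"
    and "(\<lambda>\<omega>. indicator {\<omega>. alive n \<omega>} \<omega> * cont_payoff N n w \<omega>) \<in> borel_measurable M"
proof -
  define I where "I = cont_payoff N n w"
  note I_def' = cont_payoff_def[of N n w, folded I_def]
  have [measurable]: "Measurable.pred M (alive n)" "(\<lambda>\<omega>. isl (Y n \<omega>)) \<in> measurable M (count_space UNIV)"
      "R n \<in> borel_measurable M" "S n \<in> borel_measurable M" "J n \<in> borel_measurable M"
      "L n \<in> measurable M (count_space UNIV)"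
    using from_history[OF alive_history] from_history[OF Y_history(2)[of n n]]
      from_history[OF R_history[of n n]] S_meas from_history[OF J_history] L_meas by auto
  let ?G = "\<lambda>l \<omega>. \<integral>\<^sup>+s. indicator {0..} s * ennreal (jd l s (emb (Y n \<omega>))) * next_payoff N n w l (\<omega>, s) \<partial>lborel"
  have npm: "(\<lambda>s. next_payoff N n w l (\<omega>, s)) \<in> borel_measurable lborel" if "\<omega> \<in> space M" for l \<omega>
    using measurable_compose[OF measurable_Pair1'[of \<omega> "Hist n" borel] next_payoff_measurable] that by simp
  have Gm: "(\<lambda>\<omega>. indicator {\<omega>. J n \<omega> < \<infinity>} \<omega> * ?G l \<omega>) \<in> borel_measurable M" for l
  proof -
    have "(\<lambda>p. indicator {0..} (snd p) * ennreal (jd l (snd p) (emb (Y n (fst p)))) * next_payoff N n w l p) \<in> borel_measurable (Hist n \<Otimes>\<^sub>M borel)"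
    proof -
      have [measurable]: "(\<lambda>p. jd l (snd p) (emb (Y n (fst p)))) \<in> borel_measurable (Hist n \<Otimes>\<^sub>M borel)"
        by (intro jd_measurable measurable_snd measurable_compose[OF measurable_fst Y_history(1)]) simp
      note next_payoff_measurable[measurable]
      show ?thesis by measurable
    qed
    then have "(\<lambda>p. indicator {0..} (snd p) * ennreal (jd l (snd p) (emb (Y n (fst p)))) * next_payoff N n w l p) \<in> borel_measurable (Hist n \<Otimes>\<^sub>M lborel)"
      by (subst measurable_cong_sets[OF sets_pair_measure_cong[OF refl sets_lborel] refl])
    from lborel.borel_measurable_nn_integral_fst[OF this] have "?G l \<in> borel_measurable (Hist n)" by simp
    from from_history[OF this] show ?thesis by measurable
  qed
  have pointwise: "(\<Sum>l\<in>UNIV. indicator {\<omega>. J n \<omega> < \<infinity>} \<omega> * ?G l \<omega>) = indicator {\<omega>. alive n \<omega>} \<omega> * I \<omega>"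
    if \<omega>: "\<omega> \<in> space M" for \<omega>
  proof -
    have jm: "(\<lambda>s. jd l s (emb (Y n \<omega>))) \<in> borel_measurable lborel" for l by (intro jd_measurable) auto
    have "(\<Sum>l\<in>UNIV. ?G l \<omega>) = (\<integral>\<^sup>+s. (\<Sum>l\<in>UNIV. indicator {0..} s * ennreal (jd l s (emb (Y n \<omega>))) * next_payoff N n w l (\<omega>, s)) \<partial>lborel)"
    proof (rule nn_integral_sum[symmetric])
      fix l note npm[OF \<omega>, of l, measurable] and jm[of l, measurable]
      show "(\<lambda>s. indicator {0..} s * ennreal (jd l s (emb (Y n \<omega>))) * next_payoff N n w l (\<omega>, s)) \<in> borel_measurable lborel"
        by measurable
    qed
    moreover have "(\<integral>\<^sup>+s. (\<Sum>l\<in>UNIV. indicator {0..} s * ennreal (jd l s (emb (Y n \<omega>))) * next_payoff N n w l (\<omega>, s)) \<partial>lborel) = I \<omega>"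
      if a: "alive n \<omega>"
      unfolding I_def'
    proof (rule nn_integral_cong)
      fix s :: real
      let ?c = "isl (Y n \<omega>) \<in> U \<or> isl (Y n \<omega>) \<in> D \<and> s \<le> R n \<omega>"
      show "(\<Sum>l\<in>UNIV. indicator {0..} s * ennreal (jd l s (emb (Y n \<omega>))) * next_payoff N n w l (\<omega>, s))
        = indicator {0..} s * (indicator {s. isl (Y n \<omega>) \<in> U \<or> isl (Y n \<omega>) \<in> D \<and> s \<le> R n \<omega>} s *
          ennreal ((emb (Y n \<omega>) v* K.kern s v* K.approx N (moved n \<omega> s)) \<bullet> w))"
      proof (cases "0 \<le> s \<and> ?c")
        case True
        then have s: "0 \<le> s" and mv: "0 \<le> moved n \<omega> s" using moved_nonneg[OF \<omega> a] by auto
        let ?F = "K.approx N (moved n \<omega> s)" and ?z = "\<lambda>l. emb (orbit_jump \<R> l (orbit_flow \<R> s (Y n \<omega>)))"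
        have "mpos (emb ` orbs \<R>) (emb ` orbs \<R>) ?F" using K.approx_good[of N] mv by (simp add: K.good_def)
        then have Fw: "?F *v w \<in> dual (emb ` orbs \<R>)" using w by (rule mposD)
        have nn: "0 \<le> jd l s (emb (Y n \<omega>)) * ((?z l v* ?F) \<bullet> w)" for l
        proof -
          have "mpos (emb ` orbs \<R>) (emb ` orbs \<R>) (mexp (s *\<^sub>R flow_gen \<R>) ** jump_mat \<R> l)"
            by (intro mpos_mult[OF flow_pos[OF rap s] jump_mat_pos[OF rap]])
          from mposD[OF this Fw] alive_orbs[OF \<omega> a]
          have "0 \<le> emb (Y n \<omega>) \<bullet> ((mexp (s *\<^sub>R flow_gen \<R>) ** jump_mat \<R> l) *v (?F *v w))" by (auto simp: dual_def)
          also have "\<dots> = (emb (Y n \<omega>) v* mexp (s *\<^sub>R flow_gen \<R>) v* jump_mat \<R> l) \<bullet> (?F *v w)"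
            by (simp add: dot_lmul_matrix[symmetric] vector_matrix_mul_assoc)
          also have "\<dots> = jd l s (emb (Y n \<omega>)) * ((?z l v* ?F) \<bullet> w)"
            by (simp add: jump_density_scaled[OF rap alive_orbs[OF \<omega> a] s, symmetric] dot_lmul_matrix)
          finally show ?thesis .
        qed
        have "max 0 s = s" using s by simp
        then have "next_payoff N n w l (\<omega>, s) = ennreal ((?z l v* ?F) \<bullet> w)" for l
          using True a mv by (simp add: next_payoff_def cutoff_def)
        then have "(\<Sum>l\<in>UNIV. indicator {0..} s * ennreal (jd l s (emb (Y n \<omega>))) * next_payoff N n w l (\<omega>, s))
            = (\<Sum>l\<in>UNIV. ennreal (jd l s (emb (Y n \<omega>)) * ((?z l v* ?F) \<bullet> w)))"
          using s jump_density_nonneg[OF rap alive_orbs[OF \<omega> a] s] by (simp add: ennreal_mult')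
        also have "\<dots> = ennreal (\<Sum>l\<in>UNIV. jd l s (emb (Y n \<omega>)) * ((?z l v* ?F) \<bullet> w))"
          by (rule sum_ennreal) (rule nn)
        also have "\<dots> = ennreal ((emb (Y n \<omega>) v* K.kern s v* ?F) \<bullet> w)"
          by (simp only: kern_row[OF alive_orbs[OF \<omega> a] s])
        finally show ?thesis using True by simp
      next
        case False
        then show ?thesis by (auto simp: next_payoff_def indicator_def)
      qed
    qed
    moreover have "?G l \<omega> = 0" if "\<not> alive n \<omega>" for l
      using that by (simp add: next_payoff_def)
    ultimately show ?thesis
      by (cases "alive n \<omega>") (auto simp: sum_distrib_left[symmetric] alive_def indicator_def)
  qed
  have "(\<integral>\<^sup>+\<omega>. payoff N (Suc n) w \<omega> \<partial>M) = (\<integral>\<^sup>+\<omega>. (\<Sum>l\<in>UNIV. indicator {\<omega>. J n \<omega> < \<infinity> \<and> S n \<omega> < \<infinity> \<and> L n \<omega> = l} \<omega> * next_payoff N n w l (\<omega>, T n \<omega>)) \<partial>M)"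
    by (intro nn_integral_cong payoff_Suc)
  also have "\<dots> = (\<Sum>l\<in>UNIV. (\<integral>\<^sup>+\<omega>. indicator {\<omega>. J n \<omega> < \<infinity> \<and> S n \<omega> < \<infinity> \<and> L n \<omega> = l} \<omega> * next_payoff N n w l (\<omega>, T n \<omega>) \<partial>M))"
  proof (rule nn_integral_sum)
    fix l
    have "(\<lambda>\<omega>. (\<omega>, T n \<omega>)) \<in> measurable M (Hist n \<Otimes>\<^sub>M borel)"
      using S_meas[of n] by (intro measurable_Pair[OF from_history[of _ n]]) (simp, measurable)
    from measurable_compose[OF this next_payoff_measurable]
    have [measurable]: "(\<lambda>\<omega>. next_payoff N n w l (\<omega>, T n \<omega>)) \<in> borel_measurable M" .
    show "(\<lambda>\<omega>. indicator {\<omega>. J n \<omega> < \<infinity> \<and> S n \<omega> < \<infinity> \<and> L n \<omega> = l} \<omega> * next_payoff N n w l (\<omega>, T n \<omega>)) \<in> borel_measurable M"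
      unfolding indicator_def of_bool_def mem_Collect_eq by measurable
  qed
  also have "\<dots> = (\<Sum>l\<in>UNIV. (\<integral>\<^sup>+\<omega>. indicator {\<omega>. J n \<omega> < \<infinity>} \<omega> * ?G l \<omega> \<partial>M))"
    by (intro sum.cong refl holding_nn next_payoff_measurable)
  also have "\<dots> = (\<integral>\<^sup>+\<omega>. (\<Sum>l\<in>UNIV. indicator {\<omega>. J n \<omega> < \<infinity>} \<omega> * ?G l \<omega>) \<partial>M)"
    by (rule nn_integral_sum[symmetric]) (rule Gm)
  also have "\<dots> = (\<integral>\<^sup>+\<omega>. indicator {\<omega>. alive n \<omega>} \<omega> * I \<omega> \<partial>M)"
    by (intro nn_integral_cong pointwise)
  finally show "(\<integral>\<^sup>+\<omega>. payoff N (Suc n) w \<omega> \<partial>M) = (\<integral>\<^sup>+\<omega>. indicator {\<omega>. alive n \<omega>} \<omega> * cont_payoff N n w \<omega> \<partial>M)"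
    by (simp add: I_def)
  have "(\<lambda>\<omega>. \<Sum>l\<in>UNIV. indicator {\<omega>. J n \<omega> < \<infinity>} \<omega> * ?G l \<omega>) \<in> borel_measurable M"
    using Gm by measurable
  then have "(\<lambda>\<omega>. indicator {\<omega>. alive n \<omega>} \<omega> * I \<omega>) \<in> borel_measurable M"
    by (rule measurable_cong[THEN iffD1, rotated]) (rule pointwise)
  then show "(\<lambda>\<omega>. indicator {\<omega>. alive n \<omega>} \<omega> * cont_payoff N n w \<omega>) \<in> borel_measurable M"
    by (simp add: I_def)
qed

text \<open>One step of the backward recursion: either the level runs out before the next jump or it does not.\<close>

lemma payoff_step:
  assumes w: "w \<in> dual (emb ` orbs \<R>)"
  shows "(\<integral>\<^sup>+\<omega>. payoff (Suc N) n w \<omega> \<partial>M) =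
    (\<integral>\<^sup>+\<omega>. indicator {\<omega>. hit n \<omega>} \<omega> * ennreal (exit n \<omega> \<bullet> w) \<partial>M) + (\<integral>\<^sup>+\<omega>. payoff N (Suc n) w \<omega> \<partial>M)"
proof -
  let ?mass = "\<lambda>\<omega>. (emb (Y n \<omega>) v* mexp (R n \<omega> *\<^sub>R flow_gen \<R>)) \<bullet> 1"
  define c where "c \<omega> = (if alive n \<omega> \<and> isl (Y n \<omega>) \<in> D then ennreal (exit n \<omega> \<bullet> w) else 0)" for \<omega>
  define I where "I = cont_payoff N n w"
  note I_def' = cont_payoff_def[of N n w, folded I_def]
  have [measurable]: "Measurable.pred M (alive n)" "(\<lambda>\<omega>. isl (Y n \<omega>)) \<in> measurable M (count_space UNIV)"
      "exit n \<in> borel_measurable M" "R n \<in> borel_measurable M" "S n \<in> borel_measurable M" "J n \<in> borel_measurable M"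
      "L n \<in> measurable M (count_space UNIV)"
    using from_history[OF alive_history] from_history[OF Y_history(2)[of n n]] from_history[OF exit_history]
      from_history[OF R_history[of n n]] S_meas from_history[OF J_history] L_meas by auto
  have [measurable]: "?mass \<in> borel_measurable M"
    using from_history[OF flow_measurable[OF R_history[of n n] Y_history(1)[of n n]]] by simp
  have cm [measurable]: "c \<in> borel_measurable M" unfolding c_def[abs_def] by measurable
  have exit_dual: "0 \<le> exit n \<omega> \<bullet> w" if "\<omega> \<in> space M" "alive n \<omega>" for \<omega>
    using w flow_orbs[OF rap alive_orbs[OF that] R_nonneg[OF that]] exit_eq[OF R_nonneg[OF that]] by (auto simp: dual_def)
  note next_part = continuing_part(1)[OF w, of N n, folded I_def] and Im = continuing_part(2)[OF w, of n N, folded I_def]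
  \<comment> \<open>the holding time exceeds the level with probability equal to the remaining mass\<close>
  have mass1: "0 \<le> ?mass \<omega>" "?mass \<omega> \<le> 1"
    "(\<Sum>l\<in>UNIV. (\<integral>\<^sup>+s. indicator {0..R n \<omega>} s * ennreal (jd l s (emb (Y n \<omega>))) \<partial>lborel)) = ennreal (1 - ?mass \<omega>)"
    if \<omega>: "\<omega> \<in> space M" and a: "alive n \<omega>" for \<omega>
  proof -
    note x = alive_orbs[OF \<omega> a] and r = R_nonneg[OF \<omega> a]
    show "0 \<le> ?mass \<omega>" using flow_mass_pos[OF rap x r] by simp
    have jn: "0 \<le> jd l s (emb (Y n \<omega>))" if "0 \<le> s" for l s using jump_density_nonneg[OF rap x that] .
    have "(\<Sum>l\<in>UNIV. (\<integral>\<^sup>+s. indicator {0..R n \<omega>} s * ennreal (jd l s (emb (Y n \<omega>))) \<partial>lborel))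
        = (\<Sum>l\<in>UNIV. ennreal (LBINT s:{0..R n \<omega>}. jd l s (emb (Y n \<omega>))))"
      by (intro sum.cong refl nonneg_set_nn_integral jd_integrable jn) auto
    also have "\<dots> = ennreal (\<Sum>l\<in>UNIV. (LBINT s:{0..R n \<omega>}. jd l s (emb (Y n \<omega>))))"
      by (intro sum_ennreal) (auto simp: set_lebesgue_integral_def indicator_def jn intro!: Bochner_Integration.integral_nonneg)
    also have "(\<Sum>l\<in>UNIV. (LBINT s:{0..R n \<omega>}. jd l s (emb (Y n \<omega>)))) = (LBINT s:{0..R n \<omega>}. (\<Sum>l\<in>UNIV. jd l s (emb (Y n \<omega>))))"
      using jd_integrable unfolding set_lebesgue_integral_def set_integrable_def scaleR_sum_right
      by (intro Bochner_Integration.integral_sum[symmetric]) auto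
    also have e: "\<dots> = 1 - ?mass \<omega>"
      using integral_sum_jump_density[OF rap r, of "emb (Y n \<omega>)"] by (simp add: emb_mass[OF rap x])
    finally show "(\<Sum>l\<in>UNIV. (\<integral>\<^sup>+s. indicator {0..R n \<omega>} s * ennreal (jd l s (emb (Y n \<omega>))) \<partial>lborel)) = ennreal (1 - ?mass \<omega>)" .
    have "0 \<le> (LBINT s:{0..R n \<omega>}. (\<Sum>l\<in>UNIV. jd l s (emb (Y n \<omega>))))"
      unfolding set_lebesgue_integral_def by (rule Bochner_Integration.integral_nonneg) (auto simp: indicator_def jn intro!: sum_nonneg)
    then show "?mass \<omega> \<le> 1" using e by simp
  qed
  have c_hist: "c \<in> borel_measurable (Hist n)"
  proof -
    note alive_history[of n, measurable] and Y_history(2)[of n n, OF order_refl, measurable] and exit_history[of n, measurable]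
    show ?thesis unfolding c_def[abs_def] by measurable
  qed
  \<comment> \<open>the complement of a hit, computed from the density of the holding time\<close>
  have below: "(\<integral>\<^sup>+\<omega>. c \<omega> * indicator {\<omega>. S n \<omega> \<le> ereal (R n \<omega>)} \<omega> \<partial>M) = (\<integral>\<^sup>+\<omega>. c \<omega> * ennreal (1 - ?mass \<omega>) \<partial>M)"
  proof -
    let ?g = "\<lambda>p. c (fst p) * indicator {p. snd p \<le> R n (fst p)} p"
    have g: "?g \<in> borel_measurable (Hist n \<Otimes>\<^sub>M borel)"
    proof -
      have [measurable]: "(\<lambda>p. R n (fst p)) \<in> borel_measurable (Hist n \<Otimes>\<^sub>M (borel :: real measure))"
        "(\<lambda>p. c (fst p)) \<in> borel_measurable (Hist n \<Otimes>\<^sub>M (borel :: real measure))"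
        using measurable_compose[OF measurable_fst R_history[of n n]] measurable_compose[OF measurable_fst c_hist] by auto
      show ?thesis unfolding indicator_def of_bool_def mem_Collect_eq by measurable
    qed
    let ?G = "\<lambda>l \<omega>. \<integral>\<^sup>+s. indicator {0..} s * ennreal (jd l s (emb (Y n \<omega>))) * ?g (\<omega>, s) \<partial>lborel"
    have G: "indicator {\<omega>. J n \<omega> < \<infinity>} \<omega> * ?G l \<omega> = c \<omega> * (\<integral>\<^sup>+s. indicator {0..R n \<omega>} s * ennreal (jd l s (emb (Y n \<omega>))) \<partial>lborel)" for l \<omega>
    proof -
      have "(\<lambda>s. jd l s (emb (Y n \<omega>))) \<in> borel_measurable lborel" by (intro jd_measurable) auto
      then have "(\<lambda>s. indicator {0..R n \<omega>} s * ennreal (jd l s (emb (Y n \<omega>)))) \<in> borel_measurable lborel" by measurable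
      from nn_integral_cmult[OF this, of "c \<omega>"]
      have "c \<omega> * (\<integral>\<^sup>+s. indicator {0..R n \<omega>} s * ennreal (jd l s (emb (Y n \<omega>))) \<partial>lborel) = (\<integral>\<^sup>+s. c \<omega> * (indicator {0..R n \<omega>} s * ennreal (jd l s (emb (Y n \<omega>)))) \<partial>lborel)" ..
      also have "\<dots> = ?G l \<omega>" by (intro nn_integral_cong) (auto simp: indicator_def mult_ac)
      finally show ?thesis by (auto simp: indicator_def c_def alive_def)
    qed
    have "(\<integral>\<^sup>+\<omega>. c \<omega> * indicator {\<omega>. S n \<omega> \<le> ereal (R n \<omega>)} \<omega> \<partial>M)
       = (\<integral>\<^sup>+\<omega>. (\<Sum>l\<in>UNIV. indicator {\<omega>. J n \<omega> < \<infinity> \<and> S n \<omega> < \<infinity> \<and> L n \<omega> = l} \<omega> * ?g (\<omega>, T n \<omega>)) \<partial>M)"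
    proof (rule nn_integral_cong)
      fix \<omega> assume \<omega>: "\<omega> \<in> space M"
      have "(\<Sum>l\<in>UNIV. indicator {\<omega>. J n \<omega> < \<infinity> \<and> S n \<omega> < \<infinity> \<and> L n \<omega> = l} \<omega> * ?g (\<omega>, T n \<omega>))
        = (\<Sum>l\<in>UNIV. if l = L n \<omega> then indicator {\<omega>. J n \<omega> < \<infinity> \<and> S n \<omega> < \<infinity>} \<omega> * ?g (\<omega>, T n \<omega>) else 0)"
        by (intro sum.cong) (auto simp: indicator_def)
      also have "\<dots> = indicator {\<omega>. J n \<omega> < \<infinity> \<and> S n \<omega> < \<infinity>} \<omega> * ?g (\<omega>, T n \<omega>)" by simp
      also have "\<dots> = c \<omega> * indicator {\<omega>. S n \<omega> \<le> ereal (R n \<omega>)} \<omega>"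
      proof (cases "S n \<omega> < \<infinity>")
        case True
        then have "S n \<omega> = ereal (T n \<omega>)" using S_real[OF \<omega>] by blast
        then have "S n \<omega> \<le> ereal (R n \<omega>) \<longleftrightarrow> T n \<omega> \<le> R n \<omega>" by (metis ereal_less_eq(3))
        then show ?thesis using True by (auto simp: indicator_def c_def alive_def)
      next
        case False
        then show ?thesis by (auto simp: indicator_def)
      qed
      finally show "c \<omega> * indicator {\<omega>. S n \<omega> \<le> ereal (R n \<omega>)} \<omega> = (\<Sum>l\<in>UNIV. indicator {\<omega>. J n \<omega> < \<infinity> \<and> S n \<omega> < \<infinity> \<and> L n \<omega> = l} \<omega> * ?g (\<omega>, T n \<omega>))" ..
    qed
    also have "\<dots> = (\<Sum>l\<in>UNIV. (\<integral>\<^sup>+\<omega>. indicator {\<omega>. J n \<omega> < \<infinity> \<and> S n \<omega> < \<infinity> \<and> L n \<omega> = l} \<omega> * ?g (\<omega>, T n \<omega>) \<partial>M))"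
    proof (rule nn_integral_sum)
      fix l
      show "(\<lambda>\<omega>. indicator {\<omega>. J n \<omega> < \<infinity> \<and> S n \<omega> < \<infinity> \<and> L n \<omega> = l} \<omega> * ?g (\<omega>, T n \<omega>)) \<in> borel_measurable M"
        unfolding indicator_def of_bool_def mem_Collect_eq fst_conv snd_conv by measurable
    qed
    also have "\<dots> = (\<Sum>l\<in>UNIV. (\<integral>\<^sup>+\<omega>. c \<omega> * (\<integral>\<^sup>+s. indicator {0..R n \<omega>} s * ennreal (jd l s (emb (Y n \<omega>))) \<partial>lborel) \<partial>M))"
      unfolding holding_nn[OF g] G ..
    also have "\<dots> = (\<integral>\<^sup>+\<omega>. (\<Sum>l\<in>UNIV. c \<omega> * (\<integral>\<^sup>+s. indicator {0..R n \<omega>} s * ennreal (jd l s (emb (Y n \<omega>))) \<partial>lborel)) \<partial>M)"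
    proof (rule nn_integral_sum[symmetric])
      fix l
      have "(\<lambda>p. indicator {0..} (snd p) * ennreal (jd l (snd p) (emb (Y n (fst p)))) * ?g p) \<in> borel_measurable (Hist n \<Otimes>\<^sub>M borel)"
      proof -
        have [measurable]: "(\<lambda>p. jd l (snd p) (emb (Y n (fst p)))) \<in> borel_measurable (Hist n \<Otimes>\<^sub>M borel)"
          by (intro jd_measurable measurable_snd measurable_compose[OF measurable_fst Y_history(1)]) simp
        note g[measurable]
        show ?thesis by measurable
      qed
      then have "(\<lambda>p. indicator {0..} (snd p) * ennreal (jd l (snd p) (emb (Y n (fst p)))) * ?g p) \<in> borel_measurable (Hist n \<Otimes>\<^sub>M lborel)"
        by (subst measurable_cong_sets[OF sets_pair_measure_cong[OF refl sets_lborel] refl])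
      from lborel.borel_measurable_nn_integral_fst[OF this] have "?G l \<in> borel_measurable (Hist n)" by simp
      from from_history[OF this] have "(\<lambda>\<omega>. indicator {\<omega>. J n \<omega> < \<infinity>} \<omega> * ?G l \<omega>) \<in> borel_measurable M" by measurable
      then show "(\<lambda>\<omega>. c \<omega> * (\<integral>\<^sup>+s. indicator {0..R n \<omega>} s * ennreal (jd l s (emb (Y n \<omega>))) \<partial>lborel)) \<in> borel_measurable M"
        unfolding G .
    qed
    also have "\<dots> = (\<integral>\<^sup>+\<omega>. c \<omega> * ennreal (1 - ?mass \<omega>) \<partial>M)"
    proof (rule nn_integral_cong)
      fix \<omega> assume \<omega>: "\<omega> \<in> space M"
      show "(\<Sum>l\<in>UNIV. c \<omega> * (\<integral>\<^sup>+s. indicator {0..R n \<omega>} s * ennreal (jd l s (emb (Y n \<omega>))) \<partial>lborel)) = c \<omega> * ennreal (1 - ?mass \<omega>)"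
        using mass1(3)[OF \<omega>] by (cases "alive n \<omega>") (simp_all add: sum_distrib_left[symmetric] c_def)
    qed
    finally show ?thesis .
  qed
  \<comment> \<open>subtraction of \<open>below\<close> from the integral of \<open>c\<close>; this needs that \<open>below\<close> is finite\<close>
  have hit_part: "(\<integral>\<^sup>+\<omega>. indicator {\<omega>. hit n \<omega>} \<omega> * ennreal (exit n \<omega> \<bullet> w) \<partial>M) = (\<integral>\<^sup>+\<omega>. c \<omega> * ennreal (?mass \<omega>) \<partial>M)"
  proof -
    obtain B where B: "\<And>z. z \<in> emb ` orbs \<R> \<Longrightarrow> norm z \<le> B"
      using mass_base_orbs[OF rap] by (auto simp: mass_base_def bounded_iff)
    have cB: "c \<omega> \<le> ennreal (B * norm w)" if \<omega>: "\<omega> \<in> space M" for \<omega>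
    proof (cases "alive n \<omega>")
      case True
      have "norm (exit n \<omega>) \<le> B"
        using exit_eq[OF R_nonneg[OF \<omega> True]] flow_orbs[OF rap alive_orbs[OF \<omega> True] R_nonneg[OF \<omega> True]] by (simp add: B)
      then have "exit n \<omega> \<bullet> w \<le> B * norm w"
        using norm_cauchy_schwarz[of "exit n \<omega>" w] mult_right_mono[of "norm (exit n \<omega>)" B "norm w"] by simp
      then show ?thesis by (simp add: c_def ennreal_leI)
    qed (simp add: c_def)
    have "(\<integral>\<^sup>+\<omega>. c \<omega> * ennreal (1 - ?mass \<omega>) \<partial>M) \<le> (\<integral>\<^sup>+\<omega>. ennreal (B * norm w) \<partial>M)"
    proof (rule nn_integral_mono)
      fix \<omega> assume \<omega>: "\<omega> \<in> space M"
      show "c \<omega> * ennreal (1 - ?mass \<omega>) \<le> ennreal (B * norm w)"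
      proof (cases "alive n \<omega>")
        case True
        then have "ennreal (1 - ?mass \<omega>) \<le> 1" using mass1(1)[OF \<omega>] by (simp add: ennreal_le_1)
        then have "c \<omega> * ennreal (1 - ?mass \<omega>) \<le> c \<omega> * 1" by (intro mult_left_mono) auto
        then show ?thesis using cB[OF \<omega>] by simp
      qed (simp add: c_def)
    qed
    also have "\<dots> < \<infinity>" by (simp add: emeasure_space_1 ennreal_mult_less_top)
    finally have fin: "(\<integral>\<^sup>+\<omega>. c \<omega> * ennreal (1 - ?mass \<omega>) \<partial>M) \<noteq> \<infinity>" by simp
    have "(\<integral>\<^sup>+\<omega>. c \<omega> * indicator {\<omega>. S n \<omega> \<le> ereal (R n \<omega>)} \<omega> \<partial>M) + (\<integral>\<^sup>+\<omega>. indicator {\<omega>. hit n \<omega>} \<omega> * ennreal (exit n \<omega> \<bullet> w) \<partial>M)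
        = (\<integral>\<^sup>+\<omega>. c \<omega> * indicator {\<omega>. S n \<omega> \<le> ereal (R n \<omega>)} \<omega> + indicator {\<omega>. hit n \<omega>} \<omega> * ennreal (exit n \<omega> \<bullet> w) \<partial>M)"
      by (rule nn_integral_add[symmetric]) (unfold hit_def indicator_def of_bool_def mem_Collect_eq, measurable)
    also have "\<dots> = (\<integral>\<^sup>+\<omega>. c \<omega> * ennreal (1 - ?mass \<omega>) + c \<omega> * ennreal (?mass \<omega>) \<partial>M)"
    proof (rule nn_integral_cong)
      fix \<omega> assume \<omega>: "\<omega> \<in> space M"
      have "c \<omega> * indicator {\<omega>. S n \<omega> \<le> ereal (R n \<omega>)} \<omega> + indicator {\<omega>. hit n \<omega>} \<omega> * ennreal (exit n \<omega> \<bullet> w) = c \<omega>"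
        by (auto simp: c_def hit_def indicator_def)
      moreover have "c \<omega> * ennreal (1 - ?mass \<omega>) + c \<omega> * ennreal (?mass \<omega>) = c \<omega>"
      proof (cases "alive n \<omega>")
        case True
        have "ennreal (1 - ?mass \<omega>) + ennreal (?mass \<omega>) = 1"
          using mass1(1,2)[OF \<omega> True] by (simp flip: ennreal_plus)
        then show ?thesis by (simp add: distrib_left[symmetric])
      qed (simp add: c_def)
      ultimately show "c \<omega> * indicator {\<omega>. S n \<omega> \<le> ereal (R n \<omega>)} \<omega> + indicator {\<omega>. hit n \<omega>} \<omega> * ennreal (exit n \<omega> \<bullet> w)
        = c \<omega> * ennreal (1 - ?mass \<omega>) + c \<omega> * ennreal (?mass \<omega>)" by simp
    qed
    also have "\<dots> = (\<integral>\<^sup>+\<omega>. c \<omega> * ennreal (1 - ?mass \<omega>) \<partial>M) + (\<integral>\<^sup>+\<omega>. c \<omega> * ennreal (?mass \<omega>) \<partial>M)"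
      by (rule nn_integral_add) measurable
    finally show ?thesis using fin unfolding below by (simp add: ennreal_add_left_cancel)
  qed
  have "(\<integral>\<^sup>+\<omega>. payoff (Suc N) n w \<omega> \<partial>M) = (\<integral>\<^sup>+\<omega>. c \<omega> * ennreal (?mass \<omega>) + indicator {\<omega>. alive n \<omega>} \<omega> * I \<omega> \<partial>M)"
  proof (rule nn_integral_cong)
    fix \<omega> assume \<omega>: "\<omega> \<in> space M"
    show "payoff (Suc N) n w \<omega> = c \<omega> * ennreal (?mass \<omega>) + indicator {\<omega>. alive n \<omega>} \<omega> * I \<omega>"
    proof (cases "alive n \<omega>")
      case True
      have "ennreal (?mass \<omega> * (exit n \<omega> \<bullet> w)) = ennreal (exit n \<omega> \<bullet> w) * ennreal (?mass \<omega>)"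
        using exit_dual[OF \<omega> True] mass1(1)[OF \<omega> True] by (simp add: ennreal_mult mult.commute)
      then show ?thesis using True step_row[OF alive_orbs[OF \<omega> True] R_nonneg[OF \<omega> True] K.approx_good w, of N]
        by (simp add: payoff_def K.approx_Suc c_def I_def' moved_def exit_eq[OF R_nonneg[OF \<omega> True]] if_distrib cong: if_cong)
    next
      case False
      then show ?thesis by (simp add: payoff_def c_def)
    qed
  qed
  also have "\<dots> = (\<integral>\<^sup>+\<omega>. c \<omega> * ennreal (?mass \<omega>) \<partial>M) + (\<integral>\<^sup>+\<omega>. indicator {\<omega>. alive n \<omega>} \<omega> * I \<omega> \<partial>M)"
    by (rule nn_integral_add[OF _ Im]) measurable
  finally show ?thesis by (simp add: hit_part next_part)
qed

lemma payoff_iterate: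
  assumes w: "w \<in> dual (emb ` orbs \<R>)"
  shows "(\<integral>\<^sup>+\<omega>. payoff N n w \<omega> \<partial>M) = (\<Sum>k<N. \<integral>\<^sup>+\<omega>. indicator {\<omega>. hit (n + k) \<omega>} \<omega> * ennreal (exit (n + k) \<omega> \<bullet> w) \<partial>M)"
proof (induction N arbitrary: n)
  case 0
  then show ?case by (simp add: payoff_def K.approx_0 vm_simps)
next
  case (Suc N)
  show ?case unfolding payoff_step[OF w] Suc
    by (simp add: lessThan_Suc_eq_insert_0 sum.reindex)
qed

text \<open>The first \<open>N\<close> terms of the series make up \<open>approx N\<close>.\<close>

lemma passage_law:
  assumes w: "w \<in> dual (emb ` orbs \<R>)"
  shows "(\<Sum>k. \<integral>\<^sup>+\<omega>. indicator {\<omega>. hit k \<omega>} \<omega> * ennreal (exit k \<omega> \<bullet> w) \<partial>M) = ennreal ((emb x0 v* K.passage r0) \<bullet> w)"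
proof -
  let ?a = "\<lambda>k. \<integral>\<^sup>+\<omega>. indicator {\<omega>. hit k \<omega>} \<omega> * ennreal (exit k \<omega> \<bullet> w) \<partial>M"
  have "(\<Sum>k<N. ?a k) = ennreal ((emb x0 v* K.approx N r0) \<bullet> w)" for N
    using payoff_iterate[OF w, of N 0] by (simp add: payoff_def alive_def emeasure_space_1)
  moreover have "(\<lambda>N. ennreal ((emb x0 v* K.approx N r0) \<bullet> w)) \<longlonglongrightarrow> ennreal ((emb x0 v* K.passage r0) \<bullet> w)"
    by (intro tendsto_ennrealI tendsto_inner tendsto_const bounded_bilinear.tendsto[OF vm_bilin] K.approx_tendsto r0)
  ultimately have "(\<lambda>N. \<Sum>k<N. ?a k) \<longlonglongrightarrow> ennreal ((emb x0 v* K.passage r0) \<bullet> w)" by simp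
  moreover have "(\<lambda>N. \<Sum>k<N. ?a k) \<longlonglongrightarrow> (\<Sum>k. ?a k)" by (rule summable_LIMSEQ) simp
  ultimately show ?thesis by (rule LIMSEQ_unique[rotated])
qed

definition exit_state :: "'w \<Rightarrow> real^('p + 'm)" where
  "exit_state \<omega> = (if \<exists>n. hit n \<omega> then exit (LEAST n. hit n \<omega>) \<omega> else 0)"

lemma exit_state_hit: "\<omega> \<in> space M \<Longrightarrow> hit n \<omega> \<Longrightarrow> exit_state \<omega> = exit n \<omega>"
proof -
  assume a: "\<omega> \<in> space M" "hit n \<omega>"
  then have "(LEAST n. hit n \<omega>) = n" using hit_unique LeastI[of "\<lambda>n. hit n \<omega>"] by blast
  then show ?thesis using a by (auto simp: exit_state_def)
qed

lemma hit_measurable [measurable]: "Measurable.pred M (hit n)"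
proof -
  have [measurable]: "Measurable.pred M (alive n)" "(\<lambda>\<omega>. isl (Y n \<omega>)) \<in> measurable M (count_space UNIV)"
      "R n \<in> borel_measurable M" "S n \<in> borel_measurable M"
    using from_history[OF alive_history] from_history[OF Y_history(2)[of n n]] 
      from_history[OF R_history[of n n]] S_meas by auto
  show ?thesis unfolding hit_def[abs_def] by measurable
qed

lemma exit_measurable [measurable]: "exit n \<in> borel_measurable M"
  by (rule from_history[OF exit_history])

lemma exit_state_measurable [measurable]: "exit_state \<in> borel_measurable M"
proof -
  have "(\<lambda>\<omega>. exit (LEAST n. hit n \<omega>) \<omega>) \<in> borel_measurable M"
    by (rule measurable_compose_countable[of exit]) measurable
  then show ?thesis unfolding exit_state_def[abs_def] by measurable
qed

lemma exit_orbs: "\<omega> \<in> space M \<Longrightarrow> hit n \<omega> \<Longrightarrow> exit n \<omega> \<in> emb ` orbs \<R>"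
  using exit_eq[OF R_nonneg] flow_orbs[OF rap alive_orbs R_nonneg] by (auto simp: hit_def)

lemma exit_state_cases: "\<omega> \<in> space M \<Longrightarrow> exit_state \<omega> = 0 \<or> exit_state \<omega> \<in> emb ` orbs \<R>"
  using exit_state_hit[of \<omega>] exit_orbs[of \<omega>] by (cases "\<exists>n. hit n \<omega>") (metis, simp add: exit_state_def)

lemma exit_state_integrable: "integrable M exit_state"
proof -
  obtain B where B: "\<And>z. z \<in> emb ` orbs \<R> \<Longrightarrow> norm z \<le> B"
    using mass_base_orbs[OF rap] by (auto simp: mass_base_def bounded_iff)
  have "norm (exit_state \<omega>) \<le> \<bar>B\<bar>" if "\<omega> \<in> space M" for \<omega>
    using exit_state_cases[OF that] B[of "exit_state \<omega>"] by auto
  then show ?thesis by (intro integrable_const_bound[where B="\<bar>B\<bar>"]) auto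
qed

text \<open>
  By \<open>passage_law\<close> both sides agree on the columns of the dual cone. Its interior points
  \<open>\<kappa> *\<^sub>R 1 + axis q 1\<close> give the single coordinates.
\<close>

lemma exit_state_expectation:
  "integral\<^sup>L M exit_state = emb x0 v* K.passage r0"
proof -
  have x0: "emb x0 \<in> emb ` orbs \<R>" using start by simp
  have dual_eq: "integral\<^sup>L M exit_state \<bullet> w = (emb x0 v* K.passage r0) \<bullet> w" if w: "w \<in> dual (emb ` orbs \<R>)" for w
  proof -
    have nn: "0 \<le> exit_state \<omega> \<bullet> w" if "\<omega> \<in> space M" for \<omega>
      using exit_state_cases[OF that] w by (auto simp: dual_def)
    have pw: "ennreal (exit_state \<omega> \<bullet> w) = (\<Sum>k. indicator {\<omega>. hit k \<omega>} \<omega> * ennreal (exit k \<omega> \<bullet> w))" if \<omega>: "\<omega> \<in> space M" for \<omega>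
    proof (cases "\<exists>n. hit n \<omega>")
      case True
      then obtain n where n: "hit n \<omega>" by blast
      have "(\<Sum>k. indicator {\<omega>. hit k \<omega>} \<omega> * ennreal (exit k \<omega> \<bullet> w)) = (\<Sum>k\<in>{n}. indicator {\<omega>. hit k \<omega>} \<omega> * ennreal (exit k \<omega> \<bullet> w))"
        by (rule suminf_finite) (use hit_unique[OF \<omega> n] in \<open>auto simp: indicator_def\<close>)
      then show ?thesis using n exit_state_hit[OF \<omega> n] by simp
    next
      case False
      then show ?thesis by (simp add: exit_state_def)
    qed
    have "ennreal (integral\<^sup>L M exit_state \<bullet> w) = ennreal (\<integral>\<omega>. exit_state \<omega> \<bullet> w \<partial>M)"
      using exit_state_integrable by simp
    also have "\<dots> = (\<integral>\<^sup>+\<omega>. ennreal (exit_state \<omega> \<bullet> w) \<partial>M)"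
      by (rule nn_integral_eq_integral[symmetric]) (use exit_state_integrable nn in auto)
    also have "\<dots> = (\<integral>\<^sup>+\<omega>. (\<Sum>k. indicator {\<omega>. hit k \<omega>} \<omega> * ennreal (exit k \<omega> \<bullet> w)) \<partial>M)"
      by (intro nn_integral_cong pw)
    also have "\<dots> = (\<Sum>k. \<integral>\<^sup>+\<omega>. indicator {\<omega>. hit k \<omega>} \<omega> * ennreal (exit k \<omega> \<bullet> w) \<partial>M)"
      by (rule nn_integral_suminf) (unfold indicator_def of_bool_def mem_Collect_eq, measurable)
    also have "\<dots> = ennreal ((emb x0 v* K.passage r0) \<bullet> w)" by (rule passage_law[OF w])
    finally have "ennreal (integral\<^sup>L M exit_state \<bullet> w) = ennreal ((emb x0 v* K.passage r0) \<bullet> w)" .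
    moreover have "0 \<le> (emb x0 v* K.passage r0) \<bullet> w"
    proof -
      have "mpos (emb ` orbs \<R>) (emb ` orbs \<R>) (K.passage r0)" using K.passage_good r0 by (simp add: K.good_def)
      from mposD[OF this w] start show ?thesis by (simp add: dual_def dot_lmul_matrix)
    qed
    moreover have "0 \<le> integral\<^sup>L M exit_state \<bullet> w"
    proof -
      have "integral\<^sup>L M exit_state \<bullet> w = (\<integral>\<omega>. exit_state \<omega> \<bullet> w \<partial>M)" using exit_state_integrable by simp
      also have "0 \<le> \<dots>" by (rule Bochner_Integration.integral_nonneg_AE) (use nn in auto)
      finally show ?thesis .
    qed
    ultimately show ?thesis by simp
  qed
  obtain \<kappa> where k: "\<kappa> > 0" "\<And>w. norm w \<le> 1 \<Longrightarrow> \<kappa> *\<^sub>R 1 + w \<in> dual (emb ` orbs \<R>)"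
    using mass_base_interior[OF mass_base_orbs[OF rap]] by metis
  show ?thesis
  proof (rule vec_eq_iff[THEN iffD2, rule_format])
    fix q
    have "integral\<^sup>L M exit_state \<bullet> (\<kappa> *\<^sub>R 1 + axis q 1) = (emb x0 v* K.passage r0) \<bullet> (\<kappa> *\<^sub>R 1 + axis q 1)"
      by (intro dual_eq k) (simp add: norm_axis_1)
    moreover have "integral\<^sup>L M exit_state \<bullet> 1 = (emb x0 v* K.passage r0) \<bullet> 1"
      by (intro dual_eq mass_base_one mass_base_orbs rap)
    ultimately show "integral\<^sup>L M exit_state $ q = (emb x0 v* K.passage r0) $ q"
      by (simp add: inner_add_right inner_axis)
  qed
qed

lemma hit_probability:
  "measure M {\<omega>\<in>space M. \<exists>n. hit n \<omega>} = (emb x0 v* K.passage r0) \<bullet> 1"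
proof -
  have "exit_state \<omega> \<bullet> 1 = indicator {\<omega>\<in>space M. \<exists>n. hit n \<omega>} \<omega>" if \<omega>: "\<omega> \<in> space M" for \<omega>
  proof (cases "\<exists>n. hit n \<omega>")
    case True
    then obtain n where n: "hit n \<omega>" by blast
    then show ?thesis using exit_state_hit[OF \<omega> n] exit_orbs[OF \<omega> n] emb_mass[OF rap] \<omega> by (auto simp: indicator_def)
  qed (simp add: exit_state_def)
  then have "(\<integral>\<omega>. exit_state \<omega> \<bullet> 1 \<partial>M) = (\<integral>\<omega>. indicator {\<omega>\<in>space M. \<exists>n. hit n \<omega>} \<omega> \<partial>M)"
    by (intro Bochner_Integration.integral_cong refl)
  also have "\<dots> = measure M {\<omega>\<in>space M. \<exists>n. hit n \<omega>}" by (simp add: Int_absorb1 subset_eq)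
  finally show ?thesis using exit_state_expectation exit_state_integrable by simp
qed

text \<open>
  Given the history, the holding time has a density on the finite times, so it meets the level with
  probability 0.
\<close>

lemma no_tie: "AE \<omega> in M. \<not> (J n \<omega> < \<infinity> \<and> S n \<omega> = ereal (R n \<omega>))"
proof -
  let ?g = "\<lambda>p. indicator {p. snd p = R n (fst p)} p :: ennreal"
  have [measurable]: "(\<lambda>p. R n (fst p)) \<in> borel_measurable (Hist n \<Otimes>\<^sub>M (borel :: real measure))"
    using measurable_compose[OF measurable_fst R_history[of n n]] by auto
  have g: "?g \<in> borel_measurable (Hist n \<Otimes>\<^sub>M borel)"
    unfolding indicator_def of_bool_def mem_Collect_eq by measurable
  have [measurable]: "R n \<in> borel_measurable M" "S n \<in> borel_measurable M" "J n \<in> borel_measurable M" "L n \<in> measurable M (count_space UNIV)"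
    using from_history[OF R_history[of n n]] S_meas from_history[OF J_history] L_meas by auto
  have "AE \<omega> in M. indicator {\<omega>. J n \<omega> < \<infinity> \<and> S n \<omega> < \<infinity> \<and> L n \<omega> = l} \<omega> * ?g (\<omega>, T n \<omega>) = 0" for l
  proof -
    have "(\<integral>\<^sup>+\<omega>. indicator {\<omega>. J n \<omega> < \<infinity> \<and> S n \<omega> < \<infinity> \<and> L n \<omega> = l} \<omega> * ?g (\<omega>, T n \<omega>) \<partial>M) = 0"
    proof -
      have "(\<integral>\<^sup>+s. indicator {0..} s * ennreal (jd l s (emb (Y n \<omega>))) * ?g (\<omega>, s) \<partial>lborel) = (\<integral>\<^sup>+(s::real). 0 \<partial>lborel)" for \<omega>
        by (rule nn_integral_cong_AE) (use AE_lborel_singleton[of "R n \<omega>"] in \<open>auto elim!: eventually_mono\<close>)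
      then show ?thesis unfolding holding_nn[OF g] by simp
    qed
    then show ?thesis
      by (subst (asm) nn_integral_0_iff_AE) (unfold indicator_def of_bool_def mem_Collect_eq fst_conv snd_conv, measurable)
  qed
  then have "AE \<omega> in M. \<forall>l\<in>UNIV. indicator {\<omega>. J n \<omega> < \<infinity> \<and> S n \<omega> < \<infinity> \<and> L n \<omega> = l} \<omega> * ?g (\<omega>, T n \<omega>) = 0"
    by (intro AE_finite_allI) auto
  then show ?thesis
  proof eventually_elim
    case (elim \<omega>)
    show ?case
    proof
      assume a: "J n \<omega> < \<infinity> \<and> S n \<omega> = ereal (R n \<omega>)"
      then have e1: "indicator {\<omega>'. J n \<omega>' < \<infinity> \<and> S n \<omega>' < \<infinity> \<and> L n \<omega>' = L n \<omega>} \<omega> * ?g (\<omega>, T n \<omega>) = 1"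
        by (simp add: indicator_def)
      have e0: "indicator {\<omega>'. J n \<omega>' < \<infinity> \<and> S n \<omega>' < \<infinity> \<and> L n \<omega>' = L n \<omega>} \<omega> * ?g (\<omega>, T n \<omega>) = 0"
        using elim by blast
      from trans[OF e1[symmetric] e0] show False by simp
    qed
  qed
qed

end

section \<open>Staying on one side\<close>

context orbit_pdmp
begin

lemma J_mono: "\<omega> \<in> space M \<Longrightarrow> m \<le> n \<Longrightarrow> J m \<omega> \<le> J n \<omega>"
  unfolding jump_time_def by (rule sum_mono2) (use S_pos in \<open>auto intro: less_imp_le\<close>)

lemma interval_exists:
  assumes \<omega>: "\<omega> \<in> space M" and t: "0 \<le> t"
  obtains n where "J n \<omega> \<le> ereal t" "ereal t < J (Suc n) \<omega>"
proof -
  define m where "m = (LEAST m. ereal t < J m \<omega>)"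
  have m: "ereal t < J m \<omega>" unfolding m_def using unbounded[OF \<omega>] by (rule LeastI_ex)
  have "m \<noteq> 0" using m t by (intro notI) simp
  then obtain n where n: "m = Suc n" by (cases m) auto
  have "\<not> ereal t < J n \<omega>" using not_less_Least[of n "\<lambda>m. ereal t < J m \<omega>"] n by (simp add: m_def)
  with m n show ?thesis by (intro that[of n]) auto
qed

lemma interval_less:
  assumes \<omega>: "\<omega> \<in> space M" and "J m \<omega> \<le> ereal s" "ereal s < J (Suc n) \<omega>"
  shows "m \<le> n"
proof (rule ccontr)
  assume "\<not> m \<le> n"
  then have "J (Suc n) \<omega> \<le> J m \<omega>" using J_mono[OF \<omega>] by simp
  with assms show False by (meson leD le_less_trans less_le_trans)
qed

lemma path_flow:
  assumes "\<omega> \<in> space M" "J n \<omega> \<le> ereal t" "ereal t < J (Suc n) \<omega>"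
  shows "A t \<omega> = orbit_flow \<R> (t - real_of_ereal (J n \<omega>)) (Y n \<omega>)" "isl (A t \<omega>) = isl (Y n \<omega>)"
  using path[OF assms] by (simp_all add: isl_flow[OF rap])

lemma path_at_jump:
  assumes \<omega>: "\<omega> \<in> space M" and J: "J n \<omega> < \<infinity>"
  shows "A (real_of_ereal (J n \<omega>)) \<omega> = Y n \<omega>"
proof -
  have e: "J n \<omega> = ereal (real_of_ereal (J n \<omega>))" by (rule J_real[OF \<omega> J])
  have "J n \<omega> < J (Suc n) \<omega>"
    unfolding J_Suc using S_pos[OF \<omega>, of n] J J_nonneg[OF \<omega>, of n]
    by (cases "S n \<omega>"; cases "J n \<omega>") auto
  then have "A (real_of_ereal (J n \<omega>)) \<omega> = orbit_flow \<R> 0 (Y n \<omega>)"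
    using path_flow(1)[OF \<omega>, of n "real_of_ereal (J n \<omega>)"] e by simp
  then show ?thesis by (simp add: Y_normalised)
qed

end

context orbit_passage
begin

lemma R_down:
  assumes \<omega>: "\<omega> \<in> space M" and J: "J n \<omega> < \<infinity>" and U: "\<And>c. c \<notin> U"
  shows "R n \<omega> = r0 - real_of_ereal (J n \<omega>)"
  using J
proof (induction n)
  case (Suc n)
  then have f: "J n \<omega> < \<infinity>" "S n \<omega> < \<infinity>" using J_Suc_finite[OF \<omega>] by auto
  have "real_of_ereal (J (Suc n) \<omega>) = real_of_ereal (J n \<omega>) + T n \<omega>"
    unfolding J_Suc using J_real[OF \<omega> f(1)] S_real[OF \<omega> f(2)] by (metis real_of_ereal.simps(1) plus_ereal.simps(1))
  then show ?case using Suc.IH[OF f(1)] U by simp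
qed simp

text \<open>
  With no rising side the level is a clock, and the path is killed when it leaves the falling side.
\<close>

lemma hit_iff_stay:
  assumes \<omega>: "\<omega> \<in> space M" and U: "\<And>c. c \<notin> U" and D: "\<And>c. c \<in> D \<longleftrightarrow> c = b"
  shows "(\<exists>n. hit n \<omega>) \<longleftrightarrow> (\<forall>s\<in>{0..r0}. isl (A s \<omega>) = b)"
proof
  assume "\<exists>n. hit n \<omega>"
  then obtain n where n: "hit n \<omega>" by blast
  then have a: "alive n \<omega>" and b: "isl (Y n \<omega>) = b" and RS: "ereal (R n \<omega>) < S n \<omega>" using D by (auto simp: hit_def)
  then have J: "J n \<omega> < \<infinity>" by (simp add: alive_def)
  have side: "isl (Y k \<omega>) = b" if "k \<le> n" for k
    using that a b U D by (cases "k = n") (auto simp: alive_def stays_def)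
  have r0J: "ereal r0 < J (Suc n) \<omega>"
  proof -
    show ?thesis
      using RS R_down[OF \<omega> J U] J J_nonneg[OF \<omega>, of n] by (cases "S n \<omega>"; cases "J n \<omega>") (auto simp: J_Suc)
  qed
  show "\<forall>s\<in>{0..r0}. isl (A s \<omega>) = b"
  proof
    fix s assume s: "s \<in> {0..r0}"
    then obtain m where m: "J m \<omega> \<le> ereal s" "ereal s < J (Suc m) \<omega>" using interval_exists[OF \<omega>, of s] by auto
    have "ereal s < J (Suc n) \<omega>" using s r0J by (meson atLeastAtMost_iff ereal_less_eq(3) le_less_trans)
    then have "m \<le> n" by (rule interval_less[OF \<omega> m(1)])
    then show "isl (A s \<omega>) = b" using path_flow(2)[OF \<omega> m] side by simp
  qed
next
  assume st: "\<forall>s\<in>{0..r0}. isl (A s \<omega>) = b"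
  obtain n where n: "J n \<omega> \<le> ereal r0" "ereal r0 < J (Suc n) \<omega>" using interval_exists[OF \<omega> r0] .
  have J: "J k \<omega> \<le> ereal r0" "J k \<omega> < \<infinity>" if "k \<le> n" for k
    using J_mono[OF \<omega> that] n(1) by (auto intro: order_trans le_less_trans)
  have side: "isl (Y k \<omega>) = b" if "k \<le> n" for k
  proof -
    have "real_of_ereal (J k \<omega>) \<in> {0..r0}"
      using J[OF that] J_nonneg[OF \<omega>, of k] by (cases "J k \<omega>") auto
    then show ?thesis using st path_at_jump[OF \<omega> J(2)[OF that]] by metis
  qed
  have Rk: "0 \<le> R k \<omega>" if "k \<le> n" for k
    using R_down[OF \<omega> J(2)[OF that] U] J[OF that] J_nonneg[OF \<omega>, of k] by (cases "J k \<omega>") auto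
  have "stays k \<omega>" if "k < n" for k
    using side[of k] Rk[of "Suc k"] that U D by (auto simp: stays_def)
  then have "alive n \<omega>" using J[of n] by (simp add: alive_def)
  moreover have "ereal (R n \<omega>) < S n \<omega>"
    using n(2) R_down[OF \<omega> J(2)[of n] U] J_real[OF \<omega> J(2)[of n]] unfolding J_Suc
    by (cases "S n \<omega>"; cases "J n \<omega>") auto
  ultimately show "\<exists>n. hit n \<omega>" using side[of n] D by (auto simp: hit_def)
qed

lemma stay_probability:
  assumes U: "\<And>c. c \<notin> U" and D: "\<And>c. c \<in> D \<longleftrightarrow> c = b"
  shows "measure M {\<omega>\<in>space M. \<forall>s\<in>{0..r0}. isl (A s \<omega>) = b} = (emb x0 v* K.passage r0) \<bullet> 1"
proof -
  have "{\<omega>\<in>space M. \<forall>s\<in>{0..r0}. isl (A s \<omega>) = b} = {\<omega>\<in>space M. \<exists>n. hit n \<omega>}"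
    using hit_iff_stay[OF _ U D] by auto
  then show ?thesis using hit_probability by simp
qed

end

section \<open>The first return of the level\<close>

definition mpart :: "real^('p::finite + 'm::finite) \<Rightarrow> real^'m" where
  "mpart v = (\<chi> q. v $ Inr q)"

lemma mpart_cat [simp]: "mpart (cat a b) = b"
  by (simp add: mpart_def vec_eq_iff)

lemma mpart_emb: "mpart (emb x) = minus_part x"
  by (cases x) (simp_all add: minus_part_def mpart_def vec_eq_iff)

lemma bounded_linear_mpart: "bounded_linear mpart"
proof -
  have "linear mpart" by (rule linearI) (simp_all add: mpart_def vec_eq_iff)
  then show ?thesis by (simp add: linear_conv_bounded_linear)
qed

lemma mpart_borel [measurable]: "mpart \<in> borel_measurable borel"
  by (intro borel_measurable_continuous_onI linear_continuous_on bounded_linear_mpart)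

text \<open>The level of the fluid process, started at 0 in a positive orbit.\<close>

locale up_down = orbit_passage M \<R> A x0 S L "{True}" "{False}" 0
  for M :: "'w measure" and \<R> :: "('p::finite, 'm::finite, 'i::finite, 'j::finite) rap"
    and A :: "real \<Rightarrow> 'w \<Rightarrow> ('p, 'm) orbit" and x0 S L +
  assumes x0_up: "isl x0"
begin

abbreviation "j n \<omega> \<equiv> real_of_ereal (J n \<omega>)"
abbreviation "up n \<omega> \<equiv> isl (Y n \<omega>)"

lemma j_Suc: "\<omega> \<in> space M \<Longrightarrow> J (Suc n) \<omega> < \<infinity> \<Longrightarrow> j (Suc n) \<omega> = j n \<omega> + T n \<omega> \<and> 0 < T n \<omega> \<and> 0 \<le> j n \<omega>"
proof -
  assume a: "\<omega> \<in> space M" "J (Suc n) \<omega> < \<infinity>"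
  then have f: "J n \<omega> < \<infinity>" "S n \<omega> < \<infinity>" using J_Suc_finite by auto
  then show ?thesis using J_nonneg[OF a(1), of n] S_pos[OF a(1), of n] unfolding J_Suc
    by (cases "J n \<omega>"; cases "S n \<omega>") auto
qed

definition drift :: "'w \<Rightarrow> real \<Rightarrow> real" where
  "drift \<omega> s = indicator (orbits_p \<R>) (A s \<omega>) - indicator (orbits_m \<R>) (A s \<omega>)"

lemma drift_eq:
  assumes "\<omega> \<in> space M" "0 \<le> s"
  shows "drift \<omega> s = (if isl (A s \<omega>) then 1 else - 1)"
  using in_orbs[OF assms] by (auto simp: drift_def orbs_def orbits_p_def orbits_m_def indicator_def)

lemma drift_interval:
  assumes \<omega>: "\<omega> \<in> space M" and s: "J n \<omega> \<le> ereal s" "ereal s < J (Suc n) \<omega>"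
  shows "drift \<omega> s = (if up n \<omega> then 1 else - 1)"
proof -
  have "0 \<le> ereal s" using J_nonneg[OF \<omega>, of n] s(1) by (rule order_trans)
  then show ?thesis using drift_eq[OF \<omega>, of s] path_flow(2)[OF \<omega> s] by simp
qed

lemma drift_piece:
  assumes \<omega>: "\<omega> \<in> space M" and B: "\<And>s. s \<in> B \<Longrightarrow> J n \<omega> \<le> ereal s \<and> ereal s < J (Suc n) \<omega>"
    and Bs: "B \<in> sets borel" "emeasure lborel B < \<infinity>"
  shows "set_integrable lborel B (drift \<omega>)" "(LBINT s:B. drift \<omega> s) = (if up n \<omega> then 1 else - 1) * measure lborel B"
proof -
  let ?c = "if up n \<omega> then 1 else - 1 :: real"
  have e: "indicator B s *\<^sub>R drift \<omega> s = indicator B s *\<^sub>R ?c" for s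
    using drift_interval[OF \<omega>, of n s] B by (auto simp: indicator_def)
  have "integrable lborel (\<lambda>s. indicator B s *\<^sub>R ?c)" using Bs by simp
  then show "set_integrable lborel B (drift \<omega>)" unfolding set_integrable_def e .
  show "(LBINT s:B. drift \<omega> s) = ?c * measure lborel B"
    unfolding set_lebesgue_integral_def e using Bs by simp
qed

lemma level_at_jump:
  assumes \<omega>: "\<omega> \<in> space M" and J: "J n \<omega> < \<infinity>"
  shows "set_integrable lborel {0..<j n \<omega>} (drift \<omega>) \<and> (LBINT s:{0..<j n \<omega>}. drift \<omega> s) = R n \<omega>"
  using J
proof (induction n)
  case 0
  then show ?case by (simp add: set_integrable_def set_lebesgue_integral_def)
next
  case (Suc n)
  then have f: "J n \<omega> < \<infinity>" "S n \<omega> < \<infinity>" using J_Suc_finite[OF \<omega>] by auto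
  note jS = j_Suc[OF \<omega> Suc.prems]
  have IH: "set_integrable lborel {0..<j n \<omega>} (drift \<omega>)" "(LBINT s:{0..<j n \<omega>}. drift \<omega> s) = R n \<omega>"
    using Suc.IH[OF f(1)] by auto
  have B: "J n \<omega> \<le> ereal s \<and> ereal s < J (Suc n) \<omega>" if "s \<in> {j n \<omega>..<j (Suc n) \<omega>}" for s
    using that J_real[OF \<omega> f(1)] J_real[OF \<omega> Suc.prems] by (metis atLeastLessThan_iff ereal_less_eq(3) less_ereal.simps(1))
  note pc = drift_piece[OF \<omega> B]
  have un: "{0..<j (Suc n) \<omega>} = {0..<j n \<omega>} \<union> {j n \<omega>..<j (Suc n) \<omega>}" using jS by auto
  have p1: "set_integrable lborel {j n \<omega>..<j (Suc n) \<omega>} (drift \<omega>)" by (rule pc(1)) (use jS in auto)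
  have p2: "(LBINT s:{j n \<omega>..<j (Suc n) \<omega>}. drift \<omega> s) = (if up n \<omega> then 1 else - 1) * T n \<omega>"
    by (subst pc(2)) (use jS in auto)
  have "set_integrable lborel {0..<j (Suc n) \<omega>} (drift \<omega>)"
    unfolding un by (rule set_integrable_Un[OF IH(1) p1]) auto
  moreover have "(LBINT s:{0..<j (Suc n) \<omega>}. drift \<omega> s) = R n \<omega> + (if up n \<omega> then 1 else - 1) * T n \<omega>"
    unfolding un by (subst set_integral_Un[OF _ IH(1) p1]) (use IH(2) p2 in auto)
  ultimately show ?case by simp
qed

lemma level_eq:
  assumes \<omega>: "\<omega> \<in> space M" and t: "J n \<omega> \<le> ereal t" "ereal t < J (Suc n) \<omega>"
  shows "level \<R> A t \<omega> = R n \<omega> + (if up n \<omega> then t - j n \<omega> else - (t - j n \<omega>))"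
proof -
  have J: "J n \<omega> < \<infinity>" using t(1) by (rule le_less_trans) simp
  have jt: "0 \<le> j n \<omega>" "j n \<omega> \<le> t" using J_nonneg[OF \<omega>, of n] J t(1) by (cases "J n \<omega>"; simp)+
  note IH = level_at_jump[OF \<omega> J]
  have B: "J n \<omega> \<le> ereal s \<and> ereal s < J (Suc n) \<omega>" if "s \<in> {j n \<omega>..t}" for s
    using that J_real[OF \<omega> J] t(2) by (metis atLeastAtMost_iff ereal_less_eq(3) le_less_trans)
  note pc = drift_piece[OF \<omega> B]
  have un: "{0..t} = {0..<j n \<omega>} \<union> {j n \<omega>..t}" using jt by auto
  have p1: "set_integrable lborel {j n \<omega>..t} (drift \<omega>)" by (rule pc(1)) (use jt in auto)
  have p2: "(LBINT s:{j n \<omega>..t}. drift \<omega> s) = (if up n \<omega> then 1 else - 1) * (t - j n \<omega>)"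
    by (subst pc(2)) (use jt in auto)
  have "(LBINT s:{0..t}. drift \<omega> s) = R n \<omega> + (if up n \<omega> then 1 else - 1) * (t - j n \<omega>)"
    unfolding un by (subst set_integral_Un[OF _ conjunct1[OF IH] p1]) (use IH p2 in auto)
  then show ?thesis unfolding level_def drift_def by simp
qed

text \<open>
  \<open>above\<close> and \<open>first_return\<close> are the counterparts of \<open>alive\<close> and \<open>hit\<close> in which a tie counts as a return.
  They describe \<open>tau_minus\<close> for every outcome, and not only almost surely, which is needed to see that
  the integrand of the theorem is measurable.
\<close>

definition above :: "nat \<Rightarrow> 'w \<Rightarrow> bool" where
  "above n \<omega> \<longleftrightarrow> J n \<omega> < \<infinity> \<and> (\<forall>k<n. up k \<omega> \<or> T k \<omega> < R k \<omega>)"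

definition first_return :: "nat \<Rightarrow> 'w \<Rightarrow> bool" where
  "first_return n \<omega> \<longleftrightarrow> above n \<omega> \<and> \<not> up n \<omega> \<and> ereal (R n \<omega>) \<le> S n \<omega>"

lemma above_Suc: "\<omega> \<in> space M \<Longrightarrow> above (Suc n) \<omega> \<longleftrightarrow> above n \<omega> \<and> S n \<omega> < \<infinity> \<and> (up n \<omega> \<or> T n \<omega> < R n \<omega>)"
  unfolding above_def J_Suc_finite by (auto simp: less_Suc_eq)

lemma above_mono: "\<omega> \<in> space M \<Longrightarrow> above m \<omega> \<Longrightarrow> n \<le> m \<Longrightarrow> above n \<omega>"
  by (induction m) (auto simp: above_Suc le_Suc_eq)

lemma R_pos: "\<omega> \<in> space M \<Longrightarrow> above n \<omega> \<Longrightarrow> 0 \<le> R n \<omega> \<and> (n \<noteq> 0 \<longrightarrow> 0 < R n \<omega>)"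
proof (induction n)
  case (Suc n)
  then have "above n \<omega>" "S n \<omega> < \<infinity>" "up n \<omega> \<or> T n \<omega> < R n \<omega>" by (auto simp: above_Suc)
  then show ?case using Suc S_real[of \<omega> n] by auto
qed simp

lemma level_pos:
  assumes \<omega>: "\<omega> \<in> space M" and t: "0 < t" "J n \<omega> \<le> ereal t" "ereal t < J (Suc n) \<omega>" and a: "above n \<omega>"
    and below: "\<not> up n \<omega> \<Longrightarrow> t < j n \<omega> + R n \<omega>"
  shows "0 < level \<R> A t \<omega>"
proof -
  have "j n \<omega> \<le> t" using t(2) a J_nonneg[OF \<omega>, of n] by (cases "J n \<omega>") (auto simp: above_def)
  moreover have "n \<noteq> 0 \<Longrightarrow> 0 < R n \<omega>" "0 \<le> R n \<omega>" using R_pos[OF \<omega> a] by auto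
  moreover have "n = 0 \<Longrightarrow> j n \<omega> = 0" by simp
  ultimately show ?thesis using level_eq[OF \<omega> t(2,3)] below t(1) by (cases "n = 0") auto
qed

lemma before_return:
  assumes \<omega>: "\<omega> \<in> space M" and a: "above (Suc n) \<omega>" and t: "ereal t < J (Suc n) \<omega>" and u: "\<not> up n \<omega>"
  shows "t < j n \<omega> + R n \<omega>"
proof -
  have J: "J (Suc n) \<omega> < \<infinity>" and T: "T n \<omega> < R n \<omega>" using a u by (auto simp: above_def)
  have "t < j (Suc n) \<omega>" using t J_real[OF \<omega> J] by (metis less_ereal.simps(1))
  then show ?thesis using j_Suc[OF \<omega> J] T by simp
qed

text \<open>
  On a tie between level and holding time the level returns at the jump time itself; the orbit is then
  already the post-jump state.
\<close>

definition return_state :: "nat \<Rightarrow> 'w \<Rightarrow> real^'m" where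
  "return_state n \<omega> = (if ereal (R n \<omega>) < S n \<omega> then mpart (exit n \<omega>) else mpart (emb (Y (Suc n) \<omega>)))"

text \<open>
  The level is positive at all times strictly between 0 and \<open>j n \<omega> + R n \<omega>\<close>. The index \<open>n\<close> is not 0
  because the path starts on the rising side, so \<open>R n \<omega> > 0\<close>.
\<close>

lemma tau_return:
  assumes \<omega>: "\<omega> \<in> space M" and fr: "first_return n \<omega>"
  shows "tau_minus \<R> A \<omega> = ereal (j n \<omega> + R n \<omega>)" "minus_part (A (j n \<omega> + R n \<omega>) \<omega>) = return_state n \<omega>"
proof -
  let ?t = "j n \<omega> + R n \<omega>"
  have a: "above n \<omega>" and dn: "\<not> up n \<omega>" and RS: "ereal (R n \<omega>) \<le> S n \<omega>" using fr by (auto simp: first_return_def)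
  have n0: "n \<noteq> 0" using dn x0_up by (intro notI) simp
  have J: "J n \<omega> < \<infinity>" using a by (simp add: above_def)
  have Rp: "0 < R n \<omega>" using R_pos[OF \<omega> a] n0 by blast
  have jn: "0 \<le> j n \<omega>" using J_nonneg[OF \<omega>, of n] by (simp add: real_of_ereal_pos)
  have t: "0 < ?t" using Rp jn by simp
  have Jt: "J n \<omega> \<le> ereal ?t" using Rp by (subst J_real[OF \<omega> J]) simp
  have tJ: "ereal ?t \<le> J (Suc n) \<omega>"
  proof -
    have "ereal ?t = J n \<omega> + ereal (R n \<omega>)" by (subst J_real[OF \<omega> J]) simp
    also have "\<dots> \<le> J n \<omega> + S n \<omega>" using RS by (rule add_left_mono)
    finally show ?thesis by (simp add: J_Suc)
  qed
  have lv: "level \<R> A ?t \<omega> = 0 \<and> minus_part (A ?t \<omega>) = return_state n \<omega>"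
  proof (cases "ereal (R n \<omega>) < S n \<omega>")
    case True
    have "ereal ?t < J (Suc n) \<omega>"
      unfolding J_Suc using True J J_nonneg[OF \<omega>, of n] by (cases "S n \<omega>"; cases "J n \<omega>") auto
    from level_eq[OF \<omega> Jt this] path_flow(1)[OF \<omega> Jt this] show ?thesis
      using dn True Rp by (simp add: return_state_def exit_eq mpart_emb)
  next
    case False
    then have S: "S n \<omega> = ereal (R n \<omega>)" using RS by simp
    then have J': "J (Suc n) \<omega> < \<infinity>" using J_Suc_finite[OF \<omega>] J by simp
    have T: "T n \<omega> = R n \<omega>" by (simp add: S)
    have jt: "j (Suc n) \<omega> = ?t" using j_Suc[OF \<omega> J'] T by simp
    have 1: "J (Suc n) \<omega> \<le> ereal ?t" unfolding jt[symmetric] by (subst J_real[OF \<omega> J']) simp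
    have 2: "ereal ?t < J (Suc (Suc n)) \<omega>"
    proof -
      have "J (Suc n) \<omega> < J (Suc (Suc n)) \<omega>"
        unfolding J_Suc[of "Suc n"] using S_pos[OF \<omega>, of "Suc n"] J' J_nonneg[OF \<omega>, of "Suc n"]
        by (cases "S (Suc n) \<omega>"; cases "J (Suc n) \<omega>") auto
      then show ?thesis using tJ by (rule le_less_trans[rotated])
    qed
    have "level \<R> A ?t \<omega> = 0" using level_eq[OF \<omega> 1 2] T dn jt by simp
    moreover have "A ?t \<omega> = Y (Suc n) \<omega>" using path_at_jump[OF \<omega> J'] jt by simp
    ultimately show ?thesis using False by (simp add: return_state_def mpart_emb del: post_jump.simps)
  qed
  then show "minus_part (A ?t \<omega>) = return_state n \<omega>" by blast
  show "tau_minus \<R> A \<omega> = ereal ?t"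
    unfolding tau_minus_def
  proof (rule antisym)
    show "(INF t\<in>{t. 0 < t \<and> level \<R> A t \<omega> \<le> 0}. ereal t) \<le> ereal ?t"
      by (rule INF_lower) (use t lv in simp)
    show "ereal ?t \<le> (INF t\<in>{t. 0 < t \<and> level \<R> A t \<omega> \<le> 0}. ereal t)"
    proof (rule INF_greatest)
      fix s assume "s \<in> {t. 0 < t \<and> level \<R> A t \<omega> \<le> 0}"
      then have s: "0 < s" "level \<R> A s \<omega> \<le> 0" by auto
      show "ereal ?t \<le> ereal s"
      proof (rule ccontr)
        assume "\<not> ereal ?t \<le> ereal s"
        then have st: "s < ?t" by simp
        obtain m where m: "J m \<omega> \<le> ereal s" "ereal s < J (Suc m) \<omega>" using interval_exists[OF \<omega>, of s] s(1) by auto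
        have "ereal s < J (Suc n) \<omega>" using st tJ by (meson less_ereal.simps(1) less_le_trans)
        then have mn: "m \<le> n" by (rule interval_less[OF \<omega> m(1)])
        have "0 < level \<R> A s \<omega>"
        proof (rule level_pos[OF \<omega> s(1) m])
          show "above m \<omega>" by (rule above_mono[OF \<omega> a mn])
          show "s < j m \<omega> + R m \<omega>" if "\<not> up m \<omega>"
          proof (cases "m = n")
            case False
            then have "above (Suc m) \<omega>" using mn by (intro above_mono[OF \<omega> a]) simp
            then show ?thesis by (rule before_return[OF \<omega> _ m(2) that])
          qed (use st in simp)
        qed
        then show False using s(2) by simp
      qed
    qed
  qed
qed

lemma tau_no_return:
  assumes \<omega>: "\<omega> \<in> space M" and nr: "\<And>n. \<not> first_return n \<omega>"
  shows "tau_minus \<R> A \<omega> = \<infinity>"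
proof -
  have above: "J n \<omega> < \<infinity> \<Longrightarrow> above n \<omega>" for n
  proof (induction n)
    case (Suc n)
    then have f: "J n \<omega> < \<infinity>" "S n \<omega> < \<infinity>" using J_Suc_finite[OF \<omega>] by auto
    then have a: "above n \<omega>" using Suc by blast
    then have "up n \<omega> \<or> S n \<omega> < ereal (R n \<omega>)" using nr[of n] by (auto simp: first_return_def)
    then have "up n \<omega> \<or> T n \<omega> < R n \<omega>" using S_real[OF \<omega> f(2)] by (metis less_ereal.simps(1))
    then show ?case using a f(2) by (simp add: above_Suc[OF \<omega>])
  qed (simp add: above_def)
  have "{t. 0 < t \<and> level \<R> A t \<omega> \<le> 0} = {}"
  proof safe
    fix t :: real assume t: "0 < t" "level \<R> A t \<omega> \<le> 0"
    obtain n where n: "J n \<omega> \<le> ereal t" "ereal t < J (Suc n) \<omega>" using interval_exists[OF \<omega>, of t] t(1) by auto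
    have J: "J n \<omega> < \<infinity>" using n(1) by (rule le_less_trans) simp
    have "0 < level \<R> A t \<omega>"
    proof (rule level_pos[OF \<omega> t(1) n above[OF J]])
      assume dn: "\<not> up n \<omega>"
      then have "S n \<omega> < ereal (R n \<omega>)" using nr[of n] above[OF J] by (auto simp: first_return_def)
      then have "S n \<omega> < \<infinity>" by (rule less_trans) simp
      then have "J (Suc n) \<omega> < \<infinity>" using J J_Suc_finite[OF \<omega>] by simp
      then show "t < j n \<omega> + R n \<omega>" using before_return[OF \<omega> above n(2) dn] by blast
    qed
    then show "t \<in> {}" using t(2) by simp
  qed
  then show ?thesis unfolding tau_minus_def by (simp only: image_empty Inf_empty top_ereal_def)
qed

lemma no_ties: "AE \<omega> in M. \<forall>n. J n \<omega> < \<infinity> \<longrightarrow> S n \<omega> \<noteq> ereal (R n \<omega>)"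
  unfolding AE_all_countable
proof
  fix n
  show "AE \<omega> in M. J n \<omega> < \<infinity> \<longrightarrow> S n \<omega> \<noteq> ereal (R n \<omega>)"
    using no_tie[of n] by eventually_elim blast
qed

lemma first_return_hit:
  assumes \<omega>: "\<omega> \<in> space M" and nt: "\<And>n. J n \<omega> < \<infinity> \<Longrightarrow> S n \<omega> \<noteq> ereal (R n \<omega>)"
  shows "first_return n \<omega> \<longleftrightarrow> hit n \<omega>"
proof -
  have ne: "T k \<omega> \<noteq> R k \<omega>" if "J (Suc k) \<omega> < \<infinity>" for k
    using nt[of k] S_real[OF \<omega>, of k] J_Suc_finite[OF \<omega>, of k] that by metis
  have "above n \<omega> \<longleftrightarrow> alive n \<omega>"
  proof (induction n)
    case 0
    then show ?case by (simp add: above_def alive_def)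
  next
    case (Suc n)
    show ?case unfolding above_Suc[OF \<omega>] alive_Suc[OF \<omega>] Suc stays_def
      using ne[of n] J_Suc_finite[OF \<omega>, of n] by (auto simp: alive_def less_le)
  qed
  moreover have "ereal (R n \<omega>) \<le> S n \<omega> \<longleftrightarrow> ereal (R n \<omega>) < S n \<omega>" if "J n \<omega> < \<infinity>"
    using nt[OF that] by (auto simp: less_le)
  ultimately show ?thesis by (auto simp: first_return_def hit_def alive_def)
qed

definition return_value :: "'w \<Rightarrow> real^'m" where
  "return_value \<omega> = (if tau_minus \<R> A \<omega> < \<infinity> then minus_part (A (real_of_ereal (tau_minus \<R> A \<omega>)) \<omega>) else 0)"

lemma first_return_measurable: "Measurable.pred M (first_return n)"
proof -
  have [measurable]: "T k \<in> borel_measurable M" "(\<lambda>\<omega>. isl (Y k \<omega>)) \<in> measurable M (count_space UNIV)"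
      "R k \<in> borel_measurable M" "S k \<in> borel_measurable M" "J k \<in> borel_measurable M" for k
    using S_meas[of k] from_history[OF Y_history(2)[of k k]] from_history[OF R_history[of k k]] from_history[OF J_history] by auto
  have "Measurable.pred M (\<lambda>\<omega>. (J n \<omega> < \<infinity> \<and> (\<forall>k\<in>{..<n}. up k \<omega> \<or> T k \<omega> < R k \<omega>)) \<and> \<not> up n \<omega> \<and> ereal (R n \<omega>) \<le> S n \<omega>)"
    by measurable
  then show ?thesis by (simp add: first_return_def[abs_def] above_def Ball_def)
qed

lemma return_state_measurable: "return_state n \<in> borel_measurable M"
proof -
  have [measurable]: "R n \<in> borel_measurable M" "S n \<in> borel_measurable M" "(\<lambda>\<omega>. emb (Y (Suc n) \<omega>)) \<in> borel_measurable M"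
    using S_meas[of n] from_history[OF R_history[of n n]] from_history[OF Y_history(1)[of "Suc n" "Suc n"]] by auto
  show ?thesis unfolding return_state_def[abs_def] by measurable
qed

lemma tau_finite: "\<omega> \<in> space M \<Longrightarrow> tau_minus \<R> A \<omega> < \<infinity> \<longleftrightarrow> (\<exists>n. first_return n \<omega>)"
  using tau_return(1)[of \<omega>] tau_no_return[of \<omega>] by (cases "\<exists>n. first_return n \<omega>") auto

lemma return_value_eq:
  assumes \<omega>: "\<omega> \<in> space M"
  shows "return_value \<omega> = (if \<exists>n. first_return n \<omega> then return_state (LEAST n. first_return n \<omega>) \<omega> else 0)"
proof (cases "\<exists>n. first_return n \<omega>")
  case True
  then have f: "first_return (LEAST n. first_return n \<omega>) \<omega>" by (rule LeastI_ex)
  show ?thesis using tau_return[OF \<omega> f] True by (simp add: return_value_def)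
next
  case False
  then show ?thesis using tau_no_return[OF \<omega>] by (simp add: return_value_def)
qed

lemma return_value_measurable: "return_value \<in> borel_measurable M"
proof -
  note first_return_measurable[measurable]
  have [measurable]: "(\<lambda>\<omega>. return_state (LEAST n. first_return n \<omega>) \<omega>) \<in> borel_measurable M"
    by (rule measurable_compose_countable[of return_state, OF return_state_measurable]) measurable
  have "(\<lambda>\<omega>. if \<exists>n. first_return n \<omega> then return_state (LEAST n. first_return n \<omega>) \<omega> else 0) \<in> borel_measurable M"
    by measurable
  then show ?thesis by (subst measurable_cong[OF return_value_eq])
qed

lemma return_value_AE: "AE \<omega> in M. return_value \<omega> = mpart (exit_state \<omega>)"
  using no_ties AE_space
proof eventually_elim
  case (elim \<omega>)
  then have fh: "first_return n \<omega> \<longleftrightarrow> hit n \<omega>" for n by (intro first_return_hit) auto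
  show ?case
  proof (cases "\<exists>n. hit n \<omega>")
    case True
    then have h: "hit (LEAST n. hit n \<omega>) \<omega>" by (rule LeastI_ex)
    then have "ereal (R (LEAST n. hit n \<omega>) \<omega>) < S (LEAST n. hit n \<omega>) \<omega>" by (simp add: hit_def)
    then show ?thesis using True elim(2) by (simp add: return_value_eq fh return_state_def exit_state_def)
  next
    case False
    then show ?thesis using elim(2) by (simp add: return_value_eq fh exit_state_def mpart_def vec_eq_iff)
  qed
qed

lemma exit_state_down: "\<omega> \<in> space M \<Longrightarrow> exit_state \<omega> \<bullet> 1 = mpart (exit_state \<omega>) \<bullet> 1"
proof (cases "\<exists>n. hit n \<omega>")
  case True
  assume \<omega>: "\<omega> \<in> space M"
  obtain n where n: "hit n \<omega>" using True by blast
  then have "\<not> isl (orbit_flow \<R> (R n \<omega>) (Y n \<omega>))" by (simp add: hit_def isl_flow[OF rap])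
  then obtain b where "orbit_flow \<R> (R n \<omega>) (Y n \<omega>) = Inr b" by (cases "orbit_flow \<R> (R n \<omega>) (Y n \<omega>)") auto
  moreover have "exit n \<omega> = emb (orbit_flow \<R> (R n \<omega>) (Y n \<omega>))" using n R_nonneg[OF \<omega>] by (intro exit_eq) (auto simp: hit_def)
  ultimately show ?thesis using exit_state_hit[OF \<omega> n] by (simp add: inner_cat_one)
qed (simp add: exit_state_def mpart_def inner_vec_def)

lemma return_expectation: "integral\<^sup>L M return_value = mpart (emb x0 v* K.passage 0)"
proof -
  have "integral\<^sup>L M return_value = (\<integral>\<omega>. mpart (exit_state \<omega>) \<partial>M)"
    by (rule integral_cong_AE[OF return_value_measurable _ return_value_AE]) measurable
  also have "\<dots> = mpart (integral\<^sup>L M exit_state)"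
    by (rule integral_bounded_linear[OF bounded_linear_mpart exit_state_integrable])
  finally show ?thesis by (simp add: exit_state_expectation)
qed

lemma return_probability: "measure M {\<omega>\<in>space M. tau_minus \<R> A \<omega> < \<infinity>} = mpart (emb x0 v* K.passage 0) \<bullet> 1"
proof -
  note first_return_measurable[measurable]
  have "measure M {\<omega>\<in>space M. tau_minus \<R> A \<omega> < \<infinity>} = measure M {\<omega>\<in>space M. \<exists>n. first_return n \<omega>}"
    by (rule arg_cong[where f="measure M"]) (use tau_finite in auto)
  also have "\<dots> = measure M {\<omega>\<in>space M. \<exists>n. hit n \<omega>}"
  proof (rule measure_eq_AE)
    show "AE \<omega> in M. \<omega> \<in> {\<omega>\<in>space M. \<exists>n. first_return n \<omega>} \<longleftrightarrow> \<omega> \<in> {\<omega>\<in>space M. \<exists>n. hit n \<omega>}"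
      using no_ties AE_space by eventually_elim (use first_return_hit in auto)
  qed measurable
  also have "\<dots> = integral\<^sup>L M exit_state \<bullet> 1"
    by (simp add: hit_probability exit_state_expectation)
  also have "\<dots> = (\<integral>\<omega>. exit_state \<omega> \<bullet> 1 \<partial>M)" using exit_state_integrable by simp
  also have "\<dots> = (\<integral>\<omega>. mpart (exit_state \<omega>) \<bullet> 1 \<partial>M)"
    by (intro Bochner_Integration.integral_cong refl exit_state_down)
  also have "\<dots> = (\<integral>\<omega>. mpart (exit_state \<omega>) \<partial>M) \<bullet> 1"
    by (rule integral_inner_left) (use integrable_bounded_linear[OF bounded_linear_mpart exit_state_integrable] in auto)
  also have "(\<integral>\<omega>. mpart (exit_state \<omega>) \<partial>M) = mpart (integral\<^sup>L M exit_state)"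
    by (rule integral_bounded_linear[OF bounded_linear_mpart exit_state_integrable])
  finally show ?thesis by (simp add: exit_state_expectation)
qed

end

section \<open>Exponentially stable matrices and Sylvester equations\<close>

lemma exp_set_integrable:
  assumes l: "0 < (l::real)"
  shows "set_integrable lborel {0..} (\<lambda>t. exp (- (l * t)))"
proof -
  have "(\<integral>\<^sup>+t. ennreal (exp (- (l * t))) * indicator {0..} t \<partial>lborel) = ennreal (0 - (- exp (- (l * 0)) / l))"
  proof (rule nn_integral_FTC_atLeast)
    show "((\<lambda>t. - exp (- (l * t)) / l) has_real_derivative exp (- (l * t))) (at t)" for t
      using l by (auto intro!: derivative_eq_intros)
    have "((\<lambda>t. exp (- (l * t))) \<longlongrightarrow> 0) at_top"
      by (intro filterlim_compose[OF exp_at_bot] filterlim_compose[OF filterlim_uminus_at_bot_at_top]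
          filterlim_tendsto_pos_mult_at_top[OF tendsto_const l filterlim_ident])
    then have "((\<lambda>t. - exp (- (l * t)) / l) \<longlongrightarrow> - 0 / l) at_top"
      by (intro tendsto_intros) (use l in auto)
    then show "((\<lambda>t. - exp (- (l * t)) / l) \<longlongrightarrow> 0) at_top" by simp
  qed auto
  then show ?thesis
    unfolding set_integrable_def
    by (intro integrableI_nonneg) (auto simp: ennreal_indicator ennreal_mult' mult.commute)
qed

text \<open>Equivalently \<open>mexp (t *\<^sub>R C)\<close> tends to 0, by \<open>exp_stableI\<close> and \<open>exp_stable_tendsto\<close>.\<close>

definition exp_stable :: "real^'n::finite^'n \<Rightarrow> bool" where
  "exp_stable C \<longleftrightarrow> (\<exists>K l. 0 < l \<and> (\<forall>t\<ge>0. norm (mexp (t *\<^sub>R C)) \<le> K * exp (- (l * t))))"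

text \<open>
  At some time \<open>T\<close> the exponential is so small that multiplication by it halves all norms, whatever
  the constant of submultiplicativity; then apply the semigroup property.
\<close>

lemma exp_stableI:
  assumes lim: "((\<lambda>t. mexp (t *\<^sub>R C)) \<longlongrightarrow> 0) at_top"
  shows "exp_stable (C :: real^'n::finite^'n)"
proof -
  obtain c where c: "c > 0" "\<And>X (Y::real^'n^'n). norm ((X::real^'n^'n) ** Y) \<le> norm X * norm Y * c"
    using bounded_bilinear.pos_bounded[OF mm_bilin] by metis
  have "eventually (\<lambda>t. norm (mexp (t *\<^sub>R C)) < 1 / (2 * c)) at_top"
    using tendstoD[OF lim, of "1 / (2 * c)"] c(1) by simp
  then have "eventually (\<lambda>t. norm (mexp (t *\<^sub>R C)) < 1 / (2 * c) \<and> 0 < t) at_top"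
    using eventually_gt_at_top[of 0] by (rule eventually_conj)
  then obtain T where T: "norm (mexp (T *\<^sub>R C)) < 1 / (2 * c)" "0 < T"
    by (metis (no_types, lifting) eventually_at_top_linorder order_refl)
  have "compact ((\<lambda>t. mexp (t *\<^sub>R C)) ` {0..T})"
    by (intro compact_continuous_image continuous_intros) auto
  then have "bounded ((\<lambda>t. mexp (t *\<^sub>R C)) ` {0..T})" by (rule compact_imp_bounded)
  then have "\<exists>B. \<forall>t\<in>{0..T}. norm (mexp (t *\<^sub>R C)) \<le> B" by (simp add: bounded_iff)
  then obtain B where B: "\<And>t. 0 \<le> t \<Longrightarrow> t \<le> T \<Longrightarrow> norm (mexp (t *\<^sub>R C)) \<le> B"
    by (meson atLeastAtMost_iff)
  have B0: "0 \<le> B" using T(2) by (intro order_trans[OF norm_ge_zero B[of 0]]) auto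
  have step: "norm (mexp (t *\<^sub>R C)) \<le> B / 2 ^ k" if "real k * T \<le> t" "t \<le> (real k + 1) * T" for k t
    using that
  proof (induction k arbitrary: t)
    case 0
    then show ?case using B by simp
  next
    case (Suc k)
    have IH: "norm (mexp ((t - T) *\<^sub>R C)) \<le> B / 2 ^ k"
      by (rule Suc.IH) (use Suc.prems in \<open>auto simp: algebra_simps\<close>)
    have "norm (mexp (t *\<^sub>R C)) = norm (mexp (T *\<^sub>R C) ** mexp ((t - T) *\<^sub>R C))"
      using mexp_add[of T "t - T" C] by simp
    also have "\<dots> \<le> norm (mexp (T *\<^sub>R C)) * norm (mexp ((t - T) *\<^sub>R C)) * c" by (rule c)
    also have "\<dots> \<le> (1 / (2 * c)) * (B / 2 ^ k) * c"
      using T(1) IH c(1) B0 by (intro mult_right_mono mult_mono) auto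
    also have "\<dots> = B / 2 ^ Suc k" using c(1) by simp
    finally show ?case .
  qed
  have "norm (mexp (t *\<^sub>R C)) \<le> (2 * B) * exp (- ((ln 2 / T) * t))" if t: "0 \<le> t" for t
  proof -
    define k where "k = nat \<lfloor>t / T\<rfloor>"
    have k: "real k \<le> t / T" "t / T \<le> real k + 1"
    proof -
      have x: "0 \<le> t / T" using t T(2) by simp
      show "real k \<le> t / T" unfolding k_def using x by (rule of_nat_floor)
      show "t / T \<le> real k + 1" unfolding k_def using x by linarith
    qed
    then have "norm (mexp (t *\<^sub>R C)) \<le> B / 2 ^ k"
      using T(2) by (intro step) (simp_all add: field_simps)
    also have "\<dots> = B * exp (- (ln 2 * real k))"
      by (simp add: exp_minus divide_inverse mult.commute[of "ln 2"] exp_of_nat_mult)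
    also have "\<dots> \<le> B * (2 * exp (- ((ln 2 / T) * t)))"
    proof (intro mult_left_mono B0)
      have "exp (- (ln 2 * real k)) \<le> exp (ln 2 - ln 2 * (t / T))"
      proof -
        have "ln 2 * (t / T) \<le> ln 2 * (real k + 1)" by (intro mult_left_mono k) simp
        then show ?thesis by (simp add: distrib_left)
      qed
      also have "\<dots> = 2 * exp (- ((ln 2 / T) * t))" by (simp add: exp_diff exp_minus divide_inverse)
      finally show "exp (- (ln 2 * real k)) \<le> 2 * exp (- ((ln 2 / T) * t))" .
    qed
    finally show ?thesis by (simp add: mult.assoc mult.left_commute)
  qed
  moreover have "0 < ln 2 / T" using T(2) by simp
  ultimately show ?thesis unfolding exp_stable_def by blast
qed

lemma exp_stable_tendsto: "exp_stable C \<Longrightarrow> ((\<lambda>t. mexp (t *\<^sub>R C)) \<longlongrightarrow> 0) at_top"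
proof -
  assume "exp_stable C"
  then obtain K l where K: "0 < l" "\<And>t. 0 \<le> t \<Longrightarrow> norm (mexp (t *\<^sub>R C)) \<le> K * exp (- (l * t))"
    by (auto simp: exp_stable_def)
  have "((\<lambda>t. exp (- (l * t))) \<longlongrightarrow> 0) at_top"
    by (intro filterlim_compose[OF exp_at_bot] filterlim_compose[OF filterlim_uminus_at_bot_at_top]
        filterlim_tendsto_pos_mult_at_top[OF tendsto_const K(1) filterlim_ident])
  then have "((\<lambda>t. K * exp (- (l * t))) \<longlongrightarrow> 0) at_top" by (rule tendsto_mult_right_zero)
  then show ?thesis
    by (rule Lim_null_comparison[rotated]) (intro eventually_mono[OF eventually_ge_at_top[of "0::real"]] K(2))
qed

text \<open>The solution \<open>Y\<close> of \<open>C ** Y + Y ** C' = - X\<close>, by \<open>sylvester_equation\<close>.\<close>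

definition sylvester :: "real^'p::finite^'p \<Rightarrow> real^'m::finite^'m \<Rightarrow> real^'m^'p \<Rightarrow> real^'m^'p" where
  "sylvester C C' X = (LBINT y:{0..}. mexp (y *\<^sub>R C) ** X ** mexp (y *\<^sub>R C'))"

lemma sylvester_integrable:
  fixes C :: "real^'p::finite^'p" and C' :: "real^'m::finite^'m"
  assumes "exp_stable C" "exp_stable C'"
  shows "set_integrable lborel {0..} (\<lambda>y. mexp (y *\<^sub>R C) ** X ** mexp (y *\<^sub>R C'))"
proof -
  obtain K l where K: "0 < l" "\<And>t. 0 \<le> t \<Longrightarrow> norm (mexp (t *\<^sub>R C)) \<le> K * exp (- (l * t))"
    using assms(1) by (auto simp: exp_stable_def)
  obtain K' l' where K': "0 < l'" "\<And>t. 0 \<le> t \<Longrightarrow> norm (mexp (t *\<^sub>R C')) \<le> K' * exp (- (l' * t))"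
    using assms(2) by (auto simp: exp_stable_def)
  obtain c where c: "c > 0" "\<And>X (Y::real^'m^'p). norm ((X::real^'p^'p) ** Y) \<le> norm X * norm Y * c"
    using bounded_bilinear.pos_bounded[OF mm_bilin] by metis
  obtain d where d: "d > 0" "\<And>X (Y::real^'m^'m). norm ((X::real^'m^'p) ** Y) \<le> norm X * norm Y * d"
    using bounded_bilinear.pos_bounded[OF mm_bilin] by metis
  have K0: "0 \<le> K" "0 \<le> K'" using order_trans[OF norm_ge_zero K(2)[of 0]] order_trans[OF norm_ge_zero K'(2)[of 0]] by simp_all
  let ?B = "K * norm X * c * K' * d"
  have b: "norm (mexp (y *\<^sub>R C) ** X ** mexp (y *\<^sub>R C')) \<le> norm (?B * exp (- (l * y)))" if y: "0 \<le> y" for y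
  proof -
    have e1: "exp (- (l' * y)) \<le> 1" using y K'(1) by simp
    have n1: "norm (mexp (y *\<^sub>R C')) \<le> K'"
      using K'(2)[OF y] mult_left_mono[OF e1 K0(2)] by simp
    have "norm (mexp (y *\<^sub>R C) ** X ** mexp (y *\<^sub>R C')) \<le> norm (mexp (y *\<^sub>R C) ** X) * norm (mexp (y *\<^sub>R C')) * d" by (rule d)
    also have "\<dots> \<le> (norm (mexp (y *\<^sub>R C)) * norm X * c) * K' * d"
      using d(1) n1 c by (intro mult_right_mono mult_mono c) auto
    also have "\<dots> \<le> ((K * exp (- (l * y))) * norm X * c) * K' * d"
      using K(2)[OF y] c(1) d(1) K0 by (intro mult_right_mono) auto
    finally have "norm (mexp (y *\<^sub>R C) ** X ** mexp (y *\<^sub>R C')) \<le> ?B * exp (- (l * y))" by (simp add: mult_ac)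
    from order_trans[OF this abs_ge_self] show ?thesis by simp
  qed
  show ?thesis
  proof (rule set_integrable_bound)
    show "set_integrable lborel {0..} (\<lambda>y. ?B * exp (- (l * y)))"
      by (intro set_integrable_mult_right exp_set_integrable K(1))
    show "set_borel_measurable lborel {0..} (\<lambda>y. mexp (y *\<^sub>R C) ** X ** mexp (y *\<^sub>R C'))"
      unfolding set_borel_measurable_def measurable_lborel2
      by (intro borel_measurable_continuous_on_indicator continuous_on_mm continuous_intros) auto
  qed (use b in auto)
qed

lemma sylvester_derivative:
  "((\<lambda>y. mexp (y *\<^sub>R C) ** X ** mexp (y *\<^sub>R C')) has_vector_derivative
      (mexp (y *\<^sub>R C) ** (C ** X + X ** C') ** mexp (y *\<^sub>R C'))) (at y within T)"
  by (rule has_vector_derivative_eq_rhs[OF has_vector_derivative_mm[OF has_vector_derivative_mm[OF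
      has_vector_derivative_mexp' has_vector_derivative_const] has_vector_derivative_mexp]])
     (simp add: mm_simps matrix_mul_assoc)

lemma sylvester_inverse:
  fixes C :: "real^'p::finite^'p" and C' :: "real^'m::finite^'m"
  assumes st: "exp_stable C" "exp_stable C'"
  shows "sylvester C C' (C ** X + X ** C') = - X"
proof -
  let ?g = "\<lambda>y. mexp (y *\<^sub>R C) ** (C ** X + X ** C') ** mexp (y *\<^sub>R C')"
  let ?G = "\<lambda>y. mexp (y *\<^sub>R C) ** X ** mexp (y *\<^sub>R C')"
  have "((\<lambda>b. LBINT y:{0..b}. ?g y) \<longlongrightarrow> sylvester C C' (C ** X + X ** C')) at_top"
    unfolding sylvester_def
    by (rule tendsto_set_lebesgue_integral_at_top) (auto intro!: sylvester_integrable st)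
  moreover have "((\<lambda>b. LBINT y:{0..b}. ?g y) \<longlongrightarrow> - X) at_top"
  proof (rule Lim_transform_eventually)
    have "((\<lambda>b. ?G b - X) \<longlongrightarrow> 0 ** X ** 0 - X) at_top"
      by (intro tendsto_intros bounded_bilinear.tendsto[OF mm_bilin] exp_stable_tendsto st)
    then show "((\<lambda>b. ?G b - X) \<longlongrightarrow> - X) at_top" by (simp add: mm_simps)
    have "?G b - X = (LBINT y:{0..b}. ?g y)" if "0 \<le> b" for b
    proof -
      have "(LBINT y:{0..b}. ?g y) = ?G b - ?G 0"
        by (rule set_integral_FTC[OF that sylvester_derivative]) (intro continuous_on_mm continuous_intros)
      then show ?thesis by simp
    qed
    then show "\<forall>\<^sub>F b in at_top. ?G b - X = (LBINT y:{0..b}. ?g y)"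
      by (intro eventually_mono[OF eventually_ge_at_top[of "0::real"]]) simp
  qed
  ultimately show ?thesis by (rule tendsto_unique[rotated]) simp
qed

lemma sylvester_equation:
  fixes C :: "real^'p::finite^'p" and C' :: "real^'m::finite^'m"
  assumes st: "exp_stable C" "exp_stable C'"
  shows "C ** sylvester C C' X + sylvester C C' X ** C' = - X"
proof -
  note i = sylvester_integrable[OF st]
  have "C ** sylvester C C' X + sylvester C C' X ** C'
    = (LBINT y:{0..}. C ** (mexp (y *\<^sub>R C) ** X ** mexp (y *\<^sub>R C')) + (mexp (y *\<^sub>R C) ** X ** mexp (y *\<^sub>R C')) ** C')"
    unfolding sylvester_def
    by (subst set_integral_add) (auto simp: mm_integral_left[OF i] mm_integral_right[OF i])
  also have "\<dots> = sylvester C C' (C ** X + X ** C')"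
  proof -
    have "C ** (mexp (y *\<^sub>R C) ** X ** mexp (y *\<^sub>R C')) + (mexp (y *\<^sub>R C) ** X ** mexp (y *\<^sub>R C')) ** C'
      = mexp (y *\<^sub>R C) ** (C ** X + X ** C') ** mexp (y *\<^sub>R C')" for y
    proof -
      have "C ** (mexp (y *\<^sub>R C) ** X ** mexp (y *\<^sub>R C')) = (C ** mexp (y *\<^sub>R C)) ** X ** mexp (y *\<^sub>R C')"
        by (simp only: matrix_mul_assoc)
      moreover have "(mexp (y *\<^sub>R C) ** X ** mexp (y *\<^sub>R C')) ** C' = mexp (y *\<^sub>R C) ** X ** (C' ** mexp (y *\<^sub>R C'))"
        by (simp only: matrix_mul_assoc mexp_commute)
      ultimately show ?thesis by (simp only: mexp_commute[of C]) (simp add: mm_simps matrix_mul_assoc)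
    qed
    then show ?thesis by (simp only: sylvester_def)
  qed
  finally show ?thesis by (simp add: sylvester_inverse[OF st])
qed

lemma sylvester_diff:
  assumes st: "exp_stable C" "exp_stable C'"
  shows "sylvester C C' X - sylvester C C' Y = sylvester C C' (X - Y)"
  unfolding sylvester_def
  by (subst set_integral_diff(2)[symmetric]) (auto simp: sylvester_integrable[OF st] mm_simps)

section \<open>The least positive solution of the Riccati equation\<close>

text \<open>
  What the comparison needs of the return matrices: \<open>Fp r\<close> and \<open>Fm r\<close> stand for the blocks of the
  passage matrix of the fluid level that lead to negative rows, from positive and from negative
  ones. Then \<open>F_super\<close> says that from a positive orbit the level \<open>s\<close> can be exhausted by a return to the
  start followed by a descent by \<open>s\<close>, and \<open>F_minimal\<close> is minimality of the passage matrix.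
\<close>

locale riccati =
  fixes Zp :: "(real^'p::finite) set" and Zm :: "(real^'m::finite) set"
    and C :: "real^'p^'p" and C' :: "real^'m^'m" and D :: "real^'m^'p" and D' :: "real^'p^'m"
    and Fp :: "real \<Rightarrow> real^'m^'p" and Fm :: "real \<Rightarrow> real^'m^'m" and \<psi> :: "nat \<Rightarrow> real^'m^'p"
  assumes base: "mass_base Zp" "mass_base Zm"
    and stable: "exp_stable C" "exp_stable C'"
    and exp_pos: "\<And>t. 0 \<le> t \<Longrightarrow> mpos Zp Zp (mexp (t *\<^sub>R C))" "\<And>t. 0 \<le> t \<Longrightarrow> mpos Zm Zm (mexp (t *\<^sub>R C'))"
    and D_pos: "mpos Zp Zm D" "mpos Zm Zp D'"
    and rows: "C' *v 1 + D' *v 1 = 0"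
    and F_pos: "mpos Zp Zm (Fp 0)" and F_mass: "1 - Fp 0 *v 1 \<in> dual Zp" and Fm_0: "Fm 0 = mat 1"
    and Fp_ode: "(Fp has_vector_derivative - (C ** Fp 0 + D)) (at 0 within {0..})"
    and Fm_ode: "(Fm has_vector_derivative C' + D' ** Fp 0) (at 0 within {0..})"
    and F_super: "\<And>s. 0 \<le> s \<Longrightarrow> mpos Zp Zm (Fp s - Fp 0 ** Fm s)"
    and F_minimal: "\<And>hp hm. (\<And>r. 0 \<le> r \<Longrightarrow> mpos Zp Zm (hp r)) \<Longrightarrow> (\<And>r. 0 \<le> r \<Longrightarrow> mpos Zm Zm (hm r)) \<Longrightarrow>
        (\<And>r. 0 \<le> r \<Longrightarrow> (hp has_vector_derivative - (C ** hp r + D ** hm r)) (at r within {0..})) \<Longrightarrow>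
        (\<And>r. 0 \<le> r \<Longrightarrow> (hm has_vector_derivative C' ** hm r + D' ** hp r) (at r within {0..})) \<Longrightarrow>
        hm 0 = mat 1 \<Longrightarrow> mpos Zp Zm (hp 0 - Fp 0)"
    and psi_0: "\<psi> 0 = 0" and psi_Suc: "\<And>n. \<psi> (Suc n) = sylvester C C' (D + \<psi> n ** D' ** \<psi> n)"
begin

lemma sylvester_pos: "mpos Zp Zm X \<Longrightarrow> mpos Zp Zm (sylvester C C' X)"
  unfolding sylvester_def
  by (intro mpos_integral mpos_mult[where Y=Zm] mpos_mult[where Y=Zp] exp_pos) auto

lemma recursion: "C ** \<psi> (Suc n) + \<psi> (Suc n) ** C' = - D - \<psi> n ** D' ** \<psi> n"
  unfolding psi_Suc by (simp add: sylvester_equation[OF stable])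

text \<open>
  The inequality \<open>F_super\<close> is an equality at 0, so it passes to the derivatives there. It makes the
  return matrix a supersolution of the Riccati equation.
\<close>

lemma super: "mpos Zp Zm (- (C ** Fp 0 + Fp 0 ** C') - D - Fp 0 ** D' ** Fp 0)"
proof -
  let ?f = "\<lambda>s. Fp s - Fp 0 ** Fm s"
  let ?d = "- (C ** Fp 0 + D) - Fp 0 ** (C' + D' ** Fp 0)"
  have "(?f has_vector_derivative ?d) (at 0 within {0..})"
    by (rule has_vector_derivative_eq_rhs[OF has_vector_derivative_diff[OF Fp_ode has_vector_derivative_mm[OF has_vector_derivative_const Fm_ode]]])
       (simp add: mm_simps)
  moreover have f0: "?f 0 = 0" by (simp add: Fm_0)
  ultimately have "((\<lambda>s. (1 / s) *\<^sub>R ?f s) \<longlongrightarrow> ?d) (at 0 within {0..})"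
  proof -
    assume d: "(?f has_vector_derivative ?d) (at 0 within {0..})"
    have "((\<lambda>s. (1 / norm (s - 0)) *\<^sub>R (?f s - (?f 0 + (s - 0) *\<^sub>R ?d))) \<longlongrightarrow> 0) (at 0 within {0..})"
      using d unfolding has_vector_derivative_def has_derivative_within by blast
    then have "((\<lambda>s. (1 / s) *\<^sub>R ?f s - ?d) \<longlongrightarrow> 0) (at 0 within {0..})"
    proof (rule Lim_transform_eventually)
      show "\<forall>\<^sub>F s in at 0 within {0..}. (1 / norm (s - 0)) *\<^sub>R (?f s - (?f 0 + (s - 0) *\<^sub>R ?d)) = (1 / s) *\<^sub>R ?f s - ?d"
        unfolding f0 eventually_at by (intro exI[of _ 1]) (auto simp: scaleR_diff_right)
    qed
    then show ?thesis by (rule LIM_zero_cancel)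
  qed
  moreover have "at (0::real) within {0..} \<noteq> bot"
    by (simp add: at_within_halfline[of 0 0 1] at_within_Icc_at_right trivial_limit_at_right_real)
  moreover have "\<forall>\<^sub>F s in at 0 within {0..}. mpos Zp Zm ((1 / s) *\<^sub>R ?f s)"
    unfolding eventually_at
    by (intro exI[of _ 1]) (use F_super in \<open>auto simp: mpos_def bounded_bilinear.scaleR_left[OF mv_bilin] intro!: dual_scaleR\<close>)
  ultimately have pos: "mpos Zp Zm ?d" by (rule mpos_lim)
  have e: "?d = - (C ** Fp 0 + Fp 0 ** C') - D - Fp 0 ** D' ** Fp 0"
    by (simp add: mm_simps matrix_mul_assoc algebra_simps)
  show ?thesis using pos unfolding e .
qed

lemma product_pos: "mpos Zp Zm X \<Longrightarrow> mpos Zp Zm Y \<Longrightarrow> mpos Zp Zm (Y - X) \<Longrightarrow> mpos Zp Zm (Y ** D' ** Y - X ** D' ** X)"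
proof -
  assume p: "mpos Zp Zm X" "mpos Zp Zm Y" "mpos Zp Zm (Y - X)"
  have "Y ** D' ** Y - X ** D' ** X = (Y - X) ** D' ** Y + X ** D' ** (Y - X)" by (simp add: mm_simps)
  moreover have "mpos Zp Zm \<dots>"
    by (intro mpos_add mpos_mult[where Y=Zp] mpos_mult[where Y=Zm] p D_pos)
  ultimately show ?thesis by simp
qed

lemma psi_pos: "mpos Zp Zm (\<psi> n)"
proof (induction n)
  case (Suc n)
  then show ?case unfolding psi_Suc
    by (intro sylvester_pos mpos_add D_pos mpos_mult[where Y=Zp] mpos_mult[where Y=Zm])
qed (simp add: psi_0)

lemma psi_mono: "mpos Zp Zm (\<psi> (Suc n) - \<psi> n)"
proof (induction n)
  case 0
  then show ?case using psi_pos[of "Suc 0"] by (simp add: psi_0)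
next
  case (Suc n)
  have "\<psi> (Suc (Suc n)) - \<psi> (Suc n) = sylvester C C' (\<psi> (Suc n) ** D' ** \<psi> (Suc n) - \<psi> n ** D' ** \<psi> n)"
    by (simp only: psi_Suc[of "Suc n"] psi_Suc[of n] sylvester_diff[OF stable]) (simp add: psi_Suc[of n, symmetric])
  also have "mpos Zp Zm \<dots>" by (intro sylvester_pos product_pos psi_pos Suc)
  finally show ?case .
qed

text \<open>
  Both \<open>Fp 0\<close> and \<open>\<psi> (Suc n)\<close> are Sylvester integrals, the former by \<open>sylvester_inverse\<close>. The difference
  of the integrands is positive by \<open>super\<close> and the induction hypothesis.
\<close>

lemma psi_le: "mpos Zp Zm (Fp 0 - \<psi> n)"
proof (induction n)
  case 0
  then show ?case by (simp add: psi_0 F_pos)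
next
  case (Suc n)
  let ?G = "- (C ** Fp 0 + Fp 0 ** C') - D - Fp 0 ** D' ** Fp 0"
  have "Fp 0 = - sylvester C C' (C ** Fp 0 + Fp 0 ** C')" by (simp add: sylvester_inverse[OF stable])
  also have "\<dots> = sylvester C C' 0 - sylvester C C' (C ** Fp 0 + Fp 0 ** C')" by (simp add: sylvester_def mm_simps)
  also have "\<dots> = sylvester C C' (- (C ** Fp 0 + Fp 0 ** C'))" by (simp only: sylvester_diff[OF stable]) simp
  finally have "Fp 0 - \<psi> (Suc n) = sylvester C C' (- (C ** Fp 0 + Fp 0 ** C')) - sylvester C C' (D + \<psi> n ** D' ** \<psi> n)"
    by (simp only: psi_Suc)
  also have "\<dots> = sylvester C C' (?G + (Fp 0 ** D' ** Fp 0 - \<psi> n ** D' ** \<psi> n))"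
    unfolding sylvester_diff[OF stable]
    by (rule arg_cong[where f="sylvester C C'"]) (simp add: vec_eq_iff)
  also have "mpos Zp Zm \<dots>" by (intro sylvester_pos mpos_add super product_pos psi_pos F_pos Suc)
  finally show ?case .
qed

lemma psi_convergent: "convergent \<psi>"
proof (rule matrix_mono_convergent[OF base, of \<psi> 1, OF psi_mono])
  fix n z assume z: "z \<in> Zp"
  have "1 - Fp 0 *v 1 + (Fp 0 - \<psi> n) *v 1 \<in> dual Zp"
    by (intro dual_add F_mass mposD[OF psi_le] mass_base_one base)
  then have "1 - \<psi> n *v 1 \<in> dual Zp" by (simp add: mv_simps)
  then show "z \<bullet> (\<psi> n *v 1) \<le> 1" using z base by (auto simp: dual_def mass_base_def inner_diff_right)
qed

definition \<Psi> where "\<Psi> = lim \<psi>"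

lemma psi_tendsto: "\<psi> \<longlonglongrightarrow> \<Psi>"
  using psi_convergent by (simp add: \<Psi>_def convergent_LIMSEQ_iff)

lemma Psi_pos: "mpos Zp Zm \<Psi>"
  by (rule mpos_lim[OF psi_tendsto]) (auto intro: always_eventually psi_pos)

lemma Psi_le: "mpos Zp Zm (Fp 0 - \<Psi>)"
  by (rule mpos_lim[OF tendsto_diff[OF tendsto_const psi_tendsto]]) (auto intro!: always_eventually psi_le)

lemma Psi_riccati: "C ** \<Psi> + \<Psi> ** C' = - D - \<Psi> ** D' ** \<Psi>"
proof (rule LIMSEQ_unique)
  show "(\<lambda>n. C ** \<psi> (Suc n) + \<psi> (Suc n) ** C') \<longlonglongrightarrow> C ** \<Psi> + \<Psi> ** C'"
    by (intro tendsto_add bounded_bilinear.tendsto[OF mm_bilin] tendsto_const LIMSEQ_Suc psi_tendsto)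
  show "(\<lambda>n. C ** \<psi> (Suc n) + \<psi> (Suc n) ** C') \<longlonglongrightarrow> - D - \<Psi> ** D' ** \<Psi>"
    unfolding recursion
    by (intro tendsto_diff bounded_bilinear.tendsto[OF mm_bilin] tendsto_const psi_tendsto)
qed

text \<open>
  The exponential is itself a passage matrix: with the generator \<open>C'\<close> of the negative side as the
  flow, the excursions through the positive side as jumps \<open>D' ** \<Psi>\<close>, and all rows falling.
\<close>

lemma ladder_exp_pos:
  assumes r: "0 \<le> r" shows "mpos Zm Zm (mexp (r *\<^sub>R (C' + D' ** \<Psi>)))"
proof -
  interpret K: jump_kernel Zm C' "D' ** \<Psi>" "mat 1" 0
  proof
    have "1 - Fp 0 *v 1 + (Fp 0 - \<Psi>) *v 1 \<in> dual Zp"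
      by (intro dual_add F_mass mposD[OF Psi_le] mass_base_one base)
    then have "1 - \<Psi> *v 1 \<in> dual Zp" by (simp add: mv_simps)
    then have "D' *v (1 - \<Psi> *v 1) \<in> dual Zm" by (rule mposD[OF D_pos(2)])
    moreover have "- ((C' + D' ** \<Psi>) *v 1) = D' *v (1 - \<Psi> *v 1)"
      using rows by (simp add: mv_simps matrix_vector_mul_assoc[symmetric] add_eq_0_iff)
    ultimately show "- ((C' + D' ** \<Psi>) *v 1) \<in> dual Zm" by simp
  qed (auto simp: base exp_pos mm_simps intro: mpos_mult[where Y=Zp] D_pos Psi_pos)
  have "K.passage r = mexp (r *\<^sub>R (C' + D' ** \<Psi>)) ** K.passage 0"
    by (rule mexp_left_unique[OF _ r]) (use K.passage_ode in simp)
  moreover have "K.passage 0 = mat 1" using K.passage_0 by simp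
  ultimately have e: "K.passage r = mexp (r *\<^sub>R (C' + D' ** \<Psi>))" by simp
  show ?thesis unfolding e[symmetric] using K.passage_good r by (simp add: K.good_def)
qed

text \<open>
  By the Riccati equation \<open>\<Psi> ** mexp (r *\<^sub>R K)\<close> and \<open>mexp (r *\<^sub>R K)\<close> with \<open>K = C' + D' ** \<Psi>\<close> solve the
  system of \<open>F_minimal\<close>. Hence \<open>\<Psi>\<close> is above \<open>Fp 0\<close>; by \<open>Psi_le\<close> it is also below.
\<close>

lemma psi_limit: "\<psi> \<longlonglongrightarrow> Fp 0"
proof -
  let ?K = "C' + D' ** \<Psi>"
  have "mpos Zp Zm (\<Psi> ** mexp (0 *\<^sub>R ?K) - Fp 0)"
  proof (rule F_minimal[where hp="\<lambda>r. \<Psi> ** mexp (r *\<^sub>R ?K)" and hm="\<lambda>r. mexp (r *\<^sub>R ?K)"])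
    fix r :: real assume r: "0 \<le> r"
    show "mpos Zm Zm (mexp (r *\<^sub>R ?K))" by (rule ladder_exp_pos[OF r])
    then show "mpos Zp Zm (\<Psi> ** mexp (r *\<^sub>R ?K))" by (rule mpos_mult[OF Psi_pos])
    show "((\<lambda>r. mexp (r *\<^sub>R ?K)) has_vector_derivative C' ** mexp (r *\<^sub>R ?K) + D' ** (\<Psi> ** mexp (r *\<^sub>R ?K))) (at r within {0..})"
      by (rule has_vector_derivative_eq_rhs[OF has_vector_derivative_mexp]) (simp add: mm_simps matrix_mul_assoc)
    have "\<Psi> ** ?K = - (C ** \<Psi> + D)" using Psi_riccati by (simp add: mm_simps matrix_mul_assoc algebra_simps add_eq_0_iff eq_diff_eq)
    then have "\<Psi> ** ?K ** mexp (r *\<^sub>R ?K) = - (C ** (\<Psi> ** mexp (r *\<^sub>R ?K)) + D ** mexp (r *\<^sub>R ?K))"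
      by (simp only:) (simp add: mm_simps matrix_mul_assoc)
    then show "((\<lambda>r. \<Psi> ** mexp (r *\<^sub>R ?K)) has_vector_derivative - (C ** (\<Psi> ** mexp (r *\<^sub>R ?K)) + D ** mexp (r *\<^sub>R ?K))) (at r within {0..})"
      by (intro has_vector_derivative_eq_rhs[OF has_vector_derivative_mm[OF has_vector_derivative_const has_vector_derivative_mexp]])
         (simp add: mm_simps matrix_mul_assoc)
  qed simp
  then have "mpos Zp Zm (\<Psi> - Fp 0)" by simp
  then have "\<Psi> = Fp 0" using Psi_le by (rule mpos_antisym[OF base])
  then show ?thesis using psi_tendsto by simp
qed

end

section \<open>The return matrix of the process\<close>

definition block_pp :: "real^('p::finite + 'm::finite)^('p + 'm) \<Rightarrow> real^'p^'p" where "block_pp M = (\<chi> k l. M $ Inl k $ Inl l)"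
definition block_pm :: "real^('p::finite + 'm::finite)^('p + 'm) \<Rightarrow> real^'m^'p" where "block_pm M = (\<chi> k l. M $ Inl k $ Inr l)"
definition block_mp :: "real^('p::finite + 'm::finite)^('p + 'm) \<Rightarrow> real^'p^'m" where "block_mp M = (\<chi> k l. M $ Inr k $ Inl l)"
definition block_mm :: "real^('p::finite + 'm::finite)^('p + 'm) \<Rightarrow> real^'m^'m" where "block_mm M = (\<chi> k l. M $ Inr k $ Inr l)"

lemma bmat_blocks: "bmat (block_pp M) (block_pm M) (block_mp M) (block_mm M) = M"
  by (simp add: vec_eq_iff all_sum block_pp_def block_pm_def block_mp_def block_mm_def)

lemma blocks_bmat [simp]: "block_pp (bmat A B C D) = A" "block_pm (bmat A B C D) = B" "block_mp (bmat A B C D) = C" "block_mm (bmat A B C D) = D"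
  by (simp_all add: vec_eq_iff block_pp_def block_pm_def block_mp_def block_mm_def)

lemma has_vector_derivative_blocks:
  assumes "(F has_vector_derivative F') (at t within T)"
  shows "((\<lambda>t. block_pp (F t)) has_vector_derivative block_pp F') (at t within T)"
    "((\<lambda>t. block_pm (F t)) has_vector_derivative block_pm F') (at t within T)"
    "((\<lambda>t. block_mp (F t)) has_vector_derivative block_mp F') (at t within T)"
    "((\<lambda>t. block_mm (F t)) has_vector_derivative block_mm F') (at t within T)"
  by (rule has_vector_derivative_matrix,
      simp add: block_pp_def block_pm_def block_mp_def block_mm_def bounded_linear.has_vector_derivative[OF bounded_linear_entry assms])+

context
  fixes \<R> :: "('p::finite, 'm::finite, 'i::finite, 'j::finite) rap"
  assumes rap: "rap_data \<R>"
begin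

abbreviation "Zp \<equiv> \<Union>i. Zset_p \<R> i"
abbreviation "Zm \<equiv> \<Union>i. Zset_m \<R> i"
abbreviation "ZZ \<equiv> emb ` orbs \<R>"

lemma dual_cat: "cat a b \<in> dual ZZ \<longleftrightarrow> a \<in> dual Zp \<and> b \<in> dual Zm"
  unfolding emb_orbs[OF rap] dual_def by (auto simp: inner_cat ball_Un)

lemma mpos_bmat: "mpos ZZ ZZ (bmat A B C D) \<longleftrightarrow> mpos Zp Zp A \<and> mpos Zp Zm B \<and> mpos Zm Zp C \<and> mpos Zm Zm D"
proof safe
  assume m: "mpos ZZ ZZ (bmat A B C D)"
  have *: "A *v a + B *v b \<in> dual Zp \<and> C *v a + D *v b \<in> dual Zm" if "a \<in> dual Zp" "b \<in> dual Zm" for a b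
    using mposD[OF m, of "cat a b"] that by (simp add: dual_cat bmat_cat)
  from *[of _ 0] *[of 0]
  show "mpos Zp Zp A" "mpos Zp Zm B" "mpos Zm Zp C" "mpos Zm Zm D"
    by (auto simp: mpos_def mv_simps)
next
  assume m: "mpos Zp Zp A" "mpos Zp Zm B" "mpos Zm Zp C" "mpos Zm Zm D"
  show "mpos ZZ ZZ (bmat A B C D)"
    unfolding mpos_def
  proof
    fix w assume w: "w \<in> dual ZZ"
    obtain a b where ab: "w = cat a b" using cat_surj by blast
    then show "bmat A B C D *v w \<in> dual ZZ"
      using w m by (simp add: dual_cat bmat_cat dual_add mposD)
  qed
qed

lemma mpos_blocks:
  assumes "mpos ZZ ZZ M"
  shows "mpos Zp Zp (block_pp M)" "mpos Zp Zm (block_pm M)" "mpos Zm Zp (block_mp M)" "mpos Zm Zm (block_mm M)"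
  using assms by (subst (asm) bmat_blocks[symmetric], simp add: mpos_bmat)+

lemma D_pos: "mpos Zp Zm (D_pm \<R>)" "mpos Zm Zp (D_mp \<R>)"
proof -
  have "mpos ZZ ZZ (full_gen \<R> - flow_gen \<R>)"
    unfolding sum_jump_mat[symmetric] by (intro mpos_sum[OF rap] jump_mat_pos[OF rap])
  from mpos_blocks[OF this] show "mpos Zp Zm (D_pm \<R>)" "mpos Zm Zp (D_mp \<R>)"
    by (simp_all add: full_gen_def flow_gen_def bmat_simps)
qed

text \<open>
  With no rising side, a falling level is the time that remains: the orbit is read at time \<open>r\<close> if it
  has not left the side \<open>b\<close>.
\<close>

definition stay_matrix :: "bool \<Rightarrow> real \<Rightarrow> real^('p + 'm)^('p + 'm)" where
  "stay_matrix b = jump_kernel.passage (flow_gen \<R>) (full_gen \<R> - flow_gen \<R>) (side_proj {b}) (side_proj {})"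

definition return_matrix :: "real \<Rightarrow> real^('p + 'm)^('p + 'm)" where
  "return_matrix = jump_kernel.passage (flow_gen \<R>) (full_gen \<R> - flow_gen \<R>) (side_proj {False}) (side_proj {True})"

lemma stay_kernel: "jump_kernel ZZ (flow_gen \<R>) (full_gen \<R> - flow_gen \<R>) (side_proj {b}) (side_proj {})"
  by (rule jump_kernel_orbs[OF rap]) simp

lemma return_kernel: "jump_kernel ZZ (flow_gen \<R>) (full_gen \<R> - flow_gen \<R>) (side_proj {False}) (side_proj {True})"
  by (rule jump_kernel_orbs[OF rap]) simp

text \<open>
  The negative rows of the matrix vanish, being killed, so that \<open>passage_ode\<close> closes on the positive
  block.
\<close>

lemma stay_plus:
  assumes t: "0 \<le> t"
  shows "block_pp (stay_matrix True t) = mexp (t *\<^sub>R C_p \<R>)"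
proof -
  interpret K: jump_kernel ZZ "flow_gen \<R>" "full_gen \<R> - flow_gen \<R>" "side_proj {True}" "side_proj {}"
    by (rule stay_kernel)
  have S: "stay_matrix True = K.passage" by (simp add: stay_matrix_def)
  have "block_pp (K.passage t) = mexp (t *\<^sub>R C_p \<R>) ** block_pp (K.passage 0)"
  proof (rule mexp_left_unique[OF _ t])
    fix r :: real assume r: "0 \<le> r"
    have "block_mp (K.passage r) = 0"
      using arg_cong[OF K.passage_rest[OF r], of block_mp]
      by (subst (asm) bmat_blocks[of "K.passage r", symmetric])
         (simp add: side_proj_def bmat_mult bmat_mat1[symmetric] bmat_simps bmat_0[symmetric] mm_simps)
    then have "block_pp ((side_proj {True} - side_proj {}) ** full_gen \<R> ** K.passage r) = C_p \<R> ** block_pp (K.passage r)"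
      by (subst bmat_blocks[of "K.passage r", symmetric])
         (simp add: side_proj_def full_gen_def bmat_mult bmat_simps mm_simps)
    then show "((\<lambda>r. block_pp (K.passage r)) has_vector_derivative C_p \<R> ** block_pp (K.passage r)) (at r within {0..})"
      using has_vector_derivative_blocks(1)[OF K.passage_ode[OF r]] by simp
  qed
  moreover have "block_pp (K.passage 0) = mat 1"
  proof -
    have "block_pp (side_proj {True} ** K.passage 0) = block_pp (side_proj {True} :: real^('p + 'm)^('p + 'm))" by (simp only: K.passage_0)
    then show ?thesis
      by (subst (asm) bmat_blocks[of "K.passage 0", symmetric]) (simp add: side_proj_def bmat_mult mm_simps)
  qed
  ultimately show ?thesis by (simp add: S)
qed

lemma stay_minus:
  assumes t: "0 \<le> t"
  shows "block_mm (stay_matrix False t) = mexp (t *\<^sub>R C_m \<R>)"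
proof -
  interpret K: jump_kernel ZZ "flow_gen \<R>" "full_gen \<R> - flow_gen \<R>" "side_proj {False}" "side_proj {}"
    by (rule stay_kernel)
  have S: "stay_matrix False = K.passage" by (simp add: stay_matrix_def)
  have "block_mm (K.passage t) = mexp (t *\<^sub>R C_m \<R>) ** block_mm (K.passage 0)"
  proof (rule mexp_left_unique[OF _ t])
    fix r :: real assume r: "0 \<le> r"
    have "block_pm (K.passage r) = 0"
      using arg_cong[OF K.passage_rest[OF r], of block_pm]
      by (subst (asm) bmat_blocks[of "K.passage r", symmetric])
         (simp add: side_proj_def bmat_mult bmat_mat1[symmetric] bmat_simps bmat_0[symmetric] mm_simps)
    then have "block_mm ((side_proj {False} - side_proj {}) ** full_gen \<R> ** K.passage r) = C_m \<R> ** block_mm (K.passage r)"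
      by (subst bmat_blocks[of "K.passage r", symmetric])
         (simp add: side_proj_def full_gen_def bmat_mult bmat_simps mm_simps)
    then show "((\<lambda>r. block_mm (K.passage r)) has_vector_derivative C_m \<R> ** block_mm (K.passage r)) (at r within {0..})"
      using has_vector_derivative_blocks(4)[OF K.passage_ode[OF r]] by simp
  qed
  moreover have "block_mm (K.passage 0) = mat 1"
  proof -
    have "block_mm (side_proj {False} ** K.passage 0) = block_mm (side_proj {False} :: real^('p + 'm)^('p + 'm))" by (simp only: K.passage_0)
    then show ?thesis
      by (subst (asm) bmat_blocks[of "K.passage 0", symmetric]) (simp add: side_proj_def bmat_mult mm_simps)
  qed
  ultimately show ?thesis by (simp add: S)
qed

lemma stay_pos: "0 \<le> t \<Longrightarrow> mpos ZZ ZZ (stay_matrix b t)"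
  using jump_kernel.passage_good[OF stay_kernel, of b] by (simp add: stay_matrix_def jump_kernel.good_def[OF stay_kernel])

lemma exp_pos: "0 \<le> t \<Longrightarrow> mpos Zp Zp (mexp (t *\<^sub>R C_p \<R>))" "0 \<le> t \<Longrightarrow> mpos Zm Zm (mexp (t *\<^sub>R C_m \<R>))"
  using mpos_blocks(1)[OF stay_pos[of t True]] mpos_blocks(4)[OF stay_pos[of t False]] stay_plus[of t] stay_minus[of t] by auto

lemma orbit_pdmpI:
  assumes "orbit_process \<R> P A" and x: "x \<in> orbs \<R>"
  obtains S L where "orbit_pdmp (P x) \<R> A x S L"
proof -
  have "pdmp (P x) A (orbs \<R>) (orbit_flow \<R>) (orbit_rate \<R>) (orbit_jump \<R>) x"
    using assms by (simp add: orbit_process_def orbs_def)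
  then obtain S L where
    1: "prob_space (P x)" "\<forall>n. S n \<in> borel_measurable (P x) \<and> L n \<in> measurable (P x) (count_space UNIV)"
    and 2: "\<forall>\<omega>\<in>space (P x). (\<forall>n. 0 < S n \<omega>) \<and> (\<forall>t. \<exists>n. ereal t < jump_time S n \<omega>) \<and> (\<forall>t\<ge>0. A t \<omega> \<in> orbs \<R>) \<and>
        (\<forall>n t. jump_time S n \<omega> \<le> ereal t \<and> ereal t < jump_time S (Suc n) \<omega> \<longrightarrow>
          A t \<omega> = orbit_flow \<R> (t - real_of_ereal (jump_time S n \<omega>)) (post_jump (orbit_flow \<R>) (orbit_jump \<R>) x S L n \<omega>))"
    and 3: "\<forall>n l u. 0 \<le> u \<longrightarrow> (AE \<omega> in P x. jump_time S n \<omega> < \<infinity> \<longrightarrow>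
        real_cond_exp (P x) (history (P x) S L n) (indicator {\<omega>\<in>space (P x). S n \<omega> \<le> ereal u \<and> L n \<omega> = l}) \<omega> =
        (LBINT s:{0..u}. orbit_rate \<R> l (orbit_flow \<R> s (post_jump (orbit_flow \<R>) (orbit_jump \<R>) x S L n \<omega>)) *
           exp (- (LBINT v:{0..s}. \<Sum>k\<in>UNIV. orbit_rate \<R> k (orbit_flow \<R> v (post_jump (orbit_flow \<R>) (orbit_jump \<R>) x S L n \<omega>))))))"
    unfolding pdmp_def by (elim conjE exE) (rule that)
  have "orbit_pdmp (P x) \<R> A x S L"
  proof (intro orbit_pdmp.intro orbit_pdmp_axioms.intro)
    show "prob_space (P x)" "rap_data \<R>" "x \<in> orbs \<R>" by (fact 1 rap x)+
  qed (use 1 2 3 in \<open>(blast | simp)+\<close>)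
  then show ?thesis by (rule that)
qed

lemma stay_law:
  assumes P: "orbit_process \<R> P A" and x: "x \<in> orbs \<R>" and t: "0 \<le> t"
  shows "measure (P x) {\<omega>\<in>space (P x). \<forall>s\<in>{0..t}. isl (A s \<omega>) = b} = (emb x v* stay_matrix b t) \<bullet> 1"
proof -
  obtain S L where "orbit_pdmp (P x) \<R> A x S L" by (rule orbit_pdmpI[OF P x])
  then interpret orbit_pdmp "P x" \<R> A x S L .
  interpret orbit_passage "P x" \<R> A x S L "{}" "{b}" t
    by unfold_locales (use t in auto)
  show ?thesis unfolding stay_matrix_def by (rule stay_probability) auto
qed

text \<open>The mass of the stay matrix is the probability in the nontriviality assumption.\<close>

lemma stay_vanishes:
  assumes P: "orbit_process \<R> P A" and nt: "nontrivial \<R> P A" and x: "x \<in> orbs \<R>" and b: "isl x = b"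
  shows "((\<lambda>t. (emb x v* stay_matrix b t) \<bullet> 1) \<longlongrightarrow> 0) at_top"
proof -
  define Z where "Z = (if b then orbits_p \<R> else orbits_m \<R>)"
  have xZ: "x \<in> Z" using orbs_sides[OF rap x] b by (auto simp: Z_def)
  have "Z \<in> {orbits_p \<R>, orbits_m \<R>}" by (simp add: Z_def)
  then have lim: "((\<lambda>t. measure (P x) {\<omega>\<in>space (P x). \<forall>s\<in>{0..t}. A s \<omega> \<in> Z}) \<longlongrightarrow> 0) at_top"
    using nt xZ unfolding nontrivial_def by blast
  obtain S L where "orbit_pdmp (P x) \<R> A x S L" by (rule orbit_pdmpI[OF P x])
  then interpret orbit_pdmp "P x" \<R> A x S L .
  have side: "A s \<omega> \<in> Z \<longleftrightarrow> isl (A s \<omega>) = b" if "\<omega> \<in> space (P x)" "0 \<le> s" for s \<omega>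
    using orbs_sides[OF rap in_orbs[OF that]] by (auto simp: Z_def)
  have "measure (P x) {\<omega>\<in>space (P x). \<forall>s\<in>{0..t}. A s \<omega> \<in> Z} = (emb x v* stay_matrix b t) \<bullet> 1" if "0 \<le> t" for t
  proof -
    have "{\<omega>\<in>space (P x). \<forall>s\<in>{0..t}. A s \<omega> \<in> Z} = {\<omega>\<in>space (P x). \<forall>s\<in>{0..t}. isl (A s \<omega>) = b}"
      using side by auto
    then show ?thesis using stay_law[OF P x that] by simp
  qed
  then show ?thesis
    by (intro Lim_transform_eventually[OF lim] eventually_mono[OF eventually_ge_at_top[of "0::real"]])
qed

text \<open>For positive matrices the norm of a row is controlled by its mass, by \<open>mpos_row_bound\<close>.\<close>

lemma stable_from_mass:
  fixes C :: "real^'n::finite^'n"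
  assumes Z: "mass_base Z" and pos: "\<And>t. 0 \<le> t \<Longrightarrow> mpos Z Z (mexp (t *\<^sub>R C))"
    and lim: "\<And>z. z \<in> Z \<Longrightarrow> ((\<lambda>t. z \<bullet> (mexp (t *\<^sub>R C) *v 1)) \<longlongrightarrow> 0) at_top"
  shows "exp_stable C"
proof (rule exp_stableI, rule matrix_tendsto_0[OF Z])
  fix z assume z: "z \<in> Z"
  obtain \<kappa> where k: "\<kappa> > 0" "\<And>M z. mpos Z Z M \<Longrightarrow> z \<in> Z \<Longrightarrow> norm (z v* M) \<le> \<kappa> * (z \<bullet> (M *v 1))"
    by (rule mpos_row_bound[OF Z]) blast
  show "((\<lambda>t. z v* mexp (t *\<^sub>R C)) \<longlongrightarrow> 0) at_top"
  proof (rule Lim_null_comparison)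
    show "((\<lambda>t. \<kappa> * (z \<bullet> (mexp (t *\<^sub>R C) *v 1))) \<longlongrightarrow> 0) at_top"
      by (rule tendsto_mult_right_zero[OF lim[OF z]])
    show "\<forall>\<^sub>F t in at_top. norm (z v* mexp (t *\<^sub>R C)) \<le> \<kappa> * (z \<bullet> (mexp (t *\<^sub>R C) *v 1))"
      by (intro eventually_mono[OF eventually_ge_at_top[of "0::real"]] k(2) pos z)
  qed
qed

text \<open>
  The mass of \<open>mexp (t *\<^sub>R C)\<close> is only one of the two blocks of the mass of the stay matrix; the other
  block is positive.
\<close>

lemma stable:
  assumes P: "orbit_process \<R> P A" and nt: "nontrivial \<R> P A"
  shows "exp_stable (C_p \<R>)" "exp_stable (C_m \<R>)"
proof -
  show "exp_stable (C_p \<R>)"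
  proof (rule stable_from_mass[OF mass_base_p[OF rap] exp_pos(1)])
    fix z assume z: "z \<in> Zp"
    then have x: "(Inl z :: ('p, 'm) orbit) \<in> orbs \<R>" by (auto simp: orbs_def orbits_p_def)
    show "((\<lambda>t. z \<bullet> (mexp (t *\<^sub>R C_p \<R>) *v 1)) \<longlongrightarrow> 0) at_top"
    proof (rule tendsto_sandwich[OF _ _ tendsto_const stay_vanishes[OF P nt x]])
      have b: "0 \<le> z \<bullet> (mexp (t *\<^sub>R C_p \<R>) *v 1) \<and> z \<bullet> (mexp (t *\<^sub>R C_p \<R>) *v 1) \<le> (emb (Inl z :: ('p, 'm) orbit) v* stay_matrix True t) \<bullet> 1" if t: "0 \<le> t" for t
      proof -
        let ?M = "stay_matrix True t"
        have "block_pm ?M *v 1 \<in> dual Zp" "block_pp ?M *v 1 \<in> dual Zp"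
          using mpos_blocks[OF stay_pos[OF t, of True]] mass_base_one[OF mass_base_p[OF rap]] mass_base_one[OF mass_base_m[OF rap]] by (auto simp: mpos_def)
        then have "0 \<le> z \<bullet> (block_pm ?M *v 1)" "0 \<le> z \<bullet> (block_pp ?M *v 1)" using z by (auto simp: dual_def)
        moreover have "(emb (Inl z :: ('p, 'm) orbit) v* ?M) \<bullet> 1 = z \<bullet> (block_pp ?M *v 1) + z \<bullet> (block_pm ?M *v 1)"
          by (subst bmat_blocks[of ?M, symmetric]) (simp add: cat_bmat vm_simps inner_cat_one dot_lmul_matrix)
        ultimately show ?thesis using stay_plus[OF t] by simp
      qed
      show "\<forall>\<^sub>F t in at_top. 0 \<le> z \<bullet> (mexp (t *\<^sub>R C_p \<R>) *v 1)"
        by (intro eventually_mono[OF eventually_ge_at_top[of "0::real"]]) (use b in blast)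
      show "\<forall>\<^sub>F t in at_top. z \<bullet> (mexp (t *\<^sub>R C_p \<R>) *v 1) \<le> (emb (Inl z :: ('p, 'm) orbit) v* stay_matrix True t) \<bullet> 1"
        by (intro eventually_mono[OF eventually_ge_at_top[of "0::real"]]) (use b in blast)
    qed simp
  qed
  show "exp_stable (C_m \<R>)"
  proof (rule stable_from_mass[OF mass_base_m[OF rap] exp_pos(2)])
    fix z assume z: "z \<in> Zm"
    then have x: "(Inr z :: ('p, 'm) orbit) \<in> orbs \<R>" by (auto simp: orbs_def orbits_m_def)
    show "((\<lambda>t. z \<bullet> (mexp (t *\<^sub>R C_m \<R>) *v 1)) \<longlongrightarrow> 0) at_top"
    proof (rule tendsto_sandwich[OF _ _ tendsto_const stay_vanishes[OF P nt x]])
      have b: "0 \<le> z \<bullet> (mexp (t *\<^sub>R C_m \<R>) *v 1) \<and> z \<bullet> (mexp (t *\<^sub>R C_m \<R>) *v 1) \<le> (emb (Inr z :: ('p, 'm) orbit) v* stay_matrix False t) \<bullet> 1" if t: "0 \<le> t" for t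
      proof -
        let ?M = "stay_matrix False t"
        have "block_mp ?M *v 1 \<in> dual Zm" "block_mm ?M *v 1 \<in> dual Zm"
          using mpos_blocks[OF stay_pos[OF t, of False]] mass_base_one[OF mass_base_p[OF rap]] mass_base_one[OF mass_base_m[OF rap]] by (auto simp: mpos_def)
        then have "0 \<le> z \<bullet> (block_mp ?M *v 1)" "0 \<le> z \<bullet> (block_mm ?M *v 1)" using z by (auto simp: dual_def)
        moreover have "(emb (Inr z :: ('p, 'm) orbit) v* ?M) \<bullet> 1 = z \<bullet> (block_mp ?M *v 1) + z \<bullet> (block_mm ?M *v 1)"
          by (subst bmat_blocks[of ?M, symmetric]) (simp add: cat_bmat vm_simps inner_cat_one dot_lmul_matrix)
        ultimately show ?thesis using stay_minus[OF t] by simp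
      qed
      show "\<forall>\<^sub>F t in at_top. 0 \<le> z \<bullet> (mexp (t *\<^sub>R C_m \<R>) *v 1)"
        by (intro eventually_mono[OF eventually_ge_at_top[of "0::real"]]) (use b in blast)
      show "\<forall>\<^sub>F t in at_top. z \<bullet> (mexp (t *\<^sub>R C_m \<R>) *v 1) \<le> (emb (Inr z :: ('p, 'm) orbit) v* stay_matrix False t) \<bullet> 1"
        by (intro eventually_mono[OF eventually_ge_at_top[of "0::real"]]) (use b in blast)
    qed simp
  qed
qed

text \<open>
  Read \<open>passage_ode\<close> by blocks; on the positive rows the sign is reversed because there the level
  rises. A pair as in \<open>F_minimal\<close> becomes a solution on the joint space with zero blocks in the
  positive columns.
\<close>

lemma riccati_return:
  assumes P: "orbit_process \<R> P A" and nt: "nontrivial \<R> P A"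
  shows "riccati Zp Zm (C_p \<R>) (C_m \<R>) (D_pm \<R>) (D_mp \<R>) (\<lambda>r. block_pm (return_matrix r)) (\<lambda>r. block_mm (return_matrix r)) (Psi \<R>)"
proof -
  interpret K: jump_kernel ZZ "flow_gen \<R>" "full_gen \<R> - flow_gen \<R>" "side_proj {False}" "side_proj {True}"
    by (rule return_kernel)
  have F: "return_matrix = K.passage" by (simp add: return_matrix_def)
  let ?F = return_matrix
  have pos: "mpos ZZ ZZ (?F r)" "1 - ?F r *v 1 \<in> dual ZZ" if "0 \<le> r" for r
    using K.passage_good that by (auto simp: F K.good_def)
  have gen: "(side_proj {False} - side_proj {True}) ** (flow_gen \<R> + (full_gen \<R> - flow_gen \<R>)) ** bmat a b c d
     = bmat (- (C_p \<R> ** a + D_pm \<R> ** c)) (- (C_p \<R> ** b + D_pm \<R> ** d)) (D_mp \<R> ** a + C_m \<R> ** c) (D_mp \<R> ** b + C_m \<R> ** d)" for a b c d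
    by (simp add: side_proj_def full_gen_def bmat_simps bmat_mult mm_simps)
  have ode: "((\<lambda>r. block_pm (?F r)) has_vector_derivative - (C_p \<R> ** block_pm (?F r) + D_pm \<R> ** block_mm (?F r))) (at r within {0..})"
    "((\<lambda>r. block_mm (?F r)) has_vector_derivative D_mp \<R> ** block_pm (?F r) + C_m \<R> ** block_mm (?F r)) (at r within {0..})" if "0 \<le> r" for r
  proof -
    have "(?F has_vector_derivative (side_proj {False} - side_proj {True}) ** (flow_gen \<R> + (full_gen \<R> - flow_gen \<R>)) ** bmat (block_pp (?F r)) (block_pm (?F r)) (block_mp (?F r)) (block_mm (?F r))) (at r within {0..})"
      using K.passage_ode[OF that] by (simp only: F bmat_blocks)
    from has_vector_derivative_blocks[OF this[unfolded gen]]
    show "((\<lambda>r. block_pm (?F r)) has_vector_derivative - (C_p \<R> ** block_pm (?F r) + D_pm \<R> ** block_mm (?F r))) (at r within {0..})"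
      "((\<lambda>r. block_mm (?F r)) has_vector_derivative D_mp \<R> ** block_pm (?F r) + C_m \<R> ** block_mm (?F r)) (at r within {0..})" by auto
  qed
  have mm0: "block_mm (?F 0) = mat 1"
  proof -
    have "block_mm (side_proj {False} ** ?F 0) = block_mm (side_proj {False} :: real^('p + 'm)^('p + 'm))" by (simp only: F K.passage_0)
    then show ?thesis
      by (subst (asm) bmat_blocks[of "?F 0", symmetric]) (simp add: side_proj_def bmat_mult mm_simps)
  qed
  show ?thesis
  proof
    show "mass_base Zp" "mass_base Zm" by (rule mass_base_p[OF rap], rule mass_base_m[OF rap])
    show "exp_stable (C_p \<R>)" "exp_stable (C_m \<R>)" by (rule stable[OF P nt])+
    show "mpos Zp Zp (mexp (t *\<^sub>R C_p \<R>))" "mpos Zm Zm (mexp (t *\<^sub>R C_m \<R>))" if "0 \<le> t" for t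
      by (rule exp_pos[OF that])+
    show "mpos Zp Zm (D_pm \<R>)" "mpos Zm Zp (D_mp \<R>)" by (rule D_pos)+
    show "C_m \<R> *v 1 + D_mp \<R> *v 1 = 0" using rap by (simp add: rap_data_def)
    show "mpos Zp Zm (block_pm (?F 0))" by (rule mpos_blocks[OF pos(1)]) simp
    show "1 - block_pm (?F 0) *v 1 \<in> dual Zp"
    proof -
      have "1 - bmat (block_pp (?F 0)) (block_pm (?F 0)) (block_mp (?F 0)) (block_mm (?F 0)) *v 1 \<in> dual ZZ" using pos(2)[of 0] by (simp only: bmat_blocks)
      then have "1 - (block_pp (?F 0) *v 1 + block_pm (?F 0) *v 1) \<in> dual Zp"
        by (simp add: cat_consts(2)[symmetric] bmat_cat cat_simps dual_cat)
      moreover have "block_pp (?F 0) *v 1 \<in> dual Zp"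
        by (rule mposD[OF mpos_blocks(1)[OF pos(1)] mass_base_one[OF mass_base_p[OF rap]]]) simp
      ultimately have "1 - (block_pp (?F 0) *v 1 + block_pm (?F 0) *v 1) + block_pp (?F 0) *v 1 \<in> dual Zp" by (rule dual_add)
      then show ?thesis by (simp add: algebra_simps)
    qed
    show "block_mm (?F 0) = mat 1" by (rule mm0)
    show "((\<lambda>r. block_pm (?F r)) has_vector_derivative - (C_p \<R> ** block_pm (?F 0) + D_pm \<R>)) (at 0 within {0..})"
      using ode(1)[of 0] by (simp add: mm0)
    show "((\<lambda>r. block_mm (?F r)) has_vector_derivative C_m \<R> + D_mp \<R> ** block_pm (?F 0)) (at 0 within {0..})"
      using ode(2)[of 0] by (simp add: mm0 add.commute)
    show "mpos Zp Zm (block_pm (?F s) - block_pm (?F 0) ** block_mm (?F s))" if s: "0 \<le> s" for s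
    proof -
      have "mpos ZZ ZZ (?F (0 + s) - ?F 0 ** (side_proj {False} ** ?F s))"
        unfolding F by (rule K.passage_super) (use s in auto)
      then have "mpos ZZ ZZ (bmat (block_pp (?F s)) (block_pm (?F s)) (block_mp (?F s)) (block_mm (?F s)) -
          bmat (block_pp (?F 0)) (block_pm (?F 0)) (block_mp (?F 0)) (block_mm (?F 0)) ** (side_proj {False} ** bmat (block_pp (?F s)) (block_pm (?F s)) (block_mp (?F s)) (block_mm (?F s))))"
        by (simp only: bmat_blocks add_0)
      then show ?thesis by (simp add: side_proj_def bmat_mult bmat_simps mm_simps mpos_bmat)
    qed
    show "mpos Zp Zm (hp 0 - block_pm (?F 0))"
      if hp: "\<And>r. 0 \<le> r \<Longrightarrow> mpos Zp Zm (hp r)" and hm: "\<And>r. 0 \<le> r \<Longrightarrow> mpos Zm Zm (hm r)"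
        and hp': "\<And>r. 0 \<le> r \<Longrightarrow> (hp has_vector_derivative - (C_p \<R> ** hp r + D_pm \<R> ** hm r)) (at r within {0..})"
        and hm': "\<And>r. 0 \<le> r \<Longrightarrow> (hm has_vector_derivative C_m \<R> ** hm r + D_mp \<R> ** hp r) (at r within {0..})"
        and hm0: "hm 0 = mat 1" for hp hm
    proof -
      have "mpos ZZ ZZ (bmat 0 (hp 0) 0 (hm 0) - K.passage 0 ** side_proj {False})"
      proof (rule K.passage_minimal[where h="\<lambda>r. bmat 0 (hp r) 0 (hm r)"])
        show "mpos ZZ ZZ (bmat 0 (hp r) 0 (hm r))" if "0 \<le> r" for r
          using hp[OF that] hm[OF that] by (simp add: mpos_bmat)
        show "((\<lambda>r. bmat 0 (hp r) 0 (hm r)) has_vector_derivative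
            (side_proj {False} - side_proj {True}) ** (flow_gen \<R> + (full_gen \<R> - flow_gen \<R>)) ** bmat 0 (hp r) 0 (hm r)) (at r within {0..})" if "0 \<le> r" for r
          unfolding gen
          by (rule has_vector_derivative_bmat)
             (use hp'[OF that] hm'[OF that] in \<open>simp_all add: mm_simps add.commute\<close>)
        show "mpos ZZ ZZ (side_proj {False} ** (bmat 0 (hp 0) 0 (hm 0) - side_proj {False}))"
          by (simp add: side_proj_def bmat_mult bmat_simps mm_simps hm0 bmat_0)
      qed simp
      then have "mpos ZZ ZZ (bmat 0 (hp 0) 0 (hm 0) - bmat (block_pp (?F 0)) (block_pm (?F 0)) (block_mp (?F 0)) (block_mm (?F 0)) ** side_proj {False})"
        by (simp only: F bmat_blocks)
      then show ?thesis by (simp add: side_proj_def bmat_mult bmat_simps mm_simps mpos_bmat)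
    qed
    show "Psi \<R> 0 = 0" by simp
    show "Psi \<R> (Suc n) = sylvester (C_p \<R>) (C_m \<R>) (D_pm \<R> + Psi \<R> n ** D_mp \<R> ** Psi \<R> n)" for n
      by (simp add: sylvester_def)
  qed
qed

end

theorem corollary4p2:
  fixes \<R> :: "('p::finite, 'm::finite, 'i::finite, 'j::finite) rap"
    and P :: "('p, 'm) orbit \<Rightarrow> 'w measure"
    and A :: "real \<Rightarrow> 'w \<Rightarrow> ('p, 'm) orbit"
  assumes "rap_data \<R>"
    and "orbit_process \<R> P A"
    and "nontrivial \<R> P A"
  shows "(\<forall>n. C_p \<R> ** Psi \<R> (Suc n) + Psi \<R> (Suc n) ** C_m \<R>
              = - D_pm \<R> - Psi \<R> n ** D_mp \<R> ** Psi \<R> n) \<and>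
         (\<exists>\<Psi>. Psi \<R> \<longlonglongrightarrow> \<Psi> \<and>
            (\<forall>i. \<forall>\<alpha>\<in>Zset_p \<R> i.
               integral\<^sup>L (P (Inl \<alpha>)) (\<lambda>\<omega>. if tau_minus \<R> A \<omega> < \<infinity>
                   then minus_part (A (real_of_ereal (tau_minus \<R> A \<omega>)) \<omega>) else 0) = \<alpha> v* \<Psi> \<and>
               measure (P (Inl \<alpha>)) {\<omega>\<in>space (P (Inl \<alpha>)). tau_minus \<R> A \<omega> < \<infinity>}
                 = (\<alpha> v* \<Psi>) \<bullet> 1))"
proof -
  interpret riccati "\<Union>i. Zset_p \<R> i" "\<Union>i. Zset_m \<R> i" "C_p \<R>" "C_m \<R>" "D_pm \<R>" "D_mp \<R>"
    "\<lambda>r. block_pm (return_matrix \<R> r)" "\<lambda>r. block_mm (return_matrix \<R> r)" "Psi \<R>"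
    by (rule riccati_return[OF assms])
  have "integral\<^sup>L (P (Inl \<alpha>)) (\<lambda>\<omega>. if tau_minus \<R> A \<omega> < \<infinity>
                   then minus_part (A (real_of_ereal (tau_minus \<R> A \<omega>)) \<omega>) else 0) = \<alpha> v* block_pm (return_matrix \<R> 0) \<and>
        measure (P (Inl \<alpha>)) {\<omega>\<in>space (P (Inl \<alpha>)). tau_minus \<R> A \<omega> < \<infinity>} = (\<alpha> v* block_pm (return_matrix \<R> 0)) \<bullet> 1"
    if \<alpha>: "\<alpha> \<in> Zset_p \<R> i" for i \<alpha>
  proof -
    have x: "(Inl \<alpha> :: ('p, 'm) orbit) \<in> orbs \<R>" using \<alpha> by (auto simp: orbs_def orbits_p_def)
    obtain S L where "orbit_pdmp (P (Inl \<alpha>)) \<R> A (Inl \<alpha>) S L" by (rule orbit_pdmpI[OF assms(1,2) x])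
    then interpret T: orbit_pdmp "P (Inl \<alpha>)" \<R> A "Inl \<alpha>" S L .
    interpret T: up_down "P (Inl \<alpha>)" \<R> A "Inl \<alpha>" S L
      by unfold_locales auto
    have "mpart (emb (Inl \<alpha> :: ('p, 'm) orbit) v* return_matrix \<R> 0) = \<alpha> v* block_pm (return_matrix \<R> 0)"
      by (subst bmat_blocks[of "return_matrix \<R> 0", symmetric]) (simp add: cat_bmat vm_simps)
    then show ?thesis
      using T.return_expectation T.return_probability
      by (simp add: return_matrix_def[OF assms(1)] T.return_value_def[abs_def])
  qed
  then show ?thesis using recursion psi_limit by blast
qed

end
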